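(* Let $\alpha,\beta,n,p,k\in\mathbb{R}$ and $0<R<\infty$ with $\alpha>-1$, $n\ge1$, $p\ge1$, and $k\ge1$, and let $w$ be one of the weights $w_0(r)=\left(\ln\frac{1}{r}\right)^{\frac{\beta n}{2}}$ or $w_1(r)=\left(\ln\frac{\mathrm{e}}{r}\right)^{\frac{\beta n}{2}}$ on $(0,R)$. In the case $w=w_0$, assume additionally $\beta n<2k$. (i) If $k<\frac n2$, then the continuous embedding $$X^{1,k+1}_{R,w}\hookrightarrow L^p_\alpha(0,R)\quad\text{holds for all }1\le p\le k^*:=\frac{(\alpha+1)(k+1)}{n-2k},$$ where for $p=k^*$ one additionally assumes: if $w=w_0$, then $\beta\ge0$ when $\alpha+1\ge n-2k$, and $\frac{\beta n}{2}>\frac{n-2k}{\alpha+1}-1$ when $\alpha+1<n-2k$; if $w=w_1$, then $\beta\ge0$. Moreover, assuming $\alpha\ge0$, the embedding is compact for $1\le p<k^*$. (ii) If $k=\frac n2$, then the continuous embedding $X^{1,k+1}_{R,w}\hookrightarrow L^p_\alpha(0,R)$ holds for all $1\le p<\infty$. Moreover, the embedding is compact if $\alpha\ge0$.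
   Context: $AC_R(0,R)$ is the set of locally absolutely continuous $v\colon(0,R)\to\mathbb{R}$ with $\lim_{r\to R}v(r)=0$. $X^{1,k+1}_{R,w}$ is the closure, with respect to $\|\cdot\|_w$, of the set of $v\in AC_R(0,R)$ with $$\|v\|_w=\Big(c_n\int_0^R r^{n-k}|v'(r)|^{k+1}w(r)\,\mathrm{d}r\Big)^{\frac{1}{k+1}}<\infty,$$ where $c_n>0$ is a fixed positive constant (for integers $1\le k\le n$ it is $c_n=\frac{\omega_{n-1}}{k}\binom{n-1}{k-1}$, $\omega_{n-1}$ being the area of the unit sphere in $\mathbb{R}^n$). $L^p_\alpha(0,R)$ is the space of Lebesgue measurable $v\colon(0,R)\to\mathbb{R}$ with $\|v\|_{L^p_\alpha}=\left(\int_0^R r^\alpha|v|^p\,\mathrm{d}r\right)^{1/p}<\infty$.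
   Formalization: For w=w1 two conditions are added: at p=k* with α+1<n−2k, also βn/2>(n−2k)/(α+1)−1; and if R≥e, also βn<2k (the claim fails otherwise). The logarithms in w0, w1 are taken in absolute value so that the weights are defined on all of (0,R). *)

theory Defs
  imports "HOL-Analysis.Analysis"
begin

text \<open>
  Functions on the interval \<open>(0,R)\<close> are represented by total functions on the reals; everything
  below depends only on their values on \<open>{0<..<R}\<close>.
\<close>

definition absolutely_continuous_on :: "real set \<Rightarrow> (real \<Rightarrow> real) \<Rightarrow> bool" where
  "absolutely_continuous_on S f \<longleftrightarrow>
    (\<forall>\<epsilon>>0. \<exists>\<delta>>0. \<forall>d T. d division_of T \<and> T \<subseteq> S \<and> (\<Sum>K\<in>d. Sup K - Inf K) < \<delta> \<longrightarrow>
       (\<Sum>K\<in>d. \<bar>f (Sup K) - f (Inf K)\<bar>) < \<epsilon>)"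

definition AC_R :: "real \<Rightarrow> (real \<Rightarrow> real) set" where
  "AC_R R = {v. (\<forall>a b. 0 < a \<and> a \<le> b \<and> b < R \<longrightarrow> absolutely_continuous_on {a..b} v) \<and>
                (v \<longlongrightarrow> 0) (at_left R)}"

text \<open>
  The parameter \<open>c\<close> is the fixed positive constant \<open>c\<^sub>n\<close>. The Bochner integral is \<open>0\<close> on
  non-integrable functions, so \<open>norm_w\<close> is meaningful only for functions in \<open>finite_norm_w\<close>.
\<close>

definition norm_w :: "real \<Rightarrow> real \<Rightarrow> real \<Rightarrow> real \<Rightarrow> (real \<Rightarrow> real) \<Rightarrow> (real \<Rightarrow> real) \<Rightarrow> real" where
  "norm_w c n k R w v =
    (c * (LINT r:{0<..<R}|lebesgue. r powr (n - k) * \<bar>deriv v r\<bar> powr (k + 1) * w r))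
      powr (1 / (k + 1))"

definition finite_norm_w :: "real \<Rightarrow> real \<Rightarrow> real \<Rightarrow> (real \<Rightarrow> real) \<Rightarrow> (real \<Rightarrow> real) set" where
  "finite_norm_w n k R w = {v \<in> AC_R R.
    set_integrable lebesgue {0<..<R} (\<lambda>r. r powr (n - k) * \<bar>deriv v r\<bar> powr (k + 1) * w r)}"

text \<open>The closure is taken inside \<open>AC_R R\<close>, as convergence in norm of sequences.\<close>

definition X_space :: "real \<Rightarrow> real \<Rightarrow> real \<Rightarrow> real \<Rightarrow> (real \<Rightarrow> real) \<Rightarrow> (real \<Rightarrow> real) set" where
  "X_space c n k R w = {v \<in> AC_R R. \<exists>u :: nat \<Rightarrow> real \<Rightarrow> real.
    (\<forall>j. u j \<in> finite_norm_w n k R w \<and> (\<lambda>r. u j r - v r) \<in> finite_norm_w n k R w) \<and>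
    (\<lambda>j. norm_w c n k R w (\<lambda>r. u j r - v r)) \<longlonglongrightarrow> 0}"

definition L_space :: "real \<Rightarrow> real \<Rightarrow> real \<Rightarrow> (real \<Rightarrow> real) set" where
  "L_space p \<alpha> R = {v. v \<in> borel_measurable (lebesgue_on {0<..<R}) \<and>
    set_integrable lebesgue {0<..<R} (\<lambda>r. r powr \<alpha> * \<bar>v r\<bar> powr p)}"

definition norm_L :: "real \<Rightarrow> real \<Rightarrow> real \<Rightarrow> (real \<Rightarrow> real) \<Rightarrow> real" where
  "norm_L p \<alpha> R v = (LINT r:{0<..<R}|lebesgue. r powr \<alpha> * \<bar>v r\<bar> powr p) powr (1 / p)"

definition continuous_embedding ::
  "(real \<Rightarrow> real) set \<Rightarrow> ((real \<Rightarrow> real) \<Rightarrow> real) \<Rightarrow>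
   (real \<Rightarrow> real) set \<Rightarrow> ((real \<Rightarrow> real) \<Rightarrow> real) \<Rightarrow> bool" where
  "continuous_embedding X nX Y nY \<longleftrightarrow> X \<subseteq> Y \<and> (\<exists>C. \<forall>v\<in>X. nY v \<le> C * nX v)"

definition compact_embedding ::
  "(real \<Rightarrow> real) set \<Rightarrow> ((real \<Rightarrow> real) \<Rightarrow> real) \<Rightarrow>
   (real \<Rightarrow> real) set \<Rightarrow> ((real \<Rightarrow> real) \<Rightarrow> real) \<Rightarrow> bool" where
  "compact_embedding X nX Y nY \<longleftrightarrow> continuous_embedding X nX Y nY \<and>
    (\<forall>u :: nat \<Rightarrow> real \<Rightarrow> real. (\<forall>j. u j \<in> X) \<and> (\<exists>B. \<forall>j. nX (u j) \<le> B) \<longrightarrow>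
      (\<exists>v\<in>Y. \<exists>s :: nat \<Rightarrow> nat. strict_mono s \<and> (\<lambda>j. nY (\<lambda>r. u (s j) r - v r)) \<longlonglongrightarrow> 0))"

text \<open>
  The absolute values are redundant wherever the logarithm is nonnegative, i.e. on \<open>(0,1]\<close> for
  \<open>w0\<close> and on \<open>(0,e]\<close> for \<open>w1\<close>. For larger \<open>r\<close> a real power of the logarithm is undefined; the
  absolute value makes the weights meaningful on \<open>(0,R)\<close> for every finite \<open>R\<close>.
  When \<open>\<beta> * n \<ge> 2 * k\<close>, the zero of the weight (at \<open>1\<close> for \<open>w0\<close>, at \<open>e\<close> for \<open>w1\<close>) is strong
  enough for functions to drop to \<open>0\<close> across it at arbitrarily small norm cost. For \<open>w0\<close> the source
  excludes this by assuming \<open>\<beta> * n < 2 * k\<close>; for \<open>w1\<close> it matters only if \<open>R \<ge> e\<close>.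
\<close>

definition w0 :: "real \<Rightarrow> real \<Rightarrow> real \<Rightarrow> real" where
  "w0 \<beta> n r = \<bar>ln (1 / r)\<bar> powr (\<beta> * n / 2)"

definition w1 :: "real \<Rightarrow> real \<Rightarrow> real \<Rightarrow> real" where
  "w1 \<beta> n r = \<bar>ln (exp 1 / r)\<bar> powr (\<beta> * n / 2)"

definition k_star :: "real \<Rightarrow> real \<Rightarrow> real \<Rightarrow> real" where
  "k_star \<alpha> n k = (\<alpha> + 1) * (k + 1) / (n - 2 * k)"

text \<open>
  The condition at the endpoint \<open>p = k_star \<alpha> n k\<close>. For \<open>w1\<close> the source asks only for \<open>\<beta> \<ge> 0\<close>, which
  does not suffice when \<open>\<alpha> + 1 < n - 2 * k\<close>: for \<open>k = 1\<close>, \<open>n = 6\<close>, \<open>\<alpha> = 1\<close>, \<open>\<beta> = 0\<close>, \<open>R = 1\<close> one has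
  \<open>k_star \<alpha> n k = 1\<close>, and \<open>v r\<close> = integral of \<open>1 / (s ^ 3 * ln (e / s))\<close> over \<open>s \<in> (r,1)\<close> has finite
  norm in the source space, while the integral of \<open>r * v r\<close> over \<open>(0,1)\<close> diverges. Both weights
  behave alike near \<open>0\<close>, so in that range \<open>w1\<close> gets the condition of \<open>w0\<close>.
\<close>

definition endpoint_w0 :: "real \<Rightarrow> real \<Rightarrow> real \<Rightarrow> real \<Rightarrow> bool" where
  "endpoint_w0 \<alpha> \<beta> n k \<longleftrightarrow>
    (\<alpha> + 1 \<ge> n - 2 * k \<longrightarrow> \<beta> \<ge> 0) \<and>
    (\<alpha> + 1 < n - 2 * k \<longrightarrow> \<beta> * n / 2 > (n - 2 * k) / (\<alpha> + 1) - 1)"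

definition endpoint_w1 :: "real \<Rightarrow> real \<Rightarrow> real \<Rightarrow> real \<Rightarrow> bool" where
  "endpoint_w1 \<alpha> \<beta> n k \<longleftrightarrow>
    \<beta> \<ge> 0 \<and>
    (\<alpha> + 1 < n - 2 * k \<longrightarrow> \<beta> * n / 2 > (n - 2 * k) / (\<alpha> + 1) - 1)"

end

(*
  An absolutely continuous v is differentiable almost everywhere (Vitali) and increases by the integral
  of v', so |v(r)| is at most the integral of |v'| over (r,R). By Hoelder's inequality this is at most
  a constant times the norm of v times r^(-kappa), where kappa = (n-2k)/(k+1) up to an arbitrarily small
  loss caused by the logarithm. Below the critical exponent r^alpha r^(-kappa p) is integrable; the
  same estimate on short intervals gives equicontinuity, and dominated convergence then gives compactness.
  At p = k* one needs Hardy's inequality: the integral of r^(n-2k-1) L(r)^b |v|^(k+1), L(r) = ln(e^2 R/r),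
  b = beta n/2, is bounded by the norm to the power k+1. If p >= k+1, the remaining power of |v| is
  bounded pointwise; if p < k+1, Hoelder's inequality reduces the claim to the convergence of the
  integral of 1/(r L(r)^sigma) at 0, and the hypothesis on beta says exactly that sigma > 1.
*)

theory Submission
  imports Defs "HOL-Complex_Analysis.Great_Picard"
begin

section \<open>Divisions and Vitali coverings\<close>

text \<open>Both weights have the form \<open>\<bar>ln (A / r)\<bar> powr b\<close> with A = 1 or A
  = e and b = \<beta>n/2, so they may vanish or blow up at an interior point r = A. Hoelder's
  inequality brings in w^(-1/k), whose singularity at A is integrable exactly if b < k; otherwise R
  < A is assumed. This shapes \<open>tame\<close>, which asks for boundedness near 0 but only for
  integrability elsewhere, and it is why equicontinuity comes from the continuity of a primitive and
  not from a Lipschitz bound. Every v in the closure has finite norm itself. All estimates can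
  therefore be stated for one v, a Borel majorant \<phi> of its slope and a bound on the energy of
  \<phi>, with constants that do not depend on v; no estimate has to be passed to a limit in the
  norm. Below the critical exponent a spare power r^\<epsilon> swallows every logarithm at 0. At the
  critical exponent there is none to spare, and w is compared with L^b instead: the quotient of the
  two logarithms tends to 1 at 0. The factor e^2 R keeps L above 2 on (0,R), so L^b causes no
  trouble at the outer end.\<close>

lemma sum_division_increments:
  fixes f :: "real \<Rightarrow> real"
  assumes "d division_of {a..b}" and "a \<le> b"
  shows "(\<Sum>K\<in>d. f (Sup K) - f (Inf K)) = f b - f a"
proof -
  note D = division_ofD[OF assms(1)]
  have inK: "Inf K \<in> K" if K: "K \<in> d" for K
  proof -
    obtain u v where uv: "K = {u..v}" using D(4)[OF K] by auto
    with D(3)[OF K] show ?thesis by auto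
  qed
  \<comment> \<open>Tagging each interval by its left end point gives access to the telescoping
    identity for tagged divisions.\<close>
  let ?p = "(\<lambda>K. (Inf K, K)) ` d"
  have "?p tagged_division_of {a..b}"
  proof (rule tagged_division_ofI)
    show "finite ?p" using D(1) by simp
    show "interior K1 \<inter> interior K2 = {}"
      if "(x1, K1) \<in> ?p" "(x2, K2) \<in> ?p" "(x1, K1) \<noteq> (x2, K2)" for x1 K1 x2 K2
      using that D(5)[of K1 K2] by auto
    show "\<Union>{K. \<exists>x. (x, K) \<in> ?p} = {a..b}"
    proof -
      have "{K. \<exists>x. (x, K) \<in> ?p} = d" by auto
      then show ?thesis using D(6) by simp
    qed
    show "\<exists>a b. K = cbox a b" if "(x, K) \<in> ?p" for x K using that D(4)[of K] by auto
    show "K \<subseteq> {a..b}" if "(x, K) \<in> ?p" for x K using that D(2)[of K] by auto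
    show "x \<in> K" if "(x, K) \<in> ?p" for x K using that inK by auto
  qed
  from additive_tagged_division_1[OF assms(2) this, of f]
  have "(\<Sum>(x,K)\<in>?p. f (Sup K) - f (Inf K)) = f b - f a" .
  moreover have "(\<Sum>(x,K)\<in>?p. f (Sup K) - f (Inf K)) = (\<Sum>K\<in>d. f (Sup K) - f (Inf K))"
    by (subst sum.reindex) (auto simp: inj_on_def)
  ultimately show ?thesis by simp
qed

text \<open>Divisions may contain one-point intervals, so divisions of sets with disjoint interiors
  need not be disjoint as families. A shared interval has empty interior, hence is a point and
  contributes nothing; this lets sums over unions of divisions be split.\<close>

lemma division_null_overlap:
  fixes d e :: "real set set"
  assumes d: "d division_of S" and e: "e division_of T" and "interior S \<inter> interior T = {}"
    and K: "K \<in> d \<inter> e"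
  shows "f (Sup K) - f (Inf K) = (0::real)"
proof -
  obtain u v where uv: "K = {u..v}" using division_ofD(4)[OF d, of K] K by auto
  have ne: "K \<noteq> {}" using division_ofD(3)[OF d, of K] K by auto
  have "interior K \<subseteq> interior S \<inter> interior T"
    using division_ofD(2)[OF d, of K] division_ofD(2)[OF e, of K] K by (simp add: interior_mono)
  then have "interior K = {}" using assms(3) by auto
  then have "u = v" using uv ne by (auto simp: interior_atLeastAtMost_real)
  then show ?thesis using uv by simp
qed

text \<open>Extend \<open>d\<close> to a division of the whole interval. The added intervals
  \<open>?r\<close> complete \<open>e\<close> just as well, and both completed sums telescope to
  \<open>f b - f a\<close>, so the two original sums differ from it by the same amount.\<close>

lemma sum_division_increments_unique:
  fixes f :: "real \<Rightarrow> real"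
  assumes d: "d division_of T" and e: "e division_of T" and T: "T \<subseteq> {a..b}"
  shows "(\<Sum>K\<in>d. f (Sup K) - f (Inf K)) = (\<Sum>K\<in>e. f (Sup K) - f (Inf K))"
proof (cases "a \<le> b")
  case True
  have "d division_of \<Union>d" "\<Union>d = T" using d by auto
  then obtain q where q: "d \<subseteq> q" "q division_of {a..b}"
    using partial_division_extend_interval[of d a b] T by auto
  let ?r = "q - d"
  have qU: "q division_of \<Union>q" using q(2) by auto
  have r: "?r division_of \<Union>?r" using division_of_subset[OF qU] by auto
  have disj: "interior T \<inter> interior (\<Union>?r) = {}"
  proof -
    have "finite ?r" using r by auto
    have "interior T \<inter> interior (\<Union>?r) = {}"
    proof (rule Int_interior_Union_intervals)
      show "finite ?r" by fact
      show "open (interior T)" by simp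
      show "\<exists>a b. K = cbox a b" if "K \<in> ?r" for K using that division_ofD(4)[OF q(2), of K] by auto
      show "interior T \<inter> interior K = {}" if K: "K \<in> ?r" for K
      proof -
        have "interior K \<inter> interior (\<Union>d) = {}"
        proof (rule Int_interior_Union_intervals)
          show "finite d" using d by auto
          show "open (interior K)" by simp
          show "\<exists>a b. L = cbox a b" if "L \<in> d" for L using that division_ofD(4)[OF d, of L] by auto
          show "interior K \<inter> interior L = {}" if "L \<in> d" for L
            using that K q division_ofD(5)[OF q(2), of K L] by auto
        qed
        then show ?thesis using \<open>\<Union>d = T\<close> by auto
      qed
    qed
    then show ?thesis by auto
  qed
  have *: "(\<Sum>K\<in>c. f (Sup K) - f (Inf K)) + (\<Sum>K\<in>?r. f (Sup K) - f (Inf K)) = f b - f a"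
    if c: "c division_of T" for c
  proof -
    have "c \<union> ?r division_of (T \<union> \<Union>?r)"
      by (rule division_disjoint_union[OF c r disj])
    moreover have "T \<union> \<Union>?r = {a..b}"
      unfolding \<open>\<Union>d = T\<close>[symmetric] division_ofD(6)[OF q(2), symmetric] using q(1) by blast
    ultimately have "(\<Sum>K\<in>c \<union> ?r. f (Sup K) - f (Inf K)) = f b - f a"
      using sum_division_increments[OF _ True] by simp
    moreover have "(\<Sum>K\<in>c \<union> ?r. f (Sup K) - f (Inf K)) =
       (\<Sum>K\<in>c. f (Sup K) - f (Inf K)) + (\<Sum>K\<in>?r. f (Sup K) - f (Inf K))"
      by (rule sum.union_inter_neutral)
        (use c r division_null_overlap[OF c r disj] in auto)
    ultimately show ?thesis by simp
  qed
  show ?thesis using *[OF d] *[OF e] by simp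
next
  case False
  then have "T = {}" using T by auto
  then show ?thesis using d e by simp
qed

lemma measure_division_real:
  fixes d :: "real set set"
  assumes d: "d division_of T"
  shows "measure lebesgue T = (\<Sum>K\<in>d. Sup K - Inf K)"
proof -
  have "measure lebesgue (\<Union>d) = (\<Sum>K\<in>d. measure lebesgue K)"
  proof (rule measure_negligible_finite_Union)
    show "finite d" using d by auto
    show "K \<in> lmeasurable" if "K \<in> d" for K using that division_ofD(4)[OF d, of K] by auto
    show "pairwise (\<lambda>S T. negligible (S \<inter> T)) d"
    proof (rule pairwiseI)
      fix K L assume KL: "K \<in> d" "L \<in> d" "K \<noteq> L"
      obtain u v where 1: "K = cbox u v" using division_ofD(4)[OF d KL(1)] by auto
      obtain u' v' where 2: "L = cbox u' v'" using division_ofD(4)[OF d KL(2)] by auto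
      have "interior (K \<inter> L) = {}" using division_ofD(5)[OF d KL] by simp
      then show "negligible (K \<inter> L)"
        unfolding 1 2 Int_interval interior_cbox negligible_interval(1) .
    qed
  qed
  also have "\<dots> = (\<Sum>K\<in>d. Sup K - Inf K)"
  proof (rule sum.cong[OF refl])
    fix K assume K: "K \<in> d"
    obtain u v where "K = {u..v}" using division_ofD(4)[OF d K] by auto
    with division_ofD(3)[OF d K] show "measure lebesgue K = Sup K - Inf K" by auto
  qed
  finally show ?thesis using division_ofD(6)[OF d] by simp
qed

lemma lmeasurable_division:
  fixes d :: "real set set"
  assumes d: "d division_of T"
  shows "T \<in> lmeasurable"
proof -
  have "\<Union>d \<in> lmeasurable"
    using division_ofD(1,4)[OF d] by (intro fmeasurable.finite_Union) auto
  then show ?thesis using division_ofD(6)[OF d] by simp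
qed

text \<open>The Vitali covering theorem gives countably many disjoint intervals that exhaust E up to
  a null set; finitely many of them already leave less than \<open>e\<close>. The point x only has
  to lie inside its interval, not at the centre.\<close>

lemma finite_Vitali_intervals:
  fixes E :: "real set"
  assumes E: "E \<in> lmeasurable" and U: "open U" "E \<subseteq> U" and e: "0 < e"
    and cov: "\<And>x d. x \<in> E \<Longrightarrow> 0 < d \<Longrightarrow> \<exists>u v. u < x \<and> x < v \<and> v - u < d \<and> P u v"
  obtains D where "D division_of \<Union>D" "\<Union>D \<subseteq> U" "measure lebesgue (E - \<Union>D) < e"
    "\<And>K. K \<in> D \<Longrightarrow> Inf K < Sup K \<and> P (Inf K) (Sup K)"
proof -
  define I where "I = {(u,v). u < v \<and> P u v \<and> {u..v} \<subseteq> U}"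
  \<comment> \<open>On the line an interval is the closed ball about its midpoint, so the covering
    theorem for balls applies.\<close>
  define ctr where "ctr = (\<lambda>(u,v::real). (u + v) / 2)"
  define rad where "rad = (\<lambda>(u,v::real). (v - u) / 2)"
  have cb: "cball (ctr i) (rad i) = {fst i..snd i}" for i
    by (cases i) (simp add: ctr_def rad_def cball_eq_atLeastAtMost field_simps)
  have "\<exists>i. i \<in> I \<and> x \<in> cball (ctr i) (rad i) \<and> rad i < d" if x: "x \<in> E" and d: "0 < d" for x d
  proof -
    obtain \<rho> where \<rho>: "\<rho> > 0" "ball x \<rho> \<subseteq> U" using U x by (meson openE subsetD)
    obtain u v where uv: "u < x" "x < v" "v - u < min d \<rho>" "P u v"
      using cov[OF x, of "min d \<rho>"] d \<rho> by auto
    have "{u..v} \<subseteq> ball x \<rho>" using uv by (auto simp: dist_real_def)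
    then have "(u,v) \<in> I" using uv \<rho> by (auto simp: I_def)
    then show ?thesis using uv by (intro exI[of _ "(u,v)"]) (auto simp: cb, auto simp: rad_def)
  qed
  note Vcov = this
  have Vrad: "0 < rad i" if "i \<in> I" for i using that by (auto simp: I_def rad_def)
  obtain C where C: "countable C" "C \<subseteq> I"
     "pairwise (\<lambda>i j. disjnt (cball (ctr i) (rad i)) (cball (ctr j) (rad j))) C"
     "negligible (E - (\<Union>i \<in> C. cball (ctr i) (rad i)))"
    by (rule Vitali_covering_theorem_cballs[of I rad E ctr]) (use Vrad Vcov in blast)+
  \<comment> \<open>The traces on E are used instead of the intervals, because finite unions of them
    have measure at most that of E, the bound needed to approximate the countable union by a finite
    one.\<close>
  define \<D> where "\<D> = (\<lambda>i. E \<inter> {fst i..snd i}) ` C"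
  have m: "X \<in> lmeasurable" if "X \<in> \<D>" for X
    using that E by (auto simp: \<D>_def intro!: fmeasurable.Int)
  have cD: "countable \<D>" using C(1) by (simp add: \<D>_def)
  have B: "measure lebesgue (\<Union>D') \<le> measure lebesgue E" if "D' \<subseteq> \<D>" "finite D'" for D'
  proof (rule measure_mono_fmeasurable)
    show "\<Union>D' \<subseteq> E" using that(1) by (auto simp: \<D>_def)
    show "\<Union>D' \<in> sets lebesgue"
      using that m by (intro sets.finite_Union) (auto intro: fmeasurableD)
  qed (rule E)
  obtain D' where D': "D' \<subseteq> \<D>" "finite D'" "measure lebesgue (\<Union>\<D>) - e < measure lebesgue (\<Union>D')"
    by (rule measure_countable_Union_approachable[OF cD e m B]) auto
  obtain C' where C': "C' \<subseteq> C" "finite C'" "D' = (\<lambda>i. E \<inter> {fst i..snd i}) ` C'"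
    using finite_subset_image[OF D'(2) D'(1)[unfolded \<D>_def]] by blast
  define D where "D = (\<lambda>i. {fst i..snd i}) ` C'"
  have inI: "fst i < snd i \<and> P (fst i) (snd i) \<and> {fst i..snd i} \<subseteq> U" if "i \<in> C'" for i
  proof -
    have "i \<in> I" using that C'(1) C(2) by blast
    then show ?thesis unfolding I_def by (cases i) simp
  qed
  have sub: "\<Union>D \<subseteq> U" unfolding D_def using inI by blast
  have div: "D division_of \<Union>D"
  proof (rule division_ofI)
    show "finite D" using C' by (simp add: D_def)
    show "K \<noteq> {}" if "K \<in> D" for K
    proof -
      obtain i where "i \<in> C'" "K = {fst i..snd i}" using \<open>K \<in> D\<close> unfolding D_def by blast
      then show ?thesis using inI[of i] by simp
    qed
    show "interior K1 \<inter> interior K2 = {}" if K: "K1 \<in> D" "K2 \<in> D" "K1 \<noteq> K2" for K1 K2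
    proof -
      obtain i where i: "i \<in> C'" "K1 = {fst i..snd i}" using K unfolding D_def by blast
      obtain j where j: "j \<in> C'" "K2 = {fst j..snd j}" using K unfolding D_def by blast
      have "i \<noteq> j" "i \<in> C" "j \<in> C" using i j K(3) C'(1) by auto
      then have "disjnt K1 K2" using C(3) i j by (simp add: pairwise_def cb)
      then have "K1 \<inter> K2 = {}" by (simp add: disjnt_def)
      moreover have "interior K1 \<subseteq> K1" "interior K2 \<subseteq> K2" by (rule interior_subset)+
      ultimately show ?thesis by blast
    qed
    show "\<exists>a b. K = cbox a b" if "K \<in> D" for K
      using \<open>K \<in> D\<close> unfolding D_def by (metis (lifting) image_iff cbox_interval)
  qed auto
  have UD: "\<Union>\<D> = E \<inter> (\<Union>i \<in> C. cball (ctr i) (rad i))" by (auto simp: \<D>_def cb)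
  have UD': "\<Union>D' = E \<inter> \<Union>D" unfolding C' D_def by auto
  have "measure lebesgue (\<Union>\<D>) = measure lebesgue E"
    unfolding UD
  proof (rule measure_negligible_symdiff[OF E])
    have "(E - E \<inter> (\<Union>i \<in> C. cball (ctr i) (rad i))) \<union> (E \<inter> (\<Union>i \<in> C. cball (ctr i) (rad i)) - E)
       = E - (\<Union>i \<in> C. cball (ctr i) (rad i))" by blast
    then show "negligible ((E - E \<inter> (\<Union>i \<in> C. cball (ctr i) (rad i))) \<union> (E \<inter> (\<Union>i \<in> C. cball (ctr i) (rad i)) - E))"
      using C(4) by simp
  qed
  moreover have "measure lebesgue (E - \<Union>D) = measure lebesgue E - measure lebesgue (E \<inter> \<Union>D)"
  proof -
    have "E - \<Union>D = E - (E \<inter> \<Union>D)" by auto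
    moreover have "E \<inter> \<Union>D \<in> sets lebesgue"
      using E lmeasurable_division[OF div] by (auto intro: fmeasurableD)
    ultimately show ?thesis using measurable_measure_Diff[OF E, of "E \<inter> \<Union>D"] by simp
  qed
  ultimately have "measure lebesgue (E - \<Union>D) < e" using D'(3) UD' by simp
  moreover have "Inf K < Sup K \<and> P (Inf K) (Sup K)" if "K \<in> D" for K
  proof -
    obtain i where i: "i \<in> C'" "K = {fst i..snd i}" using \<open>K \<in> D\<close> unfolding D_def by blast
    then show ?thesis using inI[OF i(1)] by simp
  qed
  ultimately show thesis using that div sub by blast
qed

section \<open>Differentiability of absolutely continuous functions\<close>

text \<open>Total length is rephrased as the measure of the union: smallness will come from outer
  regularity and from Vitali coverings, which speak of measures.\<close>

lemma absolutely_continuous_onD: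
  assumes "absolutely_continuous_on S f" and "\<epsilon> > 0"
  shows "\<exists>\<delta>>0. \<forall>d. d division_of \<Union>d \<longrightarrow> \<Union>d \<subseteq> S \<longrightarrow> measure lebesgue (\<Union>d) < \<delta> \<longrightarrow>
       (\<Sum>K\<in>d. \<bar>f (Sup K) - f (Inf K)\<bar>) < \<epsilon>"
proof -
  have "\<exists>\<delta>>0. \<forall>d T. d division_of T \<and> T \<subseteq> S \<and> (\<Sum>K\<in>d. Sup K - Inf K) < \<delta> \<longrightarrow>
       (\<Sum>K\<in>d. \<bar>f (Sup K) - f (Inf K)\<bar>) < \<epsilon>"
    by (rule assms(1)[unfolded absolutely_continuous_on_def, THEN spec, THEN mp, OF assms(2)])
  then obtain \<delta> where \<delta>: "\<delta> > 0" "\<forall>d T. d division_of T \<and> T \<subseteq> S \<and> (\<Sum>K\<in>d. Sup K - Inf K) < \<delta> \<longrightarrow>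
       (\<Sum>K\<in>d. \<bar>f (Sup K) - f (Inf K)\<bar>) < \<epsilon>"
    by blast
  show ?thesis
  proof (intro exI conjI allI impI)
    fix d :: "real set set"
    assume d: "d division_of \<Union>d" "\<Union>d \<subseteq> S" "measure lebesgue (\<Union>d) < \<delta>"
    show "(\<Sum>K\<in>d. \<bar>f (Sup K) - f (Inf K)\<bar>) < \<epsilon>"
      by (rule \<delta>(2)[rule_format, of d "\<Union>d"]) (use d measure_division_real[OF d(1)] in simp)
  qed (rule \<delta>(1))
qed

text \<open>
  Cover \<open>E\<close> up to a small set by intervals on which \<open>f\<close> has slope below \<open>p\<close>, then cover \<open>E\<close> inside
  these by intervals with slope above \<open>q\<close>. What is left between the two families has small measure,
  so by absolute continuity the two families have almost the same total increment.
\<close>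

lemma negligible_two_slopes:
  assumes ac: "absolutely_continuous_on {a..b} f"
    and E: "E \<in> lmeasurable" "E \<subseteq> {a<..<b}" and pq: "p < q"
    and lo: "\<And>x d. x \<in> E \<Longrightarrow> 0 < d \<Longrightarrow> \<exists>u v. u < x \<and> x < v \<and> v - u < d \<and> f v - f u < p * (v - u)"
    and hi: "\<And>x d. x \<in> E \<Longrightarrow> 0 < d \<Longrightarrow> \<exists>u v. u < x \<and> x < v \<and> v - u < d \<and> q * (v - u) < f v - f u"
  shows "negligible E"
proof (rule ccontr)
  assume nE: "\<not> negligible E"
  define m where "m = measure lebesgue E"
  have "m \<noteq> 0" using nE E(1) by (simp add: negligible_iff_measure m_def)
  then have m: "m > 0" unfolding m_def by (simp add: zero_less_measure_iff)
  \<comment> \<open>The final contradiction compares \<open>(q - p) * T1 < 2 * \<epsilon>\<close>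
    with \<open>T1 \<ge> m / 2\<close>, so \<open>2 * \<epsilon>\<close> has to equal
    \<open>(q - p) * m / 2\<close>.\<close>
  define \<epsilon> where "\<epsilon> = (q - p) * m / 4"
  have \<epsilon>: "\<epsilon> > 0" using pq m by (simp add: \<epsilon>_def)
  obtain \<delta> where \<delta>: "\<delta> > 0"
    "\<forall>d. d division_of \<Union>d \<longrightarrow> \<Union>d \<subseteq> {a..b} \<longrightarrow> measure lebesgue (\<Union>d) < \<delta> \<longrightarrow>
       (\<Sum>K\<in>d. \<bar>f (Sup K) - f (Inf K)\<bar>) < \<epsilon>"
    using absolutely_continuous_onD[OF ac \<epsilon>] by blast
  \<comment> \<open>The two coverings will satisfy
    \<open>m - 2 * \<eta> < T2 \<le> T1 < m + \<eta>\<close>. The three bounds on \<eta> make the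
    gap \<open>3 * \<eta>\<close> smaller than \<delta>, keep T2 above \<open>m / 2\<close>, and
    make q times the gap at most \<epsilon>.\<close>
  define \<eta> where "\<eta> = min (\<delta> / 4) (min (m / 4) (\<epsilon> / (3 * (\<bar>q\<bar> + 1))))"
  have \<eta>: "\<eta> > 0" "\<eta> \<le> \<delta> / 4" "\<eta> \<le> m / 4" "3 * \<eta> * \<bar>q\<bar> \<le> \<epsilon>"
  proof -
    have "\<eta> \<le> \<epsilon> / (3 * (\<bar>q\<bar> + 1))" unfolding \<eta>_def by auto
    then have *: "\<eta> * (3 * (\<bar>q\<bar> + 1)) \<le> \<epsilon>" by (simp add: pos_le_divide_eq)
    show "\<eta> > 0" using \<delta>(1) m \<epsilon> by (auto simp: \<eta>_def)
    then show "3 * \<eta> * \<bar>q\<bar> \<le> \<epsilon>" using * by (simp add: algebra_simps)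
    show "\<eta> \<le> \<delta> / 4" "\<eta> \<le> m / 4" unfolding \<eta>_def by linarith+
  qed
  obtain V where V: "open V" "E \<subseteq> V" "V - E \<in> lmeasurable" "emeasure lebesgue (V - E) < ennreal \<eta>"
    using sets_lebesgue_outer_open[OF fmeasurableD[OF E(1)] \<eta>(1)] by blast
  define U where "U = V \<inter> {a<..<b}"
  have U: "open U" "E \<subseteq> U" "U \<subseteq> {a<..<b}" using V E by (auto simp: U_def)
  have Um: "U \<in> lmeasurable"
    using U bounded_subset[OF _ U(3)] by (intro lmeasurable_open) auto
  have UE: "measure lebesgue U < m + \<eta>"
  proof -
    have 1: "measure lebesgue (V - E) < \<eta>"
      using V(3,4) \<eta>(1) by (metis emeasure_eq_measure2 ennreal_less_iff measure_nonneg)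
    have "measure lebesgue U \<le> measure lebesgue (E \<union> (V - E))"
      by (rule measure_mono_fmeasurable)
        (use V(3) E(1) Um in \<open>auto simp: U_def simp del: Un_Diff_cancel intro: fmeasurableD fmeasurable.Un\<close>)
    also have "\<dots> \<le> measure lebesgue E + measure lebesgue (V - E)"
      by (rule measure_Un_le) (use E V in \<open>auto intro: fmeasurableD\<close>)
    finally show ?thesis using 1 by (simp add: m_def)
  qed
  obtain D where D: "D division_of \<Union>D" "\<Union>D \<subseteq> U" "measure lebesgue (E - \<Union>D) < \<eta>"
      "\<And>K. K \<in> D \<Longrightarrow> Inf K < Sup K \<and> f (Sup K) - f (Inf K) < p * (Sup K - Inf K)"
    using finite_Vitali_intervals[OF E(1) U(1,2) \<eta>(1) lo] by blast
  \<comment> \<open>Working in the interiors forces the second family into \<Union>D, so that it can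
    be completed to a division of \<Union>D; only finitely many end points of E are lost.\<close>
  define U' where "U' = (\<Union>K\<in>D. interior K)"
  have U': "open U'" "U' \<subseteq> \<Union>D" using interior_subset by (auto simp: U'_def)
  have D_meas: "\<Union>D \<in> lmeasurable" by (rule lmeasurable_division[OF D(1)])
  have U'm: "U' \<in> lmeasurable"
    using U' D_meas by (meson D(1) bounded_subset elementary_bounded lmeasurable_open)
  have bdry: "negligible (\<Union>D - U')"
  proof (rule negligible_subset)
    show "negligible (\<Union>K\<in>D. {Inf K, Sup K})" using D(1) by (intro negligible_finite) auto
    show "\<Union>D - U' \<subseteq> (\<Union>K\<in>D. {Inf K, Sup K})"
    proof
      fix x assume x: "x \<in> \<Union>D - U'"
      then obtain K where K: "K \<in> D" "x \<in> K" "x \<notin> interior K" by (auto simp: U'_def)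
      obtain u v where uv: "K = {u..v}" using division_ofD(4)[OF D(1) K(1)] by auto
      have "x = u \<or> x = v" using K(2,3) unfolding uv by (auto simp: interior_atLeastAtMost_real)
      then have "x \<in> {Inf K, Sup K}" using K(2) by (auto simp: uv)
      then show "x \<in> (\<Union>K\<in>D. {Inf K, Sup K})" using K(1) by blast
    qed
  qed
  have EU': "measure lebesgue (E - U') < \<eta>"
  proof -
    have "measure lebesgue (E - U') \<le> measure lebesgue ((E - \<Union>D) \<union> (\<Union>D - U'))"
      by (rule measure_mono_fmeasurable)
        (use E U'm D_meas in \<open>auto intro: fmeasurableD fmeasurable.Un fmeasurable.Diff\<close>)
    also have "\<dots> \<le> measure lebesgue (E - \<Union>D) + measure lebesgue (\<Union>D - U')"
      by (rule measure_Un_le) (use E U'm D_meas in \<open>auto intro: fmeasurableD\<close>)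
    also have "measure lebesgue (\<Union>D - U') = 0" by (rule negligible_imp_measure0[OF bdry])
    finally show ?thesis using D(3) by simp
  qed
  have E'm: "E \<inter> U' \<in> lmeasurable" using E U'm by (auto intro: fmeasurableD fmeasurable.Int)
  have hi': "\<exists>u v. u < x \<and> x < v \<and> v - u < d \<and> q * (v - u) < f v - f u"
    if "x \<in> E \<inter> U'" "0 < d" for x d using hi[of x d] that by simp
  obtain D2 where D2: "D2 division_of \<Union>D2" "\<Union>D2 \<subseteq> U'" "measure lebesgue (E \<inter> U' - \<Union>D2) < \<eta>"
      "\<And>K. K \<in> D2 \<Longrightarrow> Inf K < Sup K \<and> q * (Sup K - Inf K) < f (Sup K) - f (Inf K)"
    using finite_Vitali_intervals[OF E'm U'(1) Int_lower2 \<eta>(1) hi'] by blast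
  have D2_meas: "\<Union>D2 \<in> lmeasurable" by (rule lmeasurable_division[OF D2(1)])
  define T1 where "T1 = measure lebesgue (\<Union>D)"
  define T2 where "T2 = measure lebesgue (\<Union>D2)"
  have T2: "m - 2 * \<eta> < T2"
  proof -
    have "m \<le> measure lebesgue ((E - U') \<union> ((E \<inter> U' - \<Union>D2) \<union> \<Union>D2))"
      unfolding m_def by (rule measure_mono_fmeasurable)
        (use E U'm D2_meas E'm in \<open>auto intro: fmeasurableD fmeasurable.Un fmeasurable.Diff\<close>)
    also have "\<dots> \<le> measure lebesgue (E - U') + measure lebesgue ((E \<inter> U' - \<Union>D2) \<union> \<Union>D2)"
      by (rule measure_Un_le) (use E U'm E'm D2_meas in \<open>auto intro: fmeasurableD\<close>)
    also have "measure lebesgue ((E \<inter> U' - \<Union>D2) \<union> \<Union>D2) \<le> measure lebesgue (E \<inter> U' - \<Union>D2) + T2"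
      unfolding T2_def by (rule measure_Un_le) (use E U'm E'm D2_meas in \<open>auto intro: fmeasurableD\<close>)
    finally show ?thesis using EU' D2(3) by linarith
  qed
  have T12: "T2 \<le> T1" unfolding T1_def T2_def
    by (rule measure_mono_fmeasurable) (use D2 U' D_meas D2_meas in \<open>auto intro: fmeasurableD\<close>)
  have T1: "T1 < m + \<eta>"
  proof -
    have "T1 \<le> measure lebesgue U" unfolding T1_def
      by (rule measure_mono_fmeasurable) (use D Um D_meas in \<open>auto intro: fmeasurableD\<close>)
    then show ?thesis using UE by simp
  qed
  obtain r where r: "D2 \<subseteq> r" "r division_of \<Union>D"
    using partial_division_extend[OF D2(1) D(1)] D2(2) U'(2) by blast
  have fin: "finite r" "finite D" "finite D2" using r(2) D(1) D2(1) by auto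
  have rU: "r division_of \<Union>r" using r(2) by auto
  have G: "r - D2 division_of \<Union>(r - D2)" by (rule division_of_subset[OF rU]) auto
  have "{a<..<b} \<subseteq> {a..b}" by auto
  then have sub: "\<Union>D \<subseteq> {a..b}" using D(2) U(3) by (meson order_trans)
  have "measure lebesgue (\<Union>(r - D2)) = T1 - T2"
  proof -
    have "measure lebesgue (\<Union>(r - D2)) = (\<Sum>K\<in>r - D2. Sup K - Inf K)"
      by (rule measure_division_real[OF G])
    also have "\<dots> = (\<Sum>K\<in>r. Sup K - Inf K) - (\<Sum>K\<in>D2. Sup K - Inf K)"
      by (rule sum_diff[OF fin(1) r(1)])
    finally show ?thesis
      unfolding T1_def T2_def using measure_division_real[OF r(2)] measure_division_real[OF D2(1)] by simp
  qed
  then have "measure lebesgue (\<Union>(r - D2)) < \<delta>" using T1 T2 \<eta>(1,2) \<delta>(1) by linarith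
  moreover have "\<Union>(r - D2) \<subseteq> {a..b}" using sub division_ofD(6)[OF r(2)] by blast
  ultimately have *: "(\<Sum>K\<in>r - D2. \<bar>f (Sup K) - f (Inf K)\<bar>) < \<epsilon>" using \<delta>(2) G by blast
  have "(\<Sum>K\<in>D. f (Sup K) - f (Inf K)) = (\<Sum>K\<in>r. f (Sup K) - f (Inf K))"
    by (rule sum_division_increments_unique[OF D(1) r(2) sub])
  also have "\<dots> = (\<Sum>K\<in>D2. f (Sup K) - f (Inf K)) + (\<Sum>K\<in>r - D2. f (Sup K) - f (Inf K))"
    using sum_diff[OF fin(1) r(1), of "\<lambda>K. f (Sup K) - f (Inf K)"] by simp
  finally have **: "(\<Sum>K\<in>D. f (Sup K) - f (Inf K)) > (\<Sum>K\<in>D2. f (Sup K) - f (Inf K)) - \<epsilon>"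
    using * sum_abs[of "\<lambda>K. f (Sup K) - f (Inf K)" "r - D2"] by linarith
  have "(\<Sum>K\<in>D. f (Sup K) - f (Inf K)) \<le> (\<Sum>K\<in>D. p * (Sup K - Inf K))"
    by (rule sum_mono) (use D(4) in \<open>force intro: less_imp_le\<close>)
  also have "\<dots> = p * T1"
    unfolding T1_def measure_division_real[OF D(1)] by (simp add: sum_distrib_left)
  finally have 1: "(\<Sum>K\<in>D. f (Sup K) - f (Inf K)) \<le> p * T1" .
  have "(\<Sum>K\<in>D2. f (Sup K) - f (Inf K)) \<ge> (\<Sum>K\<in>D2. q * (Sup K - Inf K))"
    by (rule sum_mono) (use D2(4) in \<open>force intro: less_imp_le\<close>)
  moreover have "(\<Sum>K\<in>D2. q * (Sup K - Inf K)) = q * T2"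
    unfolding T2_def measure_division_real[OF D2(1)] by (simp add: sum_distrib_left)
  ultimately have 2: "p * T1 > q * T2 - \<epsilon>" using 1 ** by linarith
  have "q * (T1 - T2) \<le> \<bar>q\<bar> * (3 * \<eta>)"
    by (rule mult_mono) (use T1 T2 T12 in auto)
  then have "(q - p) * T1 < 2 * \<epsilon>" using 2 \<eta>(4) by (simp add: algebra_simps)
  moreover have "(q - p) * T1 \<ge> (q - p) * (m / 2)"
    by (rule mult_left_mono) (use T12 T2 \<eta>(3) pq in auto)
  ultimately show False by (simp add: \<epsilon>_def field_simps)
qed

text \<open>In a window of length \<delta>/2 the increments over any division add up to less than 1.
  Intervals of slope above j therefore have total length below 1/j, while by Vitali they miss less
  than 1/j of E in the window. So that part of E has measure at most 2/j for all j, and windows with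
  rational left end cover E.\<close>

lemma negligible_unbounded_slopes:
  assumes ac: "absolutely_continuous_on {a..b} f"
    and E: "E \<in> lmeasurable" "E \<subseteq> {a<..<b}"
    and hi: "\<And>(q::nat) x d. x \<in> E \<Longrightarrow> 0 < d \<Longrightarrow>
       \<exists>u v. u < x \<and> x < v \<and> v - u < d \<and> q * (v - u) < \<bar>f v - f u\<bar>"
  shows "negligible E"
proof -
  obtain \<delta> where \<delta>: "\<delta> > 0"
    "\<forall>d. d division_of \<Union>d \<longrightarrow> \<Union>d \<subseteq> {a..b} \<longrightarrow> measure lebesgue (\<Union>d) < \<delta> \<longrightarrow>
       (\<Sum>K\<in>d. \<bar>f (Sup K) - f (Inf K)\<bar>) < 1"
    using absolutely_continuous_onD[OF ac zero_less_one] by blast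
  have neg: "negligible (E \<inter> {c<..<c + \<delta> / 2})" for c
  proof -
    let ?E = "E \<inter> {c<..<c + \<delta> / 2}" and ?U = "{max a c<..<min b (c + \<delta> / 2)}"
    have Em: "?E \<in> lmeasurable" using E by (auto intro: fmeasurable.Int)
    have "measure lebesgue ?E \<le> 2 / Suc j" for j
    proof -
      have EU: "?E \<subseteq> ?U" using E by auto
      have cov: "\<exists>u v. u < x \<and> x < v \<and> v - u < d \<and> real (Suc j) * (v - u) < \<bar>f v - f u\<bar>"
        if "x \<in> ?E" "0 < d" for x d :: real using that hi[of x d "Suc j"] by blast
      have j: "0 < 1 / real (Suc j)" by simp
      obtain D where D: "D division_of \<Union>D" "\<Union>D \<subseteq> ?U" "measure lebesgue (?E - \<Union>D) < 1 / Suc j"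
          "\<And>K. K \<in> D \<Longrightarrow> Inf K < Sup K \<and> Suc j * (Sup K - Inf K) < \<bar>f (Sup K) - f (Inf K)\<bar>"
        using finite_Vitali_intervals[OF Em open_greaterThanLessThan EU j cov] by blast
      have Dm: "\<Union>D \<in> lmeasurable" by (rule lmeasurable_division[OF D(1)])
      have "measure lebesgue (\<Union>D) \<le> measure lebesgue {c..c + \<delta> / 2}"
      proof (rule measure_mono_fmeasurable)
        show "\<Union>D \<subseteq> {c..c + \<delta> / 2}" using D(2) by fastforce
      qed (use Dm in \<open>auto intro: fmeasurableD\<close>)
      then have "measure lebesgue (\<Union>D) < \<delta>" using \<delta>(1) by simp
      moreover have "\<Union>D \<subseteq> {a..b}" using D(2) by fastforce
      ultimately have "(\<Sum>K\<in>D. \<bar>f (Sup K) - f (Inf K)\<bar>) < 1" using \<delta>(2) D(1) by blast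
      moreover have "(\<Sum>K\<in>D. Suc j * (Sup K - Inf K)) \<le> (\<Sum>K\<in>D. \<bar>f (Sup K) - f (Inf K)\<bar>)"
        by (rule sum_mono) (use D(4) in \<open>force intro: less_imp_le\<close>)
      moreover have "(\<Sum>K\<in>D. Suc j * (Sup K - Inf K)) = Suc j * measure lebesgue (\<Union>D)"
        unfolding measure_division_real[OF D(1)] by (simp only: sum_distrib_left)
      ultimately have "Suc j * measure lebesgue (\<Union>D) < 1" by linarith
      then have "measure lebesgue (\<Union>D) < 1 / Suc j"
        by (simp add: pos_less_divide_eq mult.commute del: of_nat_Suc)
      moreover have "measure lebesgue ?E \<le> measure lebesgue ((?E - \<Union>D) \<union> \<Union>D)"
        by (rule measure_mono_fmeasurable)
          (use Em Dm in \<open>auto intro: fmeasurableD fmeasurable.Un fmeasurable.Diff\<close>)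
      moreover have "\<dots> \<le> measure lebesgue (?E - \<Union>D) + measure lebesgue (\<Union>D)"
        by (rule measure_Un_le) (use Em Dm in \<open>auto intro: fmeasurableD\<close>)
      ultimately have "measure lebesgue ?E \<le> 1 / Suc j + 1 / Suc j" using D(3) by linarith
      then show ?thesis by simp
    qed
    moreover have "(\<lambda>j. 2 / real (Suc j)) \<longlonglongrightarrow> 0" by real_asymp
    ultimately have "measure lebesgue ?E \<le> 0"
      by (meson LIMSEQ_le_const)
    then show ?thesis using Em negligible_iff_measure measure_nonneg by (metis order_antisym)
  qed
  have "E \<subseteq> (\<Union>c\<in>\<rat>. E \<inter> {c<..<c + \<delta> / 2})"
  proof
    fix x assume "x \<in> E"
    obtain c where "c \<in> \<rat>" "x - \<delta> / 2 < c" "c < x" using Rats_dense_in_real[of "x - \<delta> / 2" x] \<delta>(1) by auto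
    then show "x \<in> (\<Union>c\<in>\<rat>. E \<inter> {c<..<c + \<delta> / 2})" using \<open>x \<in> E\<close> by (intro UN_I[of c]) auto
  qed
  moreover have "negligible (\<Union>c\<in>\<rat>. E \<inter> {c<..<c + \<delta> / 2})"
    using neg countable_rat by (intro negligible_countable_Union) auto
  ultimately show ?thesis by (rule negligible_subset[rotated])
qed

text \<open>For each n the union of all admissible open intervals shorter than 1/(n+1) is open,
  whatever P is, and the set is the intersection of these unions.\<close>

lemma borel_arbitrarily_short_intervals:
  "{x::real. \<forall>d>0. \<exists>u v. u < x \<and> x < v \<and> v - u < d \<and> P u v} \<in> sets borel" (is "?A \<in> _")
proof -
  define B where "B n = \<Union>{{u<..<v} | u v. v - u < inverse (real (Suc n)) \<and> P u v}" for n
  have "?A = (\<Inter>n. B n)"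
  proof (intro equalityI subsetI)
    fix x assume x: "x \<in> ?A"
    have "x \<in> B n" for n
    proof -
      have "0 < inverse (real (Suc n))" by simp
      then obtain u v where "u < x" "x < v" "v - u < inverse (real (Suc n))" "P u v" using x by blast
      then show ?thesis unfolding B_def by (intro UnionI[of "{u<..<v}"]) auto
    qed
    then show "x \<in> (\<Inter>n. B n)" by blast
  next
    fix x assume x: "x \<in> (\<Inter>n. B n)"
    have "\<exists>u v. u < x \<and> x < v \<and> v - u < d \<and> P u v" if d: "d > 0" for d
    proof -
      obtain n where n: "inverse (real (Suc n)) < d" using reals_Archimedean[OF d] by blast
      have "x \<in> B n" using x by blast
      then obtain u v where "v - u < inverse (real (Suc n))" "P u v" "u < x" "x < v"
        unfolding B_def by auto
      then show ?thesis using n by (meson less_trans)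
    qed
    then show "x \<in> ?A" by blast
  qed
  moreover have "open (B n)" for n unfolding B_def by (rule open_Union) auto
  ultimately show ?thesis by (auto intro: borel_open)
qed

lemma continuous_on_absolutely_continuous:
  assumes "absolutely_continuous_on {a..b} f"
  shows "continuous_on {a..b} f"
proof -
  have inc: "\<exists>\<delta>>0. \<forall>x y. a \<le> x \<longrightarrow> x \<le> y \<longrightarrow> y \<le> b \<longrightarrow> y - x < \<delta> \<longrightarrow> \<bar>f y - f x\<bar> < \<epsilon>" if \<epsilon>: "\<epsilon> > 0" for \<epsilon>
  proof -
    obtain \<delta> where \<delta>: "\<delta> > 0"
      "\<forall>d. d division_of \<Union>d \<longrightarrow> \<Union>d \<subseteq> {a..b} \<longrightarrow> measure lebesgue (\<Union>d) < \<delta> \<longrightarrow>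
         (\<Sum>K\<in>d. \<bar>f (Sup K) - f (Inf K)\<bar>) < \<epsilon>"
      using absolutely_continuous_onD[OF assms \<epsilon>] by blast
    have "\<bar>f y - f x\<bar> < \<epsilon>" if xy: "a \<le> x" "x \<le> y" "y \<le> b" "y - x < \<delta>" for x y
    proof -
      have "{{x..y}} division_of \<Union>{{x..y}}"
        using division_of_self[of x y] xy by simp
      moreover have "\<Union>{{x..y}} \<subseteq> {a..b}" "measure lebesgue (\<Union>{{x..y}}) < \<delta>" using xy by auto
      ultimately have "(\<Sum>K\<in>{{x..y}}. \<bar>f (Sup K) - f (Inf K)\<bar>) < \<epsilon>" using \<delta>(2) by blast
      then show ?thesis using xy by simp
    qed
    then show ?thesis using \<delta>(1) by blast
  qed
  show ?thesis
    unfolding continuous_on_iff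
  proof (intro ballI allI impI)
    fix x e assume x: "x \<in> {a..b}" and e: "0 < (e::real)"
    obtain \<delta> where \<delta>: "\<delta> > 0"
      "\<forall>x y. a \<le> x \<longrightarrow> x \<le> y \<longrightarrow> y \<le> b \<longrightarrow> y - x < \<delta> \<longrightarrow> \<bar>f y - f x\<bar> < e" using inc[OF e] by blast
    have "dist (f y) (f x) < e" if y: "y \<in> {a..b}" "dist y x < \<delta>" for y
    proof (cases "x \<le> y")
      case True then show ?thesis using \<delta>(2) x y by (auto simp: dist_real_def)
    next
      case False
      then have "\<bar>f x - f y\<bar> < e" using \<delta>(2) x y by (auto simp: dist_real_def)
      then show ?thesis by (simp add: dist_real_def)
    qed
    then show "\<exists>d>0. \<forall>y\<in>{a..b}. dist y x < d \<longrightarrow> dist (f y) (f x) < e" using \<delta>(1) by blast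
  qed
qed

text \<open>Vitali coverings control slopes over intervals with x strictly inside. Continuity at x
  allows one end point to tend to x, which turns the control into one of the one-sided difference
  quotients.\<close>

lemma DERIV_straddling:
  fixes f :: "real \<Rightarrow> real"
  assumes cont: "isCont f x"
    and L: "\<And>e. e > 0 \<Longrightarrow>
      \<exists>d>0. \<forall>u v. u < x \<and> x < v \<and> v - u < d \<longrightarrow> \<bar>f v - f u - L * (v - u)\<bar> \<le> e * (v - u)"
  shows "DERIV f x :> L"
  unfolding has_field_derivative_iff
proof (rule LIM_I)
  fix e :: real assume e: "0 < e"
  obtain d where d: "d > 0"
    "\<forall>u v. u < x \<and> x < v \<and> v - u < d \<longrightarrow> \<bar>f v - f u - L * (v - u)\<bar> \<le> e / 2 * (v - u)"
    using L[of "e / 2"] e by auto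
  have tl: "(f \<longlongrightarrow> f x) (at_left x)" and tr: "(f \<longlongrightarrow> f x) (at_right x)"
    using cont by (auto simp: isCont_def filterlim_at_split)
  have key: "\<bar>f y - f x - L * (y - x)\<bar> \<le> e / 2 * \<bar>y - x\<bar>" if y: "y \<noteq> x" "\<bar>y - x\<bar> < d" for y
  proof (cases "x < y")
    case True
    have "\<bar>f y - f x - L * (y - x)\<bar> \<le> e / 2 * (y - x)"
    proof (rule tendsto_le[OF trivial_limit_at_left_real])
      show "((\<lambda>u. e / 2 * (y - u)) \<longlongrightarrow> e / 2 * (y - x)) (at_left x)" by (intro tendsto_intros)
      show "((\<lambda>u. \<bar>f y - f u - L * (y - u)\<bar>) \<longlongrightarrow> \<bar>f y - f x - L * (y - x)\<bar>) (at_left x)"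
        by (intro tendsto_intros tl)
      have "\<forall>\<^sub>F u in at_left x. u \<in> {y - d<..<x}"
        by (rule eventually_at_left_real) (use y True in auto)
      then show "\<forall>\<^sub>F u in at_left x. \<bar>f y - f u - L * (y - u)\<bar> \<le> e / 2 * (y - u)"
        by eventually_elim (use d(2) True in auto)
    qed
    then show ?thesis using True by simp
  next
    case False
    then have yx: "y < x" using y by simp
    have "\<bar>f x - f y - L * (x - y)\<bar> \<le> e / 2 * (x - y)"
    proof (rule tendsto_le[OF trivial_limit_at_right_real])
      show "((\<lambda>u. e / 2 * (u - y)) \<longlongrightarrow> e / 2 * (x - y)) (at_right x)" by (intro tendsto_intros)
      show "((\<lambda>u. \<bar>f u - f y - L * (u - y)\<bar>) \<longlongrightarrow> \<bar>f x - f y - L * (x - y)\<bar>) (at_right x)"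
        by (intro tendsto_intros tr)
      have "\<forall>\<^sub>F u in at_right x. u \<in> {x<..<y + d}"
        by (rule eventually_at_right_real) (use y yx in auto)
      then show "\<forall>\<^sub>F u in at_right x. \<bar>f u - f y - L * (u - y)\<bar> \<le> e / 2 * (u - y)"
        by eventually_elim (use d(2) yx in auto)
    qed
    moreover have "f x - f y - L * (x - y) = - (f y - f x - L * (y - x))" by (simp add: algebra_simps)
    ultimately show ?thesis using yx by (simp only: abs_minus_cancel) simp
  qed
  have "norm ((f y - f x) / (y - x) - L) < e" if y: "y \<noteq> x" "norm (y - x) < d" for y
  proof -
    have "(f y - f x) / (y - x) - L = (f y - f x - L * (y - x)) / (y - x)"
      using y by (simp add: field_simps)
    then have "norm ((f y - f x) / (y - x) - L) = \<bar>f y - f x - L * (y - x)\<bar> / \<bar>y - x\<bar>"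
      by (simp add: abs_divide)
    also have "\<dots> \<le> e / 2" using key[of y] y by (simp add: divide_le_eq)
    finally show ?thesis using e by simp
  qed
  then show "\<exists>s>0. \<forall>y. y \<noteq> x \<and> norm (y - x) < s \<longrightarrow> norm ((f y - f x) / (y - x) - L) < e"
    using d(1) by blast
qed

text \<open>\<open>S\<close> consists of the eventual lower bounds of the slopes around x, and its
  supremum is the lower derivative; \<open>bd\<close> makes S nonempty and bounded. The assumption
  \<open>two\<close> says that no pair of rationals separates lower and upper derivative. Rationals
  are used so that the exceptional pairs are countably many.\<close>

lemma slopes_converge_imp_DERIV:
  fixes f :: "real \<Rightarrow> real"
  assumes cont: "isCont f x" and d0: "d0 > 0"
    and bd: "\<And>u v. u < x \<Longrightarrow> x < v \<Longrightarrow> v - u < d0 \<Longrightarrow> \<bar>f v - f u\<bar> \<le> M * (v - u)"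
    and two: "\<And>p q. p \<in> \<rat> \<Longrightarrow> q \<in> \<rat> \<Longrightarrow> p < q \<Longrightarrow>
      (\<exists>d>0. \<forall>u v. u < x \<and> x < v \<and> v - u < d \<longrightarrow> p * (v - u) \<le> f v - f u) \<or>
      (\<exists>d>0. \<forall>u v. u < x \<and> x < v \<and> v - u < d \<longrightarrow> f v - f u \<le> q * (v - u))"
  shows "\<exists>L. DERIV f x :> L"
proof -
  define S where "S = {p. \<exists>d>0. \<forall>u v. u < x \<and> x < v \<and> v - u < d \<longrightarrow> p * (v - u) \<le> f v - f u}"
  have "- M \<in> S"
  proof -
    have "- M * (v - u) \<le> f v - f u" if "u < x" "x < v" "v - u < d0" for u v
      using bd[OF that] by (simp add: abs_le_iff)
    then show ?thesis unfolding S_def using d0 by blast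
  qed
  have S_le: "p \<le> M" if "p \<in> S" for p
  proof -
    obtain d where d: "d > 0" "\<forall>u v. u < x \<and> x < v \<and> v - u < d \<longrightarrow> p * (v - u) \<le> f v - f u"
      using \<open>p \<in> S\<close> unfolding S_def by blast
    define h where "h = min d d0 / 4"
    have h: "h > 0" "2 * h < d" "2 * h < d0" using d d0 by (auto simp: h_def)
    have "p * (2 * h) \<le> f (x + h) - f (x - h)" using d(2)[rule_format, of "x - h" "x + h"] h by simp
    also have "\<dots> \<le> M * (2 * h)" using bd[of "x - h" "x + h"] h by simp
    finally show ?thesis using h by simp
  qed
  then have bdd: "bdd_above S" by (auto simp: bdd_above_def)
  define L where "L = Sup S"
  have down: "p \<in> S" if "p' \<in> S" "p \<le> p'" for p p'
  proof -
    obtain d where d: "d > 0" "\<forall>u v. u < x \<and> x < v \<and> v - u < d \<longrightarrow> p' * (v - u) \<le> f v - f u"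
      using \<open>p' \<in> S\<close> unfolding S_def by blast
    have "p * (v - u) \<le> f v - f u" if "u < x" "x < v" "v - u < d" for u v
    proof -
      have "p * (v - u) \<le> p' * (v - u)" using that \<open>p \<le> p'\<close> by (intro mult_right_mono) auto
      also have "\<dots> \<le> f v - f u" using d(2) that by blast
      finally show ?thesis .
    qed
    then show ?thesis using d(1) unfolding S_def by blast
  qed
  have "DERIV f x :> L"
  proof (rule DERIV_straddling[OF cont])
    fix e :: real assume e: "e > 0"
    have "\<exists>p\<in>S. L - e < p"
      using less_cSupD[of S "L - e"] \<open>- M \<in> S\<close> e unfolding L_def by auto
    then have "L - e \<in> S" using down by (meson less_imp_le)
    then obtain d1 where d1: "d1 > 0" "\<forall>u v. u < x \<and> x < v \<and> v - u < d1 \<longrightarrow> (L - e) * (v - u) \<le> f v - f u"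
      unfolding S_def by blast
    \<comment> \<open>As p > L is not an eventual lower bound, the dichotomy for p < q makes q an
      eventual upper bound, and q is still below L + e.\<close>
    obtain p where p: "p \<in> \<rat>" "L < p" "p < L + e" using Rats_dense_in_real[of L "L + e"] e by auto
    obtain q where q: "q \<in> \<rat>" "p < q" "q < L + e" using Rats_dense_in_real[OF p(3)] by auto
    have "p \<notin> S" using cSup_upper[OF _ bdd] p(2) unfolding L_def by (meson not_le)
    then obtain d2 where d2: "d2 > 0" "\<forall>u v. u < x \<and> x < v \<and> v - u < d2 \<longrightarrow> f v - f u \<le> q * (v - u)"
      using two[OF p(1) q(1,2)] unfolding S_def by blast
    have "\<bar>f v - f u - L * (v - u)\<bar> \<le> e * (v - u)" if uv: "u < x" "x < v" "v - u < min d1 d2" for u v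
    proof -
      have "f v - f u \<le> q * (v - u)" using d2 uv by auto
      also have "\<dots> \<le> (L + e) * (v - u)" using q(3) uv by (intro mult_right_mono) auto
      finally have "f v - f u \<le> (L + e) * (v - u)" .
      moreover have "(L - e) * (v - u) \<le> f v - f u" using d1 uv by auto
      ultimately show ?thesis by (simp add: abs_le_iff algebra_simps)
    qed
    then show "\<exists>d>0. \<forall>u v. u < x \<and> x < v \<and> v - u < d \<longrightarrow> \<bar>f v - f u - L * (v - u)\<bar> \<le> e * (v - u)"
      using d1(1) d2(1) by (intro exI[of _ "min d1 d2"]) simp
  qed
  then show ?thesis by blast
qed

text \<open>At a point without derivative either the slopes over short straddling intervals are
  unbounded, or for some rational p < q they fall below p and exceed q arbitrarily close to the
  point. Both alternatives define Borel sets, and countably many of them suffice.\<close>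

theorem absolutely_continuous_differentiable:
  assumes ac: "absolutely_continuous_on {a..b} f"
  shows "negligible {x \<in> {a<..<b}. \<not> (\<exists>L. DERIV f x :> L)}"
proof -
  define A where "A P = {x::real. \<forall>d>0. \<exists>u v. u < x \<and> x < v \<and> v - u < d \<and> P u v}" for P
  define lo where "lo p = (\<lambda>u v. f v - f u < p * (v - u))" for p
  define hi where "hi p = (\<lambda>u v. p * (v - u) < f v - f u)" for p
  define ab where "ab n = (\<lambda>u v. real n * (v - u) < \<bar>f v - f u\<bar>)" for n :: nat
  \<comment> \<open>Here \<open>R\<close> is the countable set of rational pairs, not a
    radius.\<close>
  define R where "R = {(p,q). p \<in> \<rat> \<and> q \<in> \<rat> \<and> p < (q::real)}"
  have Am: "A P \<inter> {a<..<b} \<in> lmeasurable" "(A P \<inter> A Q) \<inter> {a<..<b} \<in> lmeasurable" for P Q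
  proof -
    have "A P \<in> sets borel" for P unfolding A_def by (rule borel_arbitrarily_short_intervals)
    then have "A P \<inter> {a<..<b} \<in> sets lebesgue" "(A P \<inter> A Q) \<inter> {a<..<b} \<in> sets lebesgue" for P Q
      by auto
    then show "A P \<inter> {a<..<b} \<in> lmeasurable" "(A P \<inter> A Q) \<inter> {a<..<b} \<in> lmeasurable"
      by (auto intro!: bounded_set_imp_lmeasurable bounded_Int)
  qed
  have 1: "negligible (A (lo (fst r)) \<inter> A (hi (snd r)) \<inter> {a<..<b})" if "r \<in> R" for r
  proof (rule negligible_two_slopes[OF ac Am(2)])
    show "fst r < snd r" using that by (auto simp: R_def)
  qed (auto simp: A_def lo_def hi_def)
  have 2: "negligible ((\<Inter>n. A (ab n)) \<inter> {a<..<b})"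
  proof (rule negligible_unbounded_slopes[OF ac])
    have "(\<Inter>n. A (ab n) \<inter> {a<..<b}) \<in> lmeasurable"
      using Am by (intro fmeasurable_INT) auto
    then show "(\<Inter>n. A (ab n)) \<inter> {a<..<b} \<in> lmeasurable" by (simp add: INT_simps)
  qed (auto simp: A_def ab_def)
  have cR: "countable R"
  proof (rule countable_subset)
    show "R \<subseteq> \<rat> \<times> \<rat>" by (auto simp: R_def)
    show "countable (\<rat> \<times> \<rat> :: (real \<times> real) set)" using countable_rat by (intro countable_SIGMA) auto
  qed
  have "negligible ((\<Union>r\<in>R. A (lo (fst r)) \<inter> A (hi (snd r)) \<inter> {a<..<b}) \<union> ((\<Inter>n. A (ab n)) \<inter> {a<..<b}))"
    using 1 2 cR by (intro negligible_Un negligible_countable_Union) auto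
  moreover have "{x \<in> {a<..<b}. \<not> (\<exists>L. DERIV f x :> L)} \<subseteq>
     ((\<Union>r\<in>R. A (lo (fst r)) \<inter> A (hi (snd r)) \<inter> {a<..<b}) \<union> ((\<Inter>n. A (ab n)) \<inter> {a<..<b}))"
  proof
    fix x assume "x \<in> {x \<in> {a<..<b}. \<not> (\<exists>L. DERIV f x :> L)}"
    then have x: "x \<in> {a<..<b}" and nd: "\<not> (\<exists>L. DERIV f x :> L)" by auto
    show "x \<in> ((\<Union>r\<in>R. A (lo (fst r)) \<inter> A (hi (snd r)) \<inter> {a<..<b}) \<union> ((\<Inter>n. A (ab n)) \<inter> {a<..<b}))"
    proof (rule ccontr)
      assume nx: "\<not> ?thesis"
      obtain n where "x \<notin> A (ab n)" using nx x by blast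
      then obtain d0 where d0: "d0 > 0"
        "\<And>u v. u < x \<Longrightarrow> x < v \<Longrightarrow> v - u < d0 \<Longrightarrow> \<bar>f v - f u\<bar> \<le> real n * (v - u)"
        unfolding A_def ab_def mem_Collect_eq by (meson not_less)
      have "continuous_on {a<..<b} f"
        by (rule continuous_on_subset[OF continuous_on_absolutely_continuous[OF ac]]) auto
      then have cont: "isCont f x" using x by (simp add: continuous_on_eq_continuous_at)
      have "(\<exists>d>0. \<forall>u v. u < x \<and> x < v \<and> v - u < d \<longrightarrow> p * (v - u) \<le> f v - f u) \<or>
      (\<exists>d>0. \<forall>u v. u < x \<and> x < v \<and> v - u < d \<longrightarrow> f v - f u \<le> q * (v - u))"
        if "p \<in> \<rat>" "q \<in> \<rat>" "p < q" for p q
      proof -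
        have "(p, q) \<in> R" using that by (simp add: R_def)
        then have "x \<notin> A (lo p) \<or> x \<notin> A (hi q)" using nx x by fastforce
        then show ?thesis unfolding A_def lo_def hi_def mem_Collect_eq by (meson not_less)
      qed
      note two = this
      have "\<exists>L. DERIV f x :> L" by (rule slopes_converge_imp_DERIV[OF cont d0 two])
      then show False using nd by blast
    qed
  qed
  ultimately show ?thesis by (rule negligible_subset)
qed

section \<open>Newton-Leibniz formula for absolutely continuous functions\<close>

lemma tagged_partial_increments:
  fixes f :: "real \<Rightarrow> real"
  assumes p: "p tagged_partial_division_of S"
  shows "(\<Sum>(x,K)\<in>p. \<bar>f (Sup K) - f (Inf K)\<bar>) = (\<Sum>K\<in>snd ` p. \<bar>f (Sup K) - f (Inf K)\<bar>)"
proof -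
  \<comment> \<open>One interval can carry several tags only if it is degenerate. The transfer lemma
    needs a function that vanishes on every box with empty interior, including the empty set, where
    \<open>Sup\<close> and \<open>Inf\<close> have no prescribed value; hence the case
    distinction.\<close>
  define h where "h K = (if K = {} then 0 else \<bar>f (Sup K) - f (Inf K)\<bar>)" for K :: "real set"
  have ne: "K \<noteq> {}" if "(x, K) \<in> p" for x K using tagged_partial_division_ofD(2)[OF p that] by auto
  have "(\<Sum>(x,K)\<in>p. h K) = (\<Sum>K\<in>snd ` p. h K)"
  proof (rule sum.over_tagged_division_lemma[OF tagged_partial_division_of_Union_self[OF p]])
    show "h (cbox u v) = 0" if "box u v = {}" for u v
      using that by (auto simp: h_def)
  qed
  moreover have "(\<Sum>(x,K)\<in>p. h K) = (\<Sum>(x,K)\<in>p. \<bar>f (Sup K) - f (Inf K)\<bar>)"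
    by (rule sum.cong) (use ne in \<open>auto simp: h_def\<close>)
  moreover have "(\<Sum>K\<in>snd ` p. h K) = (\<Sum>K\<in>snd ` p. \<bar>f (Sup K) - f (Inf K)\<bar>)"
    by (rule sum.cong) (use ne in \<open>auto simp: h_def\<close>)
  ultimately show ?thesis by simp
qed

text \<open>
  In the Henstock-Kurzweil sums, intervals tagged by points of differentiability are controlled by
  the derivative, and those tagged in the exceptional null set by absolute continuity.
\<close>

theorem has_integral_deriv_absolutely_continuous:
  fixes f :: "real \<Rightarrow> real"
  assumes ac: "absolutely_continuous_on {a..b} f" and ab: "a \<le> b"
  shows "(deriv f has_integral f b - f a) {a..b}"
proof -
  define N where "N = {x \<in> {a<..<b}. \<not> (\<exists>L. DERIV f x :> L)} \<union> {a, b}"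
  have N: "negligible N"
    unfolding N_def using absolutely_continuous_differentiable[OF ac] by (intro negligible_Un) auto
  have der: "DERIV f x :> deriv f x" if "x \<in> {a..b}" "x \<notin> N" for x
    using that unfolding N_def by (auto simp: DERIV_deriv_iff_real_differentiable real_differentiable_def)
  \<comment> \<open>With value 0 on N, an interval tagged in N contributes only its increment to the
    error. Changing the derivative on a null set does not affect the integral.\<close>
  define g where "g x = (if x \<in> N then 0 else deriv f x)" for x
  have "(g has_integral f b - f a) (cbox a b)"
    unfolding has_integral
  proof (intro allI impI)
    fix e :: real assume e: "e > 0"
    \<comment> \<open>Half of \<open>e\<close> is spread over the length of the interval; the
      summand 1 keeps the denominator positive when a = b.\<close>
    define \<epsilon> where "\<epsilon> = e / (2 * (b - a + 1))"
    have \<epsilon>: "\<epsilon> > 0" using e ab by (simp add: \<epsilon>_def)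
    have \<epsilon>2: "\<epsilon> * (b - a) < e / 2" using e ab by (simp add: \<epsilon>_def field_simps)
    obtain \<delta> where \<delta>: "\<delta> > 0"
      "\<forall>d. d division_of \<Union>d \<longrightarrow> \<Union>d \<subseteq> {a..b} \<longrightarrow> measure lebesgue (\<Union>d) < \<delta> \<longrightarrow>
         (\<Sum>K\<in>d. \<bar>f (Sup K) - f (Inf K)\<bar>) < e / 2"
      using absolutely_continuous_onD[OF ac half_gt_zero[OF e]] by blast
    obtain V where V: "open V" "N \<subseteq> V" "V - N \<in> lmeasurable" "emeasure lebesgue (V - N) < ennreal \<delta>"
      using sets_lebesgue_outer_open[OF negligible_imp_sets[OF N] \<delta>(1)] by blast
    have Vm: "measure lebesgue (V - N) < \<delta>"
      using V(3,4) \<delta>(1) by (metis emeasure_eq_measure2 ennreal_less_iff measure_nonneg)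
    have "\<exists>d>0. \<forall>y. \<bar>y - x\<bar> < d \<longrightarrow> \<bar>f y - f x - deriv f x * (y - x)\<bar> \<le> \<epsilon> * \<bar>y - x\<bar>"
      if "x \<in> {a..b}" "x \<notin> N" for x
    proof -
      have "(f has_derivative (*) (deriv f x)) (at x)"
        using der[OF that] by (simp add: has_field_derivative_def)
      then obtain d where "d > 0"
        "\<forall>y. norm (y - x) < d \<longrightarrow> norm (f y - f x - deriv f x * (y - x)) \<le> \<epsilon> * norm (y - x)"
        unfolding has_derivative_at_alt using \<epsilon> by blast
      then show ?thesis by auto
    qed
    then obtain d where d: "\<And>x. x \<in> {a..b} \<Longrightarrow> x \<notin> N \<Longrightarrow> d x > 0"
      "\<And>x y. x \<in> {a..b} \<Longrightarrow> x \<notin> N \<Longrightarrow> \<bar>y - x\<bar> < d x \<Longrightarrow>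
         \<bar>f y - f x - deriv f x * (y - x)\<bar> \<le> \<epsilon> * \<bar>y - x\<bar>"
      by metis
    \<comment> \<open>Intervals tagged in N are confined to V, whose measure is below \<delta>
      because N is null; the others lie in a ball on which the linear approximation is good.\<close>
    define \<gamma> where "\<gamma> x = (if x \<in> N then V else if x \<in> {a..b} then ball x (d x) else UNIV)" for x
    have gauge: "gauge \<gamma>" unfolding gauge_def \<gamma>_def using V(1,2) d(1) by auto
    have close: "norm ((\<Sum>(x,K)\<in>p. measure lborel K *\<^sub>R g x) - (f b - f a)) < e"
      if p: "p tagged_division_of cbox a b" and fine: "\<gamma> fine p" for p
    proof -
      define inc where "inc K = f (Sup K) - f (Inf K)" for K
      define pN where "pN = {(x,K) \<in> p. x \<in> N}"
      have fin: "finite p" using p by auto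
      have pNp: "pN \<subseteq> p" by (auto simp: pN_def)
      have tot: "(\<Sum>(x,K)\<in>p. inc K) = f b - f a"
        unfolding inc_def using additive_tagged_division_1[OF ab] p by simp
      have good: "\<bar>measure lborel K *\<^sub>R g x - inc K\<bar> \<le> \<epsilon> * measure lborel K" if xK: "(x,K) \<in> p - pN" for x K
      proof -
        have xN: "x \<notin> N" and xp: "(x,K) \<in> p" using xK by (auto simp: pN_def)
        obtain u v where uv: "K = cbox u v" using tagged_division_ofD(4)[OF p xp] by blast
        have xin: "x \<in> K" "K \<subseteq> {a..b}" using tagged_division_ofD(2,3)[OF p xp] by auto
        have xab: "x \<in> {a..b}" using xin by auto
        have "K \<subseteq> \<gamma> x" using fine xp by (auto simp: fine_def)
        then have "K \<subseteq> ball x (d x)" using xN xab by (simp add: \<gamma>_def)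
        moreover have uxv: "u \<le> x" "x \<le> v" using xin(1) uv by auto
        moreover have "u \<in> K" "v \<in> K" using uxv uv by auto
        ultimately have "u \<in> ball x (d x)" "v \<in> ball x (d x)" by blast+
        then have *: "\<bar>u - x\<bar> < d x" "\<bar>v - x\<bar> < d x" by (auto simp: dist_real_def)
        have "\<bar>f v - f x - deriv f x * (v - x)\<bar> \<le> \<epsilon> * (v - x)"
          using d(2)[OF xab xN *(2)] uxv by simp
        moreover have "\<bar>f u - f x - deriv f x * (u - x)\<bar> \<le> \<epsilon> * (x - u)"
          using d(2)[OF xab xN *(1)] uxv by simp
        ultimately have "\<bar>(v - u) * deriv f x - (f v - f u)\<bar> \<le> \<epsilon> * (v - u)"
          unfolding abs_le_iff by (simp add: algebra_simps)
        then show ?thesis using uxv xN by (simp add: uv g_def inc_def)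
      qed
      have part: "pN tagged_partial_division_of cbox a b"
        using p pNp unfolding tagged_division_of_def by (meson tagged_partial_division_subset)
      have div: "snd ` pN division_of \<Union>(snd ` pN)"
        by (rule partial_division_of_tagged_division[OF part])
      have UV: "\<Union>(snd ` pN) \<subseteq> V"
      proof -
        have *: "K \<subseteq> V" if "(x, K) \<in> pN" for x K
          using that fine unfolding pN_def fine_def \<gamma>_def by fastforce
        show ?thesis
        proof
          fix y assume "y \<in> \<Union>(snd ` pN)"
          then obtain x K where "(x, K) \<in> pN" "y \<in> K" by auto
          then show "y \<in> V" using * by blast
        qed
      qed
      have Um: "\<Union>(snd ` pN) \<in> lmeasurable" by (rule lmeasurable_division[OF div])
      have Nm: "N \<in> lmeasurable" by (rule negligible_imp_measurable[OF N])
      have "measure lebesgue (\<Union>(snd ` pN)) \<le> measure lebesgue ((V - N) \<union> N)"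
        by (rule measure_mono_fmeasurable)
          (use UV Um Nm V(3) in \<open>auto simp del: Un_Diff_cancel2 intro: fmeasurableD fmeasurable.Un\<close>)
      also have "\<dots> \<le> measure lebesgue (V - N) + measure lebesgue N"
        by (rule measure_Un_le) (use Nm V(3) in \<open>auto intro: fmeasurableD\<close>)
      also have "\<dots> < \<delta>" using Vm negligible_imp_measure0[OF N] by simp
      finally have "measure lebesgue (\<Union>(snd ` pN)) < \<delta>" .
      moreover have "\<Union>(snd ` pN) \<subseteq> {a..b}"
      proof
        fix y assume "y \<in> \<Union>(snd ` pN)"
        then obtain x K where xK: "(x, K) \<in> pN" "y \<in> K" by auto
        have "K \<subseteq> {a..b}" using tagged_partial_division_ofD(3)[OF part xK(1)] by simp
        then show "y \<in> {a..b}" using xK(2) by blast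
      qed
      ultimately have "(\<Sum>K\<in>snd ` pN. \<bar>inc K\<bar>) < e / 2" unfolding inc_def using \<delta>(2) div by blast
      then have bad: "(\<Sum>(x,K)\<in>pN. \<bar>inc K\<bar>) < e / 2"
        using tagged_partial_increments[OF part, of f] by (simp add: inc_def)
      have "(\<Sum>(x,K)\<in>p. measure lborel K *\<^sub>R g x) - (f b - f a) = (\<Sum>(x,K)\<in>p. measure lborel K *\<^sub>R g x - inc K)"
        unfolding tot[symmetric] by (simp add: sum_subtractf split_def)
      also have "\<dots> = (\<Sum>(x,K)\<in>p - pN. measure lborel K *\<^sub>R g x - inc K) + (\<Sum>(x,K)\<in>pN. measure lborel K *\<^sub>R g x - inc K)"
        by (rule sum.subset_diff[OF pNp fin])
      finally have "norm ((\<Sum>(x,K)\<in>p. measure lborel K *\<^sub>R g x) - (f b - f a)) \<le>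
         \<bar>\<Sum>(x,K)\<in>p - pN. measure lborel K *\<^sub>R g x - inc K\<bar> + \<bar>\<Sum>(x,K)\<in>pN. measure lborel K *\<^sub>R g x - inc K\<bar>"
        by (simp add: abs_triangle_ineq)
      also have "\<bar>\<Sum>(x,K)\<in>pN. measure lborel K *\<^sub>R g x - inc K\<bar> \<le> (\<Sum>(x,K)\<in>pN. \<bar>inc K\<bar>)"
      proof -
        have "(\<Sum>(x,K)\<in>pN. measure lborel K *\<^sub>R g x - inc K) = (\<Sum>(x,K)\<in>pN. - inc K)"
          by (rule sum.cong) (auto simp: pN_def g_def)
        also have "\<bar>\<dots>\<bar> \<le> (\<Sum>z\<in>pN. \<bar>(\<lambda>(x,K). - inc K) z\<bar>)" by (rule sum_abs)
        also have "\<dots> = (\<Sum>(x,K)\<in>pN. \<bar>inc K\<bar>)" by (rule sum.cong) auto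
        finally show ?thesis .
      qed
      also have "\<bar>\<Sum>(x,K)\<in>p - pN. measure lborel K *\<^sub>R g x - inc K\<bar> \<le> (\<Sum>(x,K)\<in>p - pN. \<epsilon> * measure lborel K)"
      proof -
        have "\<bar>\<Sum>(x,K)\<in>p - pN. measure lborel K *\<^sub>R g x - inc K\<bar>
           \<le> (\<Sum>z\<in>p - pN. \<bar>(\<lambda>(x,K). measure lborel K *\<^sub>R g x - inc K) z\<bar>)" by (rule sum_abs)
        also have "\<dots> \<le> (\<Sum>(x,K)\<in>p - pN. \<epsilon> * measure lborel K)"
          by (rule sum_mono) (use good in auto)
        finally show ?thesis .
      qed
      also have "(\<Sum>(x,K)\<in>p - pN. \<epsilon> * measure lborel K) \<le> (\<Sum>(x,K)\<in>p. \<epsilon> * measure lborel K)"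
        by (rule sum_mono2) (use fin \<epsilon> in auto)
      also have "(\<Sum>(x,K)\<in>p. \<epsilon> * measure lborel K) = \<epsilon> * (\<Sum>(x,K)\<in>p. measure lborel K)"
        by (simp add: sum_distrib_left split_def)
      also have "(\<Sum>(x,K)\<in>p. measure lborel K) = b - a"
        using additive_content_tagged_division[OF p] ab by simp
      finally show ?thesis using bad \<epsilon>2 by linarith
    qed
    show "\<exists>\<gamma>. gauge \<gamma> \<and> (\<forall>p. p tagged_division_of cbox a b \<and> \<gamma> fine p \<longrightarrow>
        norm ((\<Sum>(x,K)\<in>p. measure lborel K *\<^sub>R g x) - (f b - f a)) < e)"
    proof (intro exI[of _ \<gamma>] conjI allI impI)
      show "norm ((\<Sum>(x,K)\<in>p. measure lborel K *\<^sub>R g x) - (f b - f a)) < e"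
        if "p tagged_division_of cbox a b \<and> \<gamma> fine p" for p
        using that by (intro close) auto
    qed (rule gauge)
  qed
  then have "(g has_integral f b - f a) {a..b}" by simp
  then show ?thesis
    by (rule has_integral_spike[OF N, rotated]) (auto simp: g_def)
qed

section \<open>Upper gradients\<close>

text \<open>
  A Borel majorant \<open>\<phi>\<close> of \<open>\<bar>v'\<bar>\<close>, in the integrated form in which it is used. Replacing \<open>deriv v\<close>,
  which is only Lebesgue measurable, by a Borel function makes Tonelli's theorem applicable.
\<close>

definition upper_gradient :: "real \<Rightarrow> (real \<Rightarrow> real) \<Rightarrow> (real \<Rightarrow> real) \<Rightarrow> bool" where
  "upper_gradient R v \<phi> \<longleftrightarrow> \<phi> \<in> borel_measurable borel \<and> (\<forall>s. 0 \<le> \<phi> s) \<and> continuous_on {0<..<R} v \<and>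
    (\<forall>a b. 0 < a \<longrightarrow> a \<le> b \<longrightarrow> b < R \<longrightarrow> ennreal \<bar>v b - v a\<bar> \<le> (\<integral>\<^sup>+s\<in>{a..b}. ennreal (\<phi> s) \<partial>lborel)) \<and>
    (\<forall>r. 0 < r \<longrightarrow> r < R \<longrightarrow> ennreal \<bar>v r\<bar> \<le> (\<integral>\<^sup>+s\<in>{r<..<R}. ennreal (\<phi> s) \<partial>lborel))"

lemma AC_R_continuous:
  assumes "v \<in> AC_R R"
  shows "continuous_on {0<..<R} v"
proof -
  have "isCont v x" if x: "x \<in> {0<..<R}" for x
  proof -
    have "absolutely_continuous_on {x / 2..(x + R) / 2} v" using assms x by (auto simp: AC_R_def)
    then have "continuous_on {x / 2..(x + R) / 2} v" by (rule continuous_on_absolutely_continuous)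
    then have "continuous_on {x / 2<..<(x + R) / 2} v" by (rule continuous_on_subset) auto
    then show ?thesis using x by (simp add: continuous_on_eq_continuous_at)
  qed
  then show ?thesis by (simp add: continuous_on_eq_continuous_at)
qed

lemma AC_R_differentiable:
  assumes "v \<in> AC_R R" and R: "0 < R"
  shows "negligible {x \<in> {0<..<R}. \<not> (\<exists>L. DERIV v x :> L)}"
proof -
  \<comment> \<open>The summand 3 makes even the interval for n = 0 nondegenerate.\<close>
  define I where "I n = {R / (real n + 3)<..<R - R / (real n + 3)}" for n :: nat
  have neg: "negligible {x \<in> I n. \<not> (\<exists>L. DERIV v x :> L)}" for n
  proof -
    have "R / (real n + 3) \<le> R - R / (real n + 3)" using R by (simp add: field_simps)
    then have "absolutely_continuous_on {R / (real n + 3)..R - R / (real n + 3)} v"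
      using assms by (auto simp: AC_R_def)
    then show ?thesis unfolding I_def by (rule absolutely_continuous_differentiable)
  qed
  have "negligible (\<Union>n. {x \<in> I n. \<not> (\<exists>L. DERIV v x :> L)})"
    using neg by (intro negligible_countable_Union) auto
  moreover have "{x \<in> {0<..<R}. \<not> (\<exists>L. DERIV v x :> L)} \<subseteq> (\<Union>n. {x \<in> I n. \<not> (\<exists>L. DERIV v x :> L)})"
  proof
    fix x assume x: "x \<in> {x \<in> {0<..<R}. \<not> (\<exists>L. DERIV v x :> L)}"
    then have xR: "0 < x" "x < R" by auto
    define d where "d = min x (R - x)"
    have d: "d > 0" using xR by (simp add: d_def)
    obtain n :: nat where n: "R / d < real n" using reals_Archimedean2 by blast
    have "R < real n * d" using n d by (simp add: divide_less_eq)
    also have "\<dots> \<le> (real n + 3) * d" using d by (intro mult_right_mono) auto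
    finally have "R / (real n + 3) < d" by (simp add: divide_less_eq mult.commute)
    then have "x \<in> I n" by (auto simp: I_def d_def)
    then show "x \<in> (\<Union>n. {x \<in> I n. \<not> (\<exists>L. DERIV v x :> L)})" using x by blast
  qed
  ultimately show ?thesis by (rule negligible_subset)
qed

text \<open>\<open>deriv\<close> takes arbitrary values where there is no derivative. The limit of
  the difference quotients along the steps 1/(n+1) is a Borel function and agrees with the
  derivative wherever that exists.\<close>

lemma AC_R_Borel_derivative:
  assumes "v \<in> AC_R R" and "0 < R"
  obtains \<phi> where "\<phi> \<in> borel_measurable borel" "AE x in lborel. x \<in> {0<..<R} \<longrightarrow> DERIV v x :> \<phi> x"
proof -
  \<comment> \<open>Outside (0,R) nothing is known about v, so it is cut off before measurability is
    claimed.\<close>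
  define V where "V x = indicator {0<..<R} x * v x" for x
  have [measurable]: "V \<in> borel_measurable borel"
    unfolding V_def using borel_measurable_continuous_on_indicator[OF _ AC_R_continuous[OF assms(1)]] by simp
  define \<phi> where "\<phi> x = lim (\<lambda>n. (V (x + inverse (real (Suc n))) - V x) / inverse (real (Suc n)))" for x
  have 1: "\<phi> \<in> borel_measurable borel" unfolding \<phi>_def by measurable
  have eq: "\<phi> x = L" if x: "x \<in> {0<..<R}" and L: "DERIV v x :> L" for x L
  proof -
    have "\<forall>\<^sub>F h in nhds 0. x + h \<in> {0<..<R}"
    proof -
      have "((\<lambda>h. x + h) \<longlongrightarrow> x + 0) (nhds 0)" by (intro tendsto_intros tendsto_ident_at[of 0 UNIV, unfolded at_within_def, simplified] filterlim_ident)
      then show ?thesis using x by (intro topological_tendstoD) auto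
    qed
    then have "\<forall>\<^sub>F h in at 0. x + h \<in> {0<..<R}" by (simp add: eventually_at_filter eventually_mono)
    then have "\<forall>\<^sub>F h in at 0. (v (x + h) - v x) / h = (V (x + h) - V x) / h"
      by eventually_elim (use x in \<open>simp add: V_def\<close>)
    moreover have "((\<lambda>h. (v (x + h) - v x) / h) \<longlongrightarrow> L) (at 0)" using L by (simp add: DERIV_def)
    ultimately have lim: "((\<lambda>h. (V (x + h) - V x) / h) \<longlongrightarrow> L) (at 0)"
      by (rule Lim_transform_eventually[rotated])
    have "filterlim (\<lambda>n. inverse (real (Suc n))) (at 0) sequentially"
      unfolding filterlim_at using LIMSEQ_inverse_real_of_nat by auto
    from filterlim_compose[OF lim this] show ?thesis
      unfolding \<phi>_def by (rule limI)
  qed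
  have "{x \<in> {0<..<R}. \<not> (\<exists>L. DERIV v x :> L)} \<in> null_sets lebesgue"
    using AC_R_differentiable[OF assms] by (simp add: negligible_iff_null_sets)
  then have "AE x in lebesgue. x \<notin> {x \<in> {0<..<R}. \<not> (\<exists>L. DERIV v x :> L)}" by (rule AE_not_in)
  then have "AE x in lebesgue. x \<in> {0<..<R} \<longrightarrow> DERIV v x :> \<phi> x"
    by eventually_elim (use eq in auto)
  then have "AE x in lborel. x \<in> {0<..<R} \<longrightarrow> DERIV v x :> \<phi> x"
    by (simp add: AE_completion_iff)
  with 1 show thesis using that by blast
qed

text \<open>If \<phi> is integrable on [a,b], the increment is the integral of \<phi> by
  Newton-Leibniz; otherwise the right side is infinite. The tail bound follows by letting b tend to
  R, where v tends to 0.\<close>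

lemma AC_R_upper_gradient:
  assumes v: "v \<in> AC_R R" and [measurable]: "\<phi> \<in> borel_measurable borel"
    and ae: "AE x in lborel. x \<in> {0<..<R} \<longrightarrow> DERIV v x :> \<phi> x"
  shows "upper_gradient R v (\<lambda>s. \<bar>\<phi> s\<bar>)"
proof -
  have inc: "ennreal \<bar>v b - v a\<bar> \<le> (\<integral>\<^sup>+s\<in>{a..b}. ennreal \<bar>\<phi> s\<bar> \<partial>lborel)" if ab: "0 < a" "a \<le> b" "b < R" for a b
  proof (cases "(\<integral>\<^sup>+s\<in>{a..b}. ennreal \<bar>\<phi> s\<bar> \<partial>lborel) = \<infinity>")
    case False
    have *: "ennreal \<bar>\<phi> s\<bar> * indicator {a..b} s = ennreal (norm (indicator {a..b} s * \<phi> s))" for s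
      by (simp add: indicator_def)
    have int: "integrable lborel (\<lambda>s. indicator {a..b} s * \<phi> s)"
      by (rule integrableI_bounded) (use False * in \<open>auto simp: top.not_eq_extremum\<close>)
    have "((\<lambda>s. indicator {a..b} s * \<phi> s) has_integral (LINT s|lborel. indicator {a..b} s * \<phi> s)) UNIV"
      by (rule has_integral_integral_lborel[OF int])
    moreover have "(\<lambda>s. indicator {a..b} s * \<phi> s) = (\<lambda>s. if s \<in> {a..b} then \<phi> s else 0)"
      by (auto simp: indicator_def)
    ultimately have 1: "(\<phi> has_integral (LINT s|lborel. indicator {a..b} s * \<phi> s)) {a..b}"
      by (simp only: has_integral_restrict_UNIV)
    have "absolutely_continuous_on {a..b} v" using v ab by (simp add: AC_R_def)
    then have 2: "(deriv v has_integral v b - v a) {a..b}"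
      by (rule has_integral_deriv_absolutely_continuous[OF _ ab(2)])
    have "AE x in lebesgue. x \<in> {0<..<R} \<longrightarrow> DERIV v x :> \<phi> x"
      using ae by (simp add: AE_completion_iff)
    then have N: "{x \<in> space lebesgue. \<not> (x \<in> {0<..<R} \<longrightarrow> DERIV v x :> \<phi> x)} \<in> null_sets lebesgue"
      (is "?N \<in> _") unfolding completion.AE_iff_null_sets .
    have "(\<phi> has_integral v b - v a) {a..b}"
    proof (rule has_integral_spike[OF _ _ 2])
      show "negligible ?N" using N by (simp add: negligible_iff_null_sets)
      fix x assume x: "x \<in> {a..b} - ?N"
      then have "DERIV v x :> \<phi> x" using ab by auto
      then show "\<phi> x = deriv v x" by (simp add: DERIV_imp_deriv)
    qed
    then have "v b - v a = (LINT s|lborel. indicator {a..b} s * \<phi> s)" using 1 by (rule has_integral_unique)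
    then have "ennreal \<bar>v b - v a\<bar> \<le> ennreal (LINT s|lborel. norm (indicator {a..b} s * \<phi> s))"
      using integral_norm_bound[of lborel "\<lambda>s. indicator {a..b} s * \<phi> s"] by (simp add: ennreal_leI)
    also have "\<dots> = (\<integral>\<^sup>+s. ennreal (norm (indicator {a..b} s * \<phi> s)) \<partial>lborel)"
      using int by (subst nn_integral_eq_integral) auto
    finally show ?thesis using * by simp
  qed simp
  have tail: "ennreal \<bar>v r\<bar> \<le> (\<integral>\<^sup>+s\<in>{r<..<R}. ennreal \<bar>\<phi> s\<bar> \<partial>lborel)" if r: "0 < r" "r < R" for r
  proof (rule tendsto_upperbound)
    have lim: "(v \<longlongrightarrow> 0) (at_left R)" using v by (simp add: AC_R_def)
    have "((\<lambda>b. \<bar>v b - v r\<bar>) \<longlongrightarrow> \<bar>0 - v r\<bar>) (at_left R)" by (intro tendsto_intros lim)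
    then show "((\<lambda>b. ennreal \<bar>v b - v r\<bar>) \<longlongrightarrow> ennreal \<bar>v r\<bar>) (at_left R)"
      by (intro tendsto_ennrealI) simp
    have "\<forall>\<^sub>F b in at_left R. b \<in> {r<..<R}" by (rule eventually_at_left_real[OF r(2)])
    then show "\<forall>\<^sub>F b in at_left R. ennreal \<bar>v b - v r\<bar> \<le> (\<integral>\<^sup>+s\<in>{r<..<R}. ennreal \<bar>\<phi> s\<bar> \<partial>lborel)"
    proof eventually_elim
      fix b assume b: "b \<in> {r<..<R}"
      have "ennreal \<bar>v b - v r\<bar> \<le> (\<integral>\<^sup>+s\<in>{r..b}. ennreal \<bar>\<phi> s\<bar> \<partial>lborel)" using inc[of r b] b r by auto
      also have "\<dots> \<le> (\<integral>\<^sup>+s\<in>{r<..<R}. ennreal \<bar>\<phi> s\<bar> \<partial>lborel)"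
      proof (rule nn_integral_mono_AE)
        have "AE s in lborel. s \<noteq> r" by (rule AE_lborel_singleton)
        then show "AE s in lborel. ennreal \<bar>\<phi> s\<bar> * indicator {r..b} s \<le> ennreal \<bar>\<phi> s\<bar> * indicator {r<..<R} s"
          by eventually_elim (use b in \<open>auto simp: indicator_def\<close>)
      qed
      finally show "ennreal \<bar>v b - v r\<bar> \<le> (\<integral>\<^sup>+s\<in>{r<..<R}. ennreal \<bar>\<phi> s\<bar> \<partial>lborel)" .
    qed
  qed (simp add: trivial_limit_at_left_real)
  show ?thesis
    unfolding upper_gradient_def using inc tail AC_R_continuous[OF v] by auto
qed

section \<open>Norms expressed through Borel derivatives\<close>

lemma borel_measurable_AE_lebesgue:
  fixes f g :: "'a::euclidean_space \<Rightarrow> 'b::topological_space"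
  assumes f: "f \<in> borel_measurable lebesgue" and eq: "AE x in lebesgue. g x = f x"
  shows "g \<in> borel_measurable lebesgue"
proof (rule measurableI)
  fix B :: "'b set" assume B: "B \<in> sets borel"
  have "f -` B \<inter> space lebesgue \<in> sets lebesgue" using f B by (rule measurable_sets)
  moreover have "AE x in lebesgue. x \<in> f -` B \<inter> space lebesgue \<longleftrightarrow> x \<in> g -` B \<inter> space lebesgue"
    using eq by eventually_elim simp
  ultimately show "g -` B \<inter> space lebesgue \<in> sets lebesgue"
    using completion.in_sets_AE[of "f -` B \<inter> space lebesgue" "g -` B \<inter> space lebesgue"] by blast
qed simp

lemma finite_norm_w_Borel:
  fixes v \<phi> w :: "real \<Rightarrow> real" and n k R :: real
  assumes w[measurable]: "w \<in> borel_measurable borel"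
    and [measurable]: "\<phi> \<in> borel_measurable borel"
    and ae: "AE x in lborel. x \<in> {0<..<R} \<longrightarrow> DERIV v x :> \<phi> x"
  shows "set_integrable lebesgue {0<..<R} (\<lambda>r. r powr (n - k) * \<bar>deriv v r\<bar> powr (k + 1) * w r) \<longleftrightarrow>
      set_integrable lborel {0<..<R} (\<lambda>r. r powr (n - k) * \<bar>\<phi> r\<bar> powr (k + 1) * w r)"
    and "(LINT r:{0<..<R}|lebesgue. r powr (n - k) * \<bar>deriv v r\<bar> powr (k + 1) * w r) =
      (LINT r:{0<..<R}|lborel. r powr (n - k) * \<bar>\<phi> r\<bar> powr (k + 1) * w r)"
proof -
  let ?h = "\<lambda>r. indicat_real {0<..<R} r *\<^sub>R (r powr (n - k) * \<bar>\<phi> r\<bar> powr (k + 1) * w r)"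
  let ?g = "\<lambda>r. indicat_real {0<..<R} r *\<^sub>R (r powr (n - k) * \<bar>deriv v r\<bar> powr (k + 1) * w r)"
  have "?h \<in> borel_measurable borel" by measurable
  then have hm: "?h \<in> borel_measurable lborel" by simp
  then have hm': "?h \<in> borel_measurable lebesgue" by (rule measurable_completion)
  have "AE x in lebesgue. x \<in> {0<..<R} \<longrightarrow> DERIV v x :> \<phi> x" using ae by (simp add: AE_completion_iff)
  then have eq: "AE x in lebesgue. ?g x = ?h x"
    by eventually_elim (auto simp: indicator_def DERIV_imp_deriv)
  have gm: "?g \<in> borel_measurable lebesgue" using hm' eq by (rule borel_measurable_AE_lebesgue)
  show "set_integrable lebesgue {0<..<R} (\<lambda>r. r powr (n - k) * \<bar>deriv v r\<bar> powr (k + 1) * w r) \<longleftrightarrow>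
      set_integrable lborel {0<..<R} (\<lambda>r. r powr (n - k) * \<bar>\<phi> r\<bar> powr (k + 1) * w r)"
    unfolding set_integrable_def
    using integrable_cong_AE[OF gm hm' eq] integrable_completion[OF hm] by simp
  show "(LINT r:{0<..<R}|lebesgue. r powr (n - k) * \<bar>deriv v r\<bar> powr (k + 1) * w r) =
      (LINT r:{0<..<R}|lborel. r powr (n - k) * \<bar>\<phi> r\<bar> powr (k + 1) * w r)"
    unfolding set_lebesgue_integral_def
    using integral_cong_AE[OF gm hm' eq] integral_completion[OF hm] by simp
qed

text \<open>Only finiteness matters, so
  \<open>(x + y) powr q \<le> 2 powr q * (x powr q + y powr q)\<close>, obtained by comparison with
  the larger of x and y, takes the place of Minkowski's inequality.\<close>

lemma set_integrable_slope_triangle: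
  fixes f g h :: "real \<Rightarrow> real"
  assumes [measurable]: "w \<in> borel_measurable borel" "f \<in> borel_measurable borel"
    and w0: "\<And>s. 0 \<le> w s" and q: "q \<ge> 0"
    and g: "set_integrable lborel S (\<lambda>r. r powr m * \<bar>g r\<bar> powr q * w r)"
    and h: "set_integrable lborel S (\<lambda>r. r powr m * \<bar>h r\<bar> powr q * w r)"
    and S[measurable]: "S \<in> sets borel"
    and ae: "AE s in lborel. s \<in> S \<longrightarrow> \<bar>f s\<bar> \<le> \<bar>g s\<bar> + \<bar>h s\<bar>"
  shows "set_integrable lborel S (\<lambda>r. r powr m * \<bar>f r\<bar> powr q * w r)"
proof -
  have "set_integrable lborel S (\<lambda>r. 2 powr q * (r powr m * \<bar>g r\<bar> powr q * w r + r powr m * \<bar>h r\<bar> powr q * w r))"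
    by (intro set_integrable_mult_right set_integral_add(1) g h)
  then show ?thesis
    unfolding set_integrable_def
  proof (rule Bochner_Integration.integrable_bound)
    show "AE x in lborel. norm (indicat_real S x *\<^sub>R (x powr m * \<bar>f x\<bar> powr q * w x)) \<le>
      norm (indicat_real S x *\<^sub>R (2 powr q * (x powr m * \<bar>g x\<bar> powr q * w x + x powr m * \<bar>h x\<bar> powr q * w x)))"
      using ae
    proof eventually_elim
      case (elim x)
      have "\<bar>f x\<bar> powr q \<le> 2 powr q * (\<bar>g x\<bar> powr q + \<bar>h x\<bar> powr q)" if "x \<in> S"
      proof -
        have "\<bar>f x\<bar> \<le> 2 * max \<bar>g x\<bar> \<bar>h x\<bar>" using elim that by linarith
        then have "\<bar>f x\<bar> powr q \<le> (2 * max \<bar>g x\<bar> \<bar>h x\<bar>) powr q" using q by (intro powr_mono2) auto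
        also have "\<dots> = 2 powr q * max \<bar>g x\<bar> \<bar>h x\<bar> powr q" by (simp add: powr_mult)
        also have "\<dots> \<le> 2 powr q * (\<bar>g x\<bar> powr q + \<bar>h x\<bar> powr q)"
          by (intro mult_left_mono) (auto simp: max_def)
        finally show ?thesis .
      qed
      then have "x powr m * w x * \<bar>f x\<bar> powr q \<le> x powr m * w x * (2 powr q * (\<bar>g x\<bar> powr q + \<bar>h x\<bar> powr q))" if "x \<in> S"
        using that w0[of x] by (intro mult_left_mono) auto
      then show ?case using w0[of x] by (simp add: indicator_def algebra_simps)
    qed
  qed measurable
qed

text \<open>As a nonnegative integral it also records infinite values, which the Bochner integral in
  \<open>norm_w\<close> would report as 0. For slopes it is the norm to the power k+1, divided by
  c.\<close>

abbreviation energy :: "real \<Rightarrow> real \<Rightarrow> real \<Rightarrow> (real \<Rightarrow> real) \<Rightarrow> (real \<Rightarrow> real) \<Rightarrow> ennreal" where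
  "energy n k R w \<phi> \<equiv> \<integral>\<^sup>+s\<in>{0<..<R}. ennreal (s powr (n - k) * \<phi> s powr (k + 1) * w s) \<partial>lborel"

text \<open>A single approximant u suffices: u and u - v have finite energy, hence so has v. In
  particular \<open>norm_w\<close> of v is a genuine integral and not the default value of a
  divergent one.\<close>

lemma X_space_upper_gradient:
  fixes v w :: "real \<Rightarrow> real" and c n k R :: real
  assumes R: "0 < R" and k: "0 \<le> k" and c: "0 < c"
    and w[measurable]: "w \<in> borel_measurable borel" and w0: "\<And>s. 0 \<le> w s"
    and v: "v \<in> X_space c n k R w"
  obtains \<phi> where "upper_gradient R v \<phi>"
    "energy n k R w \<phi>
       = ennreal (norm_w c n k R w v powr (k + 1) / c)"
proof -
  have vA: "v \<in> AC_R R" using v by (simp add: X_space_def)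
  obtain u where u: "u \<in> finite_norm_w n k R w" "(\<lambda>r. u r - v r) \<in> finite_norm_w n k R w"
    using v unfolding X_space_def by blast
  have uA: "u \<in> AC_R R" "(\<lambda>r. u r - v r) \<in> AC_R R" using u by (auto simp: finite_norm_w_def)
  obtain \<phi> where \<phi>: "\<phi> \<in> borel_measurable borel" "AE x in lborel. x \<in> {0<..<R} \<longrightarrow> DERIV v x :> \<phi> x"
    using AC_R_Borel_derivative[OF vA R] by blast
  obtain f where f: "f \<in> borel_measurable borel" "AE x in lborel. x \<in> {0<..<R} \<longrightarrow> DERIV u x :> f x"
    using AC_R_Borel_derivative[OF uA(1) R] by blast
  obtain d where d: "d \<in> borel_measurable borel"
      "AE x in lborel. x \<in> {0<..<R} \<longrightarrow> DERIV (\<lambda>r. u r - v r) x :> d x"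
    using AC_R_Borel_derivative[OF uA(2) R] by blast
  have tri: "AE x in lborel. x \<in> {0<..<R} \<longrightarrow> \<bar>\<phi> x\<bar> \<le> \<bar>f x\<bar> + \<bar>d x\<bar>"
    using \<phi>(2) f(2) d(2)
  proof eventually_elim
    case (elim x)
    show ?case
    proof
      assume "x \<in> {0<..<R}"
      then have "d x = f x - \<phi> x"
        using elim DERIV_unique[OF _ DERIV_diff] by blast
      then show "\<bar>\<phi> x\<bar> \<le> \<bar>f x\<bar> + \<bar>d x\<bar>" by linarith
    qed
  qed
  have fint: "set_integrable lborel {0<..<R} (\<lambda>r. r powr (n - k) * \<bar>f r\<bar> powr (k + 1) * w r)"
    using u(1) finite_norm_w_Borel(1)[OF w f] by (simp add: finite_norm_w_def)
  have dint: "set_integrable lborel {0<..<R} (\<lambda>r. r powr (n - k) * \<bar>d r\<bar> powr (k + 1) * w r)"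
    using u(2) finite_norm_w_Borel(1)[OF w d] by (simp add: finite_norm_w_def)
  have int: "set_integrable lborel {0<..<R} (\<lambda>r. r powr (n - k) * \<bar>\<phi> r\<bar> powr (k + 1) * w r)"
    by (rule set_integrable_slope_triangle[OF w \<phi>(1) w0 _ fint dint _ tri]) (use k in auto)
  define I where "I = (LINT r:{0<..<R}|lborel. r powr (n - k) * \<bar>\<phi> r\<bar> powr (k + 1) * w r)"
  have I0: "I \<ge> 0" unfolding I_def set_lebesgue_integral_def
    using w0 by (intro integral_nonneg_AE) (auto simp: indicator_def)
  have "norm_w c n k R w v = (c * I) powr (1 / (k + 1))"
    unfolding norm_w_def I_def finite_norm_w_Borel(2)[OF w \<phi>] ..
  then have "norm_w c n k R w v powr (k + 1) / c = I"
    using k c I0 by (simp add: powr_powr)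
  moreover have "(\<integral>\<^sup>+s\<in>{0<..<R}. ennreal (s powr (n - k) * \<bar>\<phi> s\<bar> powr (k + 1) * w s) \<partial>lborel) = ennreal I"
  proof -
    have "(\<integral>\<^sup>+s\<in>{0<..<R}. ennreal (s powr (n - k) * \<bar>\<phi> s\<bar> powr (k + 1) * w s) \<partial>lborel) =
      (\<integral>\<^sup>+s. ennreal (indicat_real {0<..<R} s *\<^sub>R (s powr (n - k) * \<bar>\<phi> s\<bar> powr (k + 1) * w s)) \<partial>lborel)"
      by (rule nn_integral_cong) (auto simp: indicator_def)
    also have "\<dots> = ennreal I"
      unfolding I_def set_lebesgue_integral_def
      using int w0 by (intro nn_integral_eq_integral) (auto simp: set_integrable_def indicator_def)
    finally show ?thesis .
  qed
  ultimately show thesis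
    using that[OF AC_R_upper_gradient[OF vA \<phi>]] by simp
qed

section \<open>Weighted estimates\<close>

text \<open>Young's inequality for f/a and g/b, where a and b are the roots of the bounds. If a
  bound is 0, one factor vanishes almost everywhere. Upper bounds A and B replace the norms so that
  estimates can be inserted directly.\<close>

lemma nn_integral_Hoelder:
  fixes f g :: "'a \<Rightarrow> real"
  assumes pq: "p > 1" "q > 1" "1 / p + 1 / q = 1"
    and [measurable]: "f \<in> borel_measurable M" "g \<in> borel_measurable M"
    and f0: "\<And>x. 0 \<le> f x" and g0: "\<And>x. 0 \<le> g x" and AB: "A \<ge> 0" "B \<ge> 0"
    and A: "(\<integral>\<^sup>+x. ennreal (f x powr p) \<partial>M) \<le> ennreal A"
    and B: "(\<integral>\<^sup>+x. ennreal (g x powr q) \<partial>M) \<le> ennreal B"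
  shows "(\<integral>\<^sup>+x. ennreal (f x * g x) \<partial>M) \<le> ennreal (A powr (1 / p) * B powr (1 / q))"
proof (cases "A = 0 \<or> B = 0")
  case True
  have *: "AE x in M. h x = 0" if "(\<integral>\<^sup>+x. ennreal (h x powr r) \<partial>M) \<le> 0"
    and [measurable]: "h \<in> borel_measurable M" and "\<And>x. 0 \<le> h x" for h :: "'a \<Rightarrow> real" and r
  proof -
    have "AE x in M. ennreal (h x powr r) = 0"
      using that by (subst nn_integral_0_iff_AE[symmetric]) auto
    then show ?thesis by eventually_elim simp
  qed
  have "AE x in M. f x * g x = 0"
  proof (cases "A = 0")
    case True
    then have "AE x in M. f x = 0" using A f0 by (intro *[of f p]) auto
    then show ?thesis by eventually_elim simp
  next
    case False
    then have "AE x in M. g x = 0" using B g0 True by (intro *[of g q]) auto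
    then show ?thesis by eventually_elim simp
  qed
  then have "AE x in M. ennreal (f x * g x) = 0"
    by eventually_elim (simp only: ennreal_0)
  then have "(\<integral>\<^sup>+x. ennreal (f x * g x) \<partial>M) = 0" by (subst nn_integral_0_iff_AE) auto
  then show ?thesis by simp
next
  case False
  then have pos: "A > 0" "B > 0" using AB by auto
  define a where "a = A powr (1 / p)"
  define b where "b = B powr (1 / q)"
  have ab: "a > 0" "b > 0" using pos by (auto simp: a_def b_def)
  have ap: "a powr p = A" "b powr q = B" using pos pq by (auto simp: a_def b_def powr_powr)
  have young: "f x * g x \<le> (a * b / (p * A)) * f x powr p + (a * b / (q * B)) * g x powr q" for x
  proof -
    have "(f x / a) * (g x / b) \<le> (f x / a) powr p / p + (g x / b) powr q / q"
      by (rule Youngs_inequality) (use pq f0 g0 ab in auto)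
    then have "a * b * ((f x / a) * (g x / b)) \<le> a * b * ((f x / a) powr p / p + (g x / b) powr q / q)"
      using ab by (intro mult_left_mono) auto
    moreover have "(f x / a) powr p = f x powr p / A" "(g x / b) powr q = g x powr q / B"
      using ap f0 g0 ab by (auto simp: powr_divide)
    ultimately show ?thesis using ab by (simp add: field_simps)
  qed
  have "(\<integral>\<^sup>+x. ennreal (f x * g x) \<partial>M) \<le>
     (\<integral>\<^sup>+x. ennreal (a * b / (p * A)) * ennreal (f x powr p) + ennreal (a * b / (q * B)) * ennreal (g x powr q) \<partial>M)"
  proof (rule nn_integral_mono)
    fix x
    show "ennreal (f x * g x) \<le> ennreal (a * b / (p * A)) * ennreal (f x powr p) + ennreal (a * b / (q * B)) * ennreal (g x powr q)"
      using young[of x] ab pos pq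
      by (simp add: ennreal_mult[symmetric] ennreal_plus[symmetric] del: ennreal_plus)
  qed
  also have "\<dots> = ennreal (a * b / (p * A)) * (\<integral>\<^sup>+x. ennreal (f x powr p) \<partial>M)
       + ennreal (a * b / (q * B)) * (\<integral>\<^sup>+x. ennreal (g x powr q) \<partial>M)"
    by (subst nn_integral_add) (auto simp: nn_integral_cmult)
  also have "\<dots> \<le> ennreal (a * b / (p * A)) * ennreal A + ennreal (a * b / (q * B)) * ennreal B"
    by (intro add_mono mult_left_mono A B) auto
  also have "\<dots> = ennreal (a * b / (p * A) * A + a * b / (q * B) * B)"
    using ab pos pq by (simp add: ennreal_mult[symmetric] ennreal_plus[symmetric] del: ennreal_plus)
  also have "a * b / (p * A) * A + a * b / (q * B) * B = a * b * (1 / p + 1 / q)"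
    using pos pq by (simp add: field_simps)
  finally show ?thesis using pq by (simp add: a_def b_def)
qed

text \<open>Weights \<open>G\<close> for which the tails of \<open>s powr (- a) * G s\<close> with \<open>a > 1\<close> are as small as those of \<open>s powr (- a)\<close>.\<close>

definition tame :: "real \<Rightarrow> (real \<Rightarrow> real) \<Rightarrow> bool" where
  "tame R G \<longleftrightarrow> G \<in> borel_measurable borel \<and> (\<forall>s. 0 \<le> G s) \<and>
    (\<exists>s0 M. 0 < s0 \<and> (\<forall>s. 0 < s \<and> s < s0 \<longrightarrow> G s \<le> M) \<and> (\<integral>\<^sup>+s\<in>{s0..<R}. ennreal (G s) \<partial>lborel) < \<infinity>)"

lemma nn_integral_powr_tail:
  assumes a: "a > 1" and r: "r > 0"
  shows "(\<integral>\<^sup>+s\<in>{r<..}. ennreal (s powr (- a)) \<partial>lborel) \<le> ennreal (r powr (1 - a) / (a - 1))"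
proof -
  have "((\<lambda>s. s powr (- a)) has_integral - (r powr (- a + 1)) / (- a + 1)) {r..}"
    by (rule has_integral_powr_to_inf) (use a r in auto)
  then have "(\<integral>\<^sup>+s. ennreal (indicator {r..} s * s powr (- a)) \<partial>lborel) = ennreal (- (r powr (- a + 1)) / (- a + 1))"
    by (intro nn_integral_has_integral_lebesgue) auto
  moreover have "(\<integral>\<^sup>+s\<in>{r<..}. ennreal (s powr (- a)) \<partial>lborel) \<le> (\<integral>\<^sup>+s. ennreal (indicator {r..} s * s powr (- a)) \<partial>lborel)"
    by (rule nn_integral_mono) (auto simp: indicator_def)
  moreover have "- (r powr (- a + 1)) / (- a + 1) = r powr (1 - a) / (a - 1)"
    using a by (simp add: divide_simps algebra_simps)
  ultimately show ?thesis by simp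
qed

text \<open>Below s0 the weight is bounded and the tail is that of a pure power; beyond s0 the power
  is bounded and G is integrable.\<close>

lemma tame_tail_bound:
  assumes G: "tame R G" and a: "a > 1" and R: "0 < R"
  shows "\<exists>C\<ge>0. \<forall>r. 0 < r \<longrightarrow> r < R \<longrightarrow>
    (\<integral>\<^sup>+s\<in>{r<..<R}. ennreal (s powr (- a) * G s) \<partial>lborel) \<le> ennreal (C * r powr (1 - a))"
proof -
  have [measurable]: "G \<in> borel_measurable borel" and G0: "0 \<le> G s" for s using G by (auto simp: tame_def)
  obtain s0 M where s0: "0 < s0" "\<And>s. 0 < s \<Longrightarrow> s < s0 \<Longrightarrow> G s \<le> M"
    "(\<integral>\<^sup>+s\<in>{s0..<R}. ennreal (G s) \<partial>lborel) < \<infinity>" using G by (auto simp: tame_def)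
  have M: "M \<ge> 0" using s0(2)[of "s0/2"] s0(1) G0[of "s0/2"] by auto
  obtain I where I: "I \<ge> 0" "(\<integral>\<^sup>+s\<in>{s0..<R}. ennreal (G s) \<partial>lborel) = ennreal I"
    using s0(3) by (metis ennreal_cases infinity_ennreal_def less_irrefl)
  \<comment> \<open>The part beyond s0 is at most a constant. Since
    \<open>R powr (a - 1) * r powr (1 - a) \<ge> 1\<close> for r < R, it is absorbed into a multiple
    of \<open>r powr (1 - a)\<close>.\<close>
  define C where "C = M / (a - 1) + s0 powr (- a) * I * R powr (a - 1)"
  have C: "C \<ge> 0" using M I a by (auto simp: C_def)
  have "(\<integral>\<^sup>+s\<in>{r<..<R}. ennreal (s powr (- a) * G s) \<partial>lborel) \<le> ennreal (C * r powr (1 - a))"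
    if r: "0 < r" "r < R" for r
  proof -
    have "(\<integral>\<^sup>+s\<in>{r<..<R}. ennreal (s powr (- a) * G s) \<partial>lborel) \<le>
      (\<integral>\<^sup>+s. ennreal M * (ennreal (s powr (- a)) * indicator {r<..} s) +
         ennreal (s0 powr (- a)) * (ennreal (G s) * indicator {s0..<R} s) \<partial>lborel)"
    proof (rule nn_integral_mono)
      fix s
      show "ennreal (s powr (- a) * G s) * indicator {r<..<R} s \<le>
         ennreal M * (ennreal (s powr (- a)) * indicator {r<..} s) +
         ennreal (s0 powr (- a)) * (ennreal (G s) * indicator {s0..<R} s)"
      proof (cases "s \<in> {r<..<R}")
        case True
        show ?thesis
        proof (cases "s < s0")
          case s: True
          have "s powr (- a) * G s \<le> M * s powr (- a)"
            using s0(2)[of s] True s r by (simp add: mult.commute mult_right_mono)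
          then show ?thesis using True s M by (simp add: ennreal_mult[symmetric] ennreal_leI)
        next
          case False
          have "s powr (- a) * G s \<le> s0 powr (- a) * G s"
            using False s0(1) a G0 by (intro mult_right_mono powr_mono2') auto
          then have "ennreal (s powr (- a) * G s) \<le> ennreal (s0 powr (- a)) * ennreal (G s)"
            using G0 by (simp add: ennreal_mult[symmetric] ennreal_leI)
          then show ?thesis using True False by (simp add: add_increasing)
        qed
      qed simp
    qed
    also have "\<dots> = ennreal M * (\<integral>\<^sup>+s\<in>{r<..}. ennreal (s powr (- a)) \<partial>lborel) +
       ennreal (s0 powr (- a)) * (\<integral>\<^sup>+s\<in>{s0..<R}. ennreal (G s) \<partial>lborel)"
      by (subst nn_integral_add) (auto simp: nn_integral_cmult)
    also have "\<dots> \<le> ennreal M * ennreal (r powr (1 - a) / (a - 1)) + ennreal (s0 powr (- a)) * ennreal I"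
      unfolding I(2) by (intro add_mono mult_left_mono nn_integral_powr_tail a r) auto
    also have "\<dots> = ennreal (M * (r powr (1 - a) / (a - 1)) + s0 powr (- a) * I)"
      using M I(1) a by (simp add: ennreal_mult[symmetric] ennreal_plus[symmetric] del: ennreal_plus)
    also have "\<dots> \<le> ennreal (C * r powr (1 - a))"
    proof (rule ennreal_leI)
      have "1 = R powr (a - 1) * R powr (1 - a)" using R by (simp add: powr_add[symmetric])
      also have "\<dots> \<le> R powr (a - 1) * r powr (1 - a)"
        using r a by (intro mult_left_mono powr_mono2') auto
      finally have "s0 powr (- a) * I * 1 \<le> s0 powr (- a) * I * (R powr (a - 1) * r powr (1 - a))"
        using I by (intro mult_left_mono) auto
      then show "M * (r powr (1 - a) / (a - 1)) + s0 powr (- a) * I \<le> C * r powr (1 - a)"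
        by (simp add: C_def algebra_simps)
    qed
    finally show ?thesis .
  qed
  then show ?thesis using C by blast
qed

text \<open>Factor \<phi> as \<open>\<phi> * W powr (1 / (k + 1))\<close> times
  \<open>W powr (- 1 / (k + 1))\<close> and use the exponents k+1 and (k+1)/k. Positivity of W is
  asked only almost everywhere, because the logarithmic weight can vanish at a point.\<close>

lemma nn_integral_weighted_Hoelder:
  fixes \<phi> W :: "real \<Rightarrow> real"
  assumes k: "k > 0" and [measurable]: "\<phi> \<in> borel_measurable borel" "W \<in> borel_measurable borel" "S \<in> sets borel"
    and \<phi>0: "\<And>s. 0 \<le> \<phi> s" and W: "AE s in lborel. s \<in> S \<longrightarrow> W s > 0" and AB: "A \<ge> 0" "B \<ge> 0"
    and A: "(\<integral>\<^sup>+s\<in>S. ennreal (\<phi> s powr (k + 1) * W s) \<partial>lborel) \<le> ennreal A"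
    and B: "(\<integral>\<^sup>+s\<in>S. ennreal (W s powr (- 1 / k)) \<partial>lborel) \<le> ennreal B"
  shows "(\<integral>\<^sup>+s\<in>S. ennreal (\<phi> s) \<partial>lborel) \<le> ennreal (A powr (1 / (k + 1)) * B powr (k / (k + 1)))"
proof -
  define f where "f s = indicat_real S s * (\<phi> s * W s powr (1 / (k + 1)))" for s
  define g where "g s = indicat_real S s * W s powr (- 1 / (k + 1))" for s
  have [measurable]: "f \<in> borel_measurable borel" "g \<in> borel_measurable borel" unfolding f_def g_def by measurable
  have "(\<integral>\<^sup>+s\<in>S. ennreal (\<phi> s) \<partial>lborel) = (\<integral>\<^sup>+s. ennreal (f s * g s) \<partial>lborel)"
  proof (rule nn_integral_cong_AE)
    show "AE s in lborel. ennreal (\<phi> s) * indicator S s = ennreal (f s * g s)"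
      using W
    proof eventually_elim
      case (elim s)
      show ?case
      proof (cases "s \<in> S")
        case True
        then have "W s powr (1 / (k + 1)) * W s powr (- 1 / (k + 1)) = 1"
          using elim by (simp add: powr_add[symmetric])
        then show ?thesis using True by (simp add: f_def g_def mult.assoc)
      qed (simp add: f_def)
    qed
  qed
  also have "\<dots> \<le> ennreal (A powr (1 / (k + 1)) * B powr (1 / ((k + 1) / k)))"
  proof (rule nn_integral_Hoelder)
    show "1 < k + 1" "1 < (k + 1) / k" using k by auto
    show "1 / (k + 1) + 1 / ((k + 1) / k) = 1" using k by (simp add: field_simps)
    show "0 \<le> f s" "0 \<le> g s" for s using \<phi>0 by (auto simp: f_def g_def)
    have "(\<integral>\<^sup>+s. ennreal (f s powr (k + 1)) \<partial>lborel) = (\<integral>\<^sup>+s\<in>S. ennreal (\<phi> s powr (k + 1) * W s) \<partial>lborel)"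
    proof (rule nn_integral_cong_AE)
      show "AE s in lborel. ennreal (f s powr (k + 1)) = ennreal (\<phi> s powr (k + 1) * W s) * indicator S s"
        using W by eventually_elim
          (use k \<phi>0 in \<open>auto simp: f_def indicator_def powr_mult powr_powr\<close>)
    qed
    then show "(\<integral>\<^sup>+s. ennreal (f s powr (k + 1)) \<partial>lborel) \<le> ennreal A" using A by simp
    have "(\<integral>\<^sup>+s. ennreal (g s powr ((k + 1) / k)) \<partial>lborel) = (\<integral>\<^sup>+s\<in>S. ennreal (W s powr (- 1 / k)) \<partial>lborel)"
    proof (rule nn_integral_cong)
      fix s
      have "- 1 / (k + 1) * ((k + 1) / k) = - 1 / k" using k by (simp add: field_simps)
      then have "(W s powr (- 1 / (k + 1))) powr ((k + 1) / k) = W s powr (- 1 / k)"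
        by (simp only: powr_powr)
      then show "ennreal (g s powr ((k + 1) / k)) = ennreal (W s powr (- 1 / k)) * indicator S s"
        by (simp add: g_def indicator_def)
    qed
    then show "(\<integral>\<^sup>+s. ennreal (g s powr ((k + 1) / k)) \<partial>lborel) \<le> ennreal B" using B by simp
  qed (use AB in auto)
  finally show ?thesis by simp
qed

text \<open>The factor \<open>s powr \<epsilon>\<close> is detached from the power and joined to
  \<open>w powr (- 1 / k)\<close>: it keeps this product bounded at 0 even if the latter grows like
  a power of the logarithm.\<close>

lemma weight_powr:
  fixes s k n :: real
  assumes "s > 0" "k > 0" "w \<ge> 0"
  shows "(s powr (n - k) * w) powr (- 1 / k) = s powr (- (n / k - 1 + \<epsilon>)) * (s powr \<epsilon> * w powr (- 1 / k))"
proof -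
  have "(s powr (n - k) * w) powr (- 1 / k) = s powr ((n - k) * (- 1 / k)) * w powr (- 1 / k)"
    using assms by (simp add: powr_mult powr_powr)
  also have "(n - k) * (- 1 / k) = - (n / k - 1 + \<epsilon>) + \<epsilon>" using assms by (simp add: field_simps)
  finally show ?thesis by (simp only: powr_add mult.assoc)
qed

text \<open>The common source of the pointwise bound, with S = (r,R), and of the modulus of
  continuity, with S = [a,b].\<close>

lemma energy_Hoelder:
  fixes n k R \<epsilon> A D :: real
  assumes k: "k \<ge> 1" and S[measurable]: "S \<in> sets borel" and SR: "S \<subseteq> {0<..<R}"
    and [measurable]: "w \<in> borel_measurable borel" "\<phi> \<in> borel_measurable borel"
    and w0: "\<And>s. 0 \<le> w s" and wp: "AE s in lborel. w s > 0" and \<phi>0: "\<And>s. 0 \<le> \<phi> s"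
    and D: "0 \<le> D" "(\<integral>\<^sup>+s\<in>S. ennreal (s powr (- (n / k - 1 + \<epsilon>)) * (s powr \<epsilon> * w s powr (- 1 / k))) \<partial>lborel) \<le> ennreal D"
    and A: "0 \<le> A" and E: "energy n k R w \<phi> \<le> ennreal A"
  shows "(\<integral>\<^sup>+s\<in>S. ennreal (\<phi> s) \<partial>lborel) \<le> ennreal (A powr (1 / (k + 1)) * D powr (k / (k + 1)))"
proof (rule nn_integral_weighted_Hoelder[where W = "\<lambda>s. s powr (n - k) * w s"])
  show "AE s in lborel. s \<in> S \<longrightarrow> s powr (n - k) * w s > 0"
    using wp by eventually_elim (use SR in auto)
  have "(\<integral>\<^sup>+s\<in>S. ennreal (\<phi> s powr (k + 1) * (s powr (n - k) * w s)) \<partial>lborel) \<le>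
    energy n k R w \<phi>"
    by (rule nn_integral_mono) (use SR in \<open>auto simp: indicator_def mult_ac\<close>)
  then show "(\<integral>\<^sup>+s\<in>S. ennreal (\<phi> s powr (k + 1) * (s powr (n - k) * w s)) \<partial>lborel) \<le> ennreal A"
    using E by (rule order_trans)
  have "(\<integral>\<^sup>+s\<in>S. ennreal ((s powr (n - k) * w s) powr (- 1 / k)) \<partial>lborel) =
    (\<integral>\<^sup>+s\<in>S. ennreal (s powr (- (n / k - 1 + \<epsilon>)) * (s powr \<epsilon> * w s powr (- 1 / k))) \<partial>lborel)"
  proof (rule nn_integral_cong)
    fix s
    show "ennreal ((s powr (n - k) * w s) powr (- 1 / k)) * indicator S s =
      ennreal (s powr (- (n / k - 1 + \<epsilon>)) * (s powr \<epsilon> * w s powr (- 1 / k))) * indicator S s"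
      using weight_powr[of s k "w s" n \<epsilon>] w0[of s] k SR by (cases "s \<in> S") auto
  qed
  then show "(\<integral>\<^sup>+s\<in>S. ennreal ((s powr (n - k) * w s) powr (- 1 / k)) \<partial>lborel) \<le> ennreal D"
    using D(2) by simp
qed (use k \<phi>0 A D(1) in auto)

text \<open>The tail of w^(-1/k) times the power is of order r^(1-a) with a = n/k - 1 + \<epsilon>,
  and Hoelder raises it to the power k/(k+1); this is the exponent in the conclusion. C is chosen
  before v, so the bound is uniform on sets of bounded norm.\<close>

lemma upper_gradient_pointwise:
  fixes n k R \<epsilon> :: real
  assumes k: "k \<ge> 1" and R: "0 < R" and \<epsilon>: "n / k - 1 + \<epsilon> > 1"
    and [measurable]: "w \<in> borel_measurable borel" and w0: "\<And>s. 0 \<le> w s" and wp: "AE s in lborel. w s > 0"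
    and tame: "tame R (\<lambda>s. s powr \<epsilon> * w s powr (- 1 / k))"
  shows "\<exists>C\<ge>0. \<forall>v \<phi> A. upper_gradient R v \<phi> \<longrightarrow> 0 \<le> A \<longrightarrow>
     energy n k R w \<phi> \<le> ennreal A \<longrightarrow>
     (\<forall>r. 0 < r \<longrightarrow> r < R \<longrightarrow> \<bar>v r\<bar> \<le> C * A powr (1 / (k + 1)) * r powr (- (n - 2 * k + \<epsilon> * k) / (k + 1)))"
proof -
  define a where "a = n / k - 1 + \<epsilon>"
  obtain C where C: "C \<ge> 0" "\<And>r. 0 < r \<Longrightarrow> r < R \<Longrightarrow>
     (\<integral>\<^sup>+s\<in>{r<..<R}. ennreal (s powr (- a) * (s powr \<epsilon> * w s powr (- 1 / k))) \<partial>lborel) \<le> ennreal (C * r powr (1 - a))"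
    using tame_tail_bound[OF tame _ R, of a] \<epsilon> by (auto simp: a_def)
  have "\<bar>v r\<bar> \<le> C powr (k / (k + 1)) * A powr (1 / (k + 1)) * r powr (- (n - 2 * k + \<epsilon> * k) / (k + 1))"
    if ug: "upper_gradient R v \<phi>" and A: "0 \<le> A"
      and E: "energy n k R w \<phi> \<le> ennreal A"
      and r: "0 < r" "r < R" for v \<phi> A r
  proof -
    have [measurable]: "\<phi> \<in> borel_measurable borel" and \<phi>0: "\<And>s. 0 \<le> \<phi> s" using ug by (auto simp: upper_gradient_def)
    have "ennreal \<bar>v r\<bar> \<le> (\<integral>\<^sup>+s\<in>{r<..<R}. ennreal (\<phi> s) \<partial>lborel)" using ug r by (auto simp: upper_gradient_def)
    also have "\<dots> \<le> ennreal (A powr (1 / (k + 1)) * (C * r powr (1 - a)) powr (k / (k + 1)))"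
      using C r by (intro energy_Hoelder[OF k _ _ _ _ w0 wp \<phi>0 _ _ A E, where \<epsilon> = \<epsilon>]) (auto simp: a_def[symmetric])
    finally have "\<bar>v r\<bar> \<le> A powr (1 / (k + 1)) * (C * r powr (1 - a)) powr (k / (k + 1))"
      by (simp add: ennreal_le_iff)
    also have "(C * r powr (1 - a)) powr (k / (k + 1)) = C powr (k / (k + 1)) * r powr ((1 - a) * (k / (k + 1)))"
      using C(1) by (simp add: powr_mult powr_powr)
    also have "(1 - a) * (k / (k + 1)) = - (n - 2 * k + \<epsilon> * k) / (k + 1)"
    proof -
      have "(1 - a) * k = - (n - 2 * k + \<epsilon> * k)" using k by (simp add: a_def field_simps)
      then show ?thesis by (simp only: times_divide_eq_right)
    qed
    finally show ?thesis by (simp add: mult_ac)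
  qed
  note bound = this
  show ?thesis
  proof (intro exI[of _ "C powr (k / (k + 1))"] conjI allI impI)
    fix v \<phi> :: "real \<Rightarrow> real" and A r :: real
    assume "upper_gradient R v \<phi>" "0 \<le> A" "0 < r" "r < R"
      "energy n k R w \<phi> \<le> ennreal A"
    then show "\<bar>v r\<bar> \<le> C powr (k / (k + 1)) * A powr (1 / (k + 1)) * r powr (- (n - 2 * k + \<epsilon> * k) / (k + 1))"
      by (intro bound)
  qed simp
qed

section \<open>From bounds for upper gradients to embeddings\<close>

lemma nn_integral_powr_bounded_interval:
  assumes a: "a > -1" and R: "R > 0"
  shows "(\<integral>\<^sup>+s\<in>{0<..<R}. ennreal (s powr a) \<partial>lborel) = ennreal (R powr (a + 1) / (a + 1))"
proof -
  have "((\<lambda>s. s powr a) has_integral R powr (a + 1) / (a + 1)) {0..R}"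
    by (rule has_integral_powr_from_0) (use a R in auto)
  then have "(\<integral>\<^sup>+s. ennreal (indicator {0..R} s * s powr a) \<partial>lborel) = ennreal (R powr (a + 1) / (a + 1))"
    by (intro nn_integral_has_integral_lebesgue) auto
  moreover have "(\<integral>\<^sup>+s\<in>{0<..<R}. ennreal (s powr a) \<partial>lborel) = (\<integral>\<^sup>+s. ennreal (indicator {0..R} s * s powr a) \<partial>lborel)"
  proof (rule nn_integral_cong_AE)
    have "AE s in lborel. s \<noteq> R" by (rule AE_lborel_singleton)
    then show "AE s in lborel. ennreal (s powr a) * indicator {0<..<R} s = ennreal (indicator {0..R} s * s powr a)"
      by eventually_elim (auto simp: indicator_def)
  qed
  ultimately show ?thesis by simp
qed

abbreviation Lp_integral :: "real \<Rightarrow> real \<Rightarrow> real \<Rightarrow> (real \<Rightarrow> real) \<Rightarrow> ennreal" where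
  "Lp_integral p \<alpha> R v \<equiv> \<integral>\<^sup>+r\<in>{0<..<R}. ennreal (r powr \<alpha> * \<bar>v r\<bar> powr p) \<partial>lborel"

lemma borel_measurable_Lp_integrand:
  fixes v :: "real \<Rightarrow> real"
  assumes "continuous_on {0<..<R} v"
  shows "(\<lambda>r. indicat_real {0<..<R} r *\<^sub>R (r powr \<alpha> * \<bar>v r\<bar> powr p)) \<in> borel_measurable borel"
proof -
  define V where "V r = indicat_real {0<..<R} r *\<^sub>R v r" for r
  have [measurable]: "V \<in> borel_measurable borel"
    unfolding V_def using borel_measurable_continuous_on_indicator[OF _ assms] by simp
  have "(\<lambda>r. indicat_real {0<..<R} r *\<^sub>R (r powr \<alpha> * \<bar>v r\<bar> powr p)) =
    (\<lambda>r. indicat_real {0<..<R} r * (r powr \<alpha> * \<bar>V r\<bar> powr p))"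
    by (auto simp: V_def indicator_def)
  then show ?thesis by simp
qed

lemma L_space_I:
  assumes cont: "continuous_on {0<..<R} v" and p: "p > 0" and D: "0 \<le> D"
    and I: "Lp_integral p \<alpha> R v \<le> ennreal D"
  shows "v \<in> L_space p \<alpha> R" and "norm_L p \<alpha> R v \<le> D powr (1 / p)"
proof -
  let ?h = "\<lambda>r. indicat_real {0<..<R} r *\<^sub>R (r powr \<alpha> * \<bar>v r\<bar> powr p)"
  have hm: "?h \<in> borel_measurable lborel" using borel_measurable_Lp_integrand[OF cont] by simp
  have *: "(\<integral>\<^sup>+r. ennreal (?h r) \<partial>lborel) \<le> ennreal D"
  proof -
    have "(\<integral>\<^sup>+r. ennreal (?h r) \<partial>lborel) = Lp_integral p \<alpha> R v"
      by (rule nn_integral_cong) (auto simp: indicator_def)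
    then show ?thesis using I by simp
  qed
  have h0: "0 \<le> ?h r" for r by simp
  have int: "integrable lborel ?h"
    using hm by (rule integrableI_nonneg) (use le_less_trans[OF * ennreal_less_top] in auto)
  have "integrable lebesgue ?h" using integrable_completion[OF hm] int by simp
  moreover have "v \<in> borel_measurable (lebesgue_on {0<..<R})"
    by (rule continuous_imp_measurable_on_sets_lebesgue[OF cont]) simp
  ultimately show "v \<in> L_space p \<alpha> R" by (simp add: L_space_def set_integrable_def)
  have "ennreal (LINT r|lborel. ?h r) \<le> ennreal D"
    using * nn_integral_eq_integral[OF int] h0 by simp
  then have "(LINT r|lborel. ?h r) \<le> D" using D by (simp add: ennreal_le_iff)
  then have "(LINT r|lebesgue. ?h r) \<le> D" using integral_completion[OF hm] by simp
  moreover have "0 \<le> (LINT r|lebesgue. ?h r)" by (rule integral_nonneg_AE) simp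
  ultimately show "norm_L p \<alpha> R v \<le> D powr (1 / p)"
    unfolding norm_L_def set_lebesgue_integral_def using p by (intro powr_mono2) auto
qed

text \<open>The energy is homogeneous of degree k+1 and the integral of degree p, which dictates the
  exponent p/(k+1) in \<open>bound\<close>. Inserting the energy of v for A and taking p-th roots
  produces a multiple of the norm.\<close>

lemma continuous_embedding_X_L:
  fixes c n k R p \<alpha> C :: real
  assumes R: "0 < R" and k: "1 \<le> k" and c: "0 < c" and p: "1 \<le> p" and C: "0 \<le> C"
    and w: "w \<in> borel_measurable borel" and w0: "\<And>s. 0 \<le> w s"
    and bound: "\<And>v \<phi> A. upper_gradient R v \<phi> \<Longrightarrow> 0 \<le> A \<Longrightarrow>
      energy n k R w \<phi> \<le> ennreal A \<Longrightarrow>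
      Lp_integral p \<alpha> R v \<le> ennreal (C * A powr (p / (k + 1)))"
  shows "continuous_embedding (X_space c n k R w) (norm_w c n k R w) (L_space p \<alpha> R) (norm_L p \<alpha> R)"
proof -
  have "v \<in> L_space p \<alpha> R \<and> norm_L p \<alpha> R v \<le> C powr (1 / p) / c powr (1 / (k + 1)) * norm_w c n k R w v"
    if v: "v \<in> X_space c n k R w" for v
  proof -
    obtain \<phi> where \<phi>: "upper_gradient R v \<phi>"
      "energy n k R w \<phi>
       = ennreal (norm_w c n k R w v powr (k + 1) / c)"
      using X_space_upper_gradient[OF R _ c w w0 v] k by auto
    define N where "N = norm_w c n k R w v"
    have N: "0 \<le> N" by (simp add: N_def norm_w_def)
    define A where "A = N powr (k + 1) / c"
    have A: "0 \<le> A" using c by (simp add: A_def)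
    have I: "Lp_integral p \<alpha> R v \<le> ennreal (C * A powr (p / (k + 1)))"
      by (rule bound[OF \<phi>(1) A]) (simp add: \<phi>(2) A_def N_def)
    have cont: "continuous_on {0<..<R} v" using \<phi>(1) by (simp add: upper_gradient_def)
    have D: "0 \<le> C * A powr (p / (k + 1))" using C by simp
    have "norm_L p \<alpha> R v \<le> (C * A powr (p / (k + 1))) powr (1 / p)"
      using L_space_I(2)[OF cont _ D I] p by simp
    also have "\<dots> = C powr (1 / p) * A powr (1 / (k + 1))"
      using C p by (simp add: powr_mult powr_powr)
    also have "A powr (1 / (k + 1)) = N / c powr (1 / (k + 1))"
      using N c k by (simp add: A_def powr_divide powr_powr)
    finally show ?thesis using L_space_I(1)[OF cont _ D I] p by (simp add: N_def)
  qed
  then show ?thesis unfolding continuous_embedding_def by blast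
qed

lemma pointwise_imp_Lp_bound:
  fixes \<alpha> \<kappa> p K R :: real
  assumes R: "0 < R" and K: "0 \<le> K" and p: "0 < p" and a: "\<alpha> - \<kappa> * p > -1"
    and v: "\<And>r. 0 < r \<Longrightarrow> r < R \<Longrightarrow> \<bar>v r\<bar> \<le> K * r powr (- \<kappa>)"
  shows "Lp_integral p \<alpha> R v
    \<le> ennreal (R powr (\<alpha> - \<kappa> * p + 1) / (\<alpha> - \<kappa> * p + 1) * K powr p)"
proof -
  have "Lp_integral p \<alpha> R v
     \<le> (\<integral>\<^sup>+r. ennreal (K powr p) * (ennreal (r powr (\<alpha> - \<kappa> * p)) * indicator {0<..<R} r) \<partial>lborel)"
  proof (rule nn_integral_mono)
    fix r
    have "r powr \<alpha> * \<bar>v r\<bar> powr p \<le> K powr p * r powr (\<alpha> - \<kappa> * p)" if r: "0 < r" "r < R"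
    proof -
      have "\<bar>v r\<bar> powr p \<le> (K * r powr (- \<kappa>)) powr p" using v[OF r] p by (intro powr_mono2) auto
      also have "\<dots> = K powr p * r powr (- (\<kappa> * p))" using K by (simp add: powr_mult powr_powr)
      finally have "r powr \<alpha> * \<bar>v r\<bar> powr p \<le> r powr \<alpha> * (K powr p * r powr (- (\<kappa> * p)))"
        by (intro mult_left_mono) auto
      also have "\<dots> = K powr p * (r powr \<alpha> * r powr (- (\<kappa> * p)))" by (simp only: mult_ac)
      also have "r powr \<alpha> * r powr (- (\<kappa> * p)) = r powr (\<alpha> - \<kappa> * p)"
        by (simp add: powr_add[symmetric])
      finally show ?thesis .
    qed
    then show "ennreal (r powr \<alpha> * \<bar>v r\<bar> powr p) * indicator {0<..<R} r
      \<le> ennreal (K powr p) * (ennreal (r powr (\<alpha> - \<kappa> * p)) * indicator {0<..<R} r)"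
      by (auto simp: indicator_def ennreal_mult[symmetric] intro!: ennreal_leI)
  qed
  also have "\<dots> = ennreal (K powr p) * ennreal (R powr (\<alpha> - \<kappa> * p + 1) / (\<alpha> - \<kappa> * p + 1))"
    by (subst nn_integral_cmult) (use a R in \<open>auto simp: nn_integral_powr_bounded_interval\<close>)
  finally show ?thesis using a by (simp add: ennreal_mult[symmetric] mult.commute)
qed

section \<open>Compactness\<close>

text \<open>The Arzela-Ascoli argument with pointwise convergence as its goal, which is all that
  dominated convergence needs. A diagonal sequence converges at the rationals of S, and
  equicontinuity carries this to every point of S and makes the limit continuous.\<close>

lemma equicontinuous_subsequence:
  fixes u :: "nat \<Rightarrow> real \<Rightarrow> real"
  assumes S: "open S" and bd: "\<And>j x. x \<in> S \<Longrightarrow> \<bar>u j x\<bar> \<le> M x"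
    and eq: "\<And>x e. x \<in> S \<Longrightarrow> 0 < e \<Longrightarrow> \<exists>d>0. \<forall>y\<in>S. \<bar>y - x\<bar> < d \<longrightarrow> (\<forall>j. \<bar>u j y - u j x\<bar> \<le> e)"
  obtains s v where "strict_mono (s :: nat \<Rightarrow> nat)" "\<And>x. x \<in> S \<Longrightarrow> (\<lambda>j. u (s j) x) \<longlonglongrightarrow> v x"
    "continuous_on S v"
proof -
  \<comment> \<open>The bound M may be unbounded on S, whereas the diagonal argument asks for one
    bound at all points; hence the normalisation.\<close>
  define f where "f j x = u j x / (1 + \<bar>M x\<bar>)" for j x
  have "norm (f j x) \<le> 1" if "x \<in> S \<inter> \<rat>" for j x
  proof -
    have "\<bar>u j x\<bar> \<le> 1 + \<bar>M x\<bar>" using bd[of x j] that by auto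
    then show ?thesis by (simp add: f_def divide_le_eq)
  qed
  moreover have "countable (S \<inter> \<rat>)" using countable_rat by (rule countable_subset[rotated]) auto
  ultimately obtain s where s: "strict_mono (s :: nat \<Rightarrow> nat)" "\<And>x. x \<in> S \<inter> \<rat> \<Longrightarrow> \<exists>l. (\<lambda>j. f (s j) x) \<longlonglongrightarrow> l"
    using function_convergent_subsequence[of "S \<inter> \<rat>" f 1] by blast
  have rat: "convergent (\<lambda>j. u (s j) x)" if x: "x \<in> S \<inter> \<rat>" for x
  proof -
    obtain l where "(\<lambda>j. f (s j) x) \<longlonglongrightarrow> l" using s(2)[OF x] by blast
    then have "(\<lambda>j. f (s j) x * (1 + \<bar>M x\<bar>)) \<longlonglongrightarrow> l * (1 + \<bar>M x\<bar>)" by (intro tendsto_intros)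
    moreover have "f (s j) x * (1 + \<bar>M x\<bar>) = u (s j) x" for j by (simp add: f_def)
    ultimately show ?thesis by (auto simp: convergent_def)
  qed
  have conv: "convergent (\<lambda>j. u (s j) x)" if x: "x \<in> S" for x
  proof -
    have "Cauchy (\<lambda>j. u (s j) x)"
    proof (rule metric_CauchyI)
      fix e :: real assume e: "0 < e"
      obtain d where d: "d > 0" "\<forall>y\<in>S. \<bar>y - x\<bar> < d \<longrightarrow> (\<forall>j. \<bar>u j y - u j x\<bar> \<le> e / 4)"
        using eq[OF x, of "e / 4"] e by auto
      obtain d' where d': "d' > 0" "ball x d' \<subseteq> S" using S x by (meson openE)
      obtain y where y: "y \<in> \<rat>" "x < y" "y < x + min d d'" using Rats_dense_in_real[of x "x + min d d'"] d d' by auto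
      have yS: "y \<in> S" using d'(2) y by (auto simp: subset_iff dist_real_def)
      have near: "\<bar>u j y - u j x\<bar> \<le> e / 4" for j using d(2) yS y by auto
      have "Cauchy (\<lambda>j. u (s j) y)" using rat[of y] yS y by (simp add: Cauchy_convergent_iff)
      then obtain N where N: "\<And>m n. m \<ge> N \<Longrightarrow> n \<ge> N \<Longrightarrow> dist (u (s m) y) (u (s n) y) < e / 4"
        using metric_CauchyD[of _ "e / 4"] e by (metis divide_pos_pos zero_less_numeral)
      have "dist (u (s m) x) (u (s n) x) < e" if "m \<ge> N" "n \<ge> N" for m n
        using N[OF that] near[of "s m"] near[of "s n"] e unfolding dist_real_def by linarith
      then show "\<exists>N. \<forall>m\<ge>N. \<forall>n\<ge>N. dist (u (s m) x) (u (s n) x) < e" by blast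
    qed
    then show ?thesis by (simp add: Cauchy_convergent_iff)
  qed
  define v where "v x = lim (\<lambda>j. u (s j) x)" for x
  have lim: "(\<lambda>j. u (s j) x) \<longlonglongrightarrow> v x" if "x \<in> S" for x
    using conv[OF that] by (simp add: v_def convergent_LIMSEQ_iff)
  have "continuous_on S v"
    unfolding continuous_on_iff
  proof (intro ballI allI impI)
    fix x e assume x: "x \<in> S" and e: "0 < (e::real)"
    obtain d where d: "d > 0" "\<forall>y\<in>S. \<bar>y - x\<bar> < d \<longrightarrow> (\<forall>j. \<bar>u j y - u j x\<bar> \<le> e / 2)"
      using eq[OF x, of "e / 2"] e by auto
    have "dist (v y) (v x) < e" if y: "y \<in> S" "dist y x < d" for y
    proof -
      have "(\<lambda>j. \<bar>u (s j) y - u (s j) x\<bar>) \<longlonglongrightarrow> \<bar>v y - v x\<bar>"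
        by (intro tendsto_intros lim y x)
      then have "\<bar>v y - v x\<bar> \<le> e / 2"
        by (rule LIMSEQ_le_const2) (use d(2) y in \<open>auto simp: dist_real_def\<close>)
      then show ?thesis using e by (simp add: dist_real_def)
    qed
    then show "\<exists>d>0. \<forall>y\<in>S. dist y x < d \<longrightarrow> dist (v y) (v x) < e" using d(1) by blast
  qed
  then show thesis using that s(1) lim by blast
qed

text \<open>Integrals of the weight over short intervals are small, even next to a singularity of
  the weight, because they are increments of a continuous function. This function depends on the
  weight alone and will serve as a common modulus of continuity.\<close>

lemma tame_primitive:
  fixes a R :: real
  assumes G: "tame R G" and a: "a > 1" and R: "0 < R" and d: "0 < d" "d < R"
  obtains F where "continuous_on {d..R} F"
    "\<And>x y. d < x \<Longrightarrow> x \<le> y \<Longrightarrow> y < R \<Longrightarrow>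
       F x \<le> F y \<and> (\<integral>\<^sup>+s\<in>{x..y}. ennreal (s powr (- a) * G s) \<partial>lborel) = ennreal (F y - F x)"
proof -
  have [measurable]: "G \<in> borel_measurable borel" and G0: "\<And>s. 0 \<le> G s" using G by (auto simp: tame_def)
  obtain C where C: "C \<ge> 0" "\<And>r. 0 < r \<Longrightarrow> r < R \<Longrightarrow>
     (\<integral>\<^sup>+s\<in>{r<..<R}. ennreal (s powr (- a) * G s) \<partial>lborel) \<le> ennreal (C * r powr (1 - a))"
    using tame_tail_bound[OF G a R] by blast
  define h where "h s = indicat_real {d<..<R} s * (s powr (- a) * G s)" for s
  have h0: "0 \<le> h s" for s using G0 by (simp add: h_def)
  have [measurable]: "h \<in> borel_measurable borel" unfolding h_def by measurable
  have "(\<integral>\<^sup>+s. ennreal (h s) \<partial>lborel) = (\<integral>\<^sup>+s\<in>{d<..<R}. ennreal (s powr (- a) * G s) \<partial>lborel)"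
    by (rule nn_integral_cong) (auto simp: h_def indicator_def)
  also have "\<dots> < \<infinity>" using le_less_trans[OF C(2)[OF d] ennreal_less_top] by simp
  finally have "integrable lborel h"
    by (intro integrableI_nonneg) (use h0 in auto)
  then have "h integrable_on UNIV" by (rule integrable_on_lborel)
  then have int: "h integrable_on {x..y}" for x y
    using integrable_on_subinterval[of h UNIV x y] by simp
  define F where "F x = integral {d..x} h" for x
  show thesis
  proof (rule that)
    show "continuous_on {d..R} F" unfolding F_def by (rule indefinite_integral_continuous_1[OF int])
    fix x y assume xy: "d < x" "x \<le> y" "y < R"
    have diff: "F y - F x = integral {x..y} h"
      using Henstock_Kurzweil_Integration.integral_combine[of d x y h] int xy by (simp add: F_def)
    moreover have "0 \<le> integral {x..y} h" by (rule integral_nonneg[OF int]) (use h0 in auto)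
    moreover have "(\<integral>\<^sup>+s\<in>{x..y}. ennreal (s powr (- a) * G s) \<partial>lborel) = (\<integral>\<^sup>+s. ennreal (indicator {x..y} s * h s) \<partial>lborel)"
      by (rule nn_integral_cong) (use xy in \<open>auto simp: h_def indicator_def\<close>)
    moreover have "(\<integral>\<^sup>+s. ennreal (indicator {x..y} s * h s) \<partial>lborel) = ennreal (integral {x..y} h)"
      by (rule nn_integral_has_integral_lebesgue) (use h0 int in auto)
    ultimately show "F x \<le> F y \<and> (\<integral>\<^sup>+s\<in>{x..y}. ennreal (s powr (- a) * G s) \<partial>lborel) = ennreal (F y - F x)"
      by simp
  qed
qed

lemma upper_gradient_increment:
  fixes n k R \<epsilon> A a b D :: real
  assumes k: "k \<ge> 1" and ab: "0 < a" "a \<le> b" "b < R"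
    and [measurable]: "w \<in> borel_measurable borel" and w0: "\<And>s. 0 \<le> w s" and wp: "AE s in lborel. w s > 0"
    and D: "0 \<le> D" "(\<integral>\<^sup>+s\<in>{a..b}. ennreal (s powr (- (n / k - 1 + \<epsilon>)) * (s powr \<epsilon> * w s powr (- 1 / k))) \<partial>lborel) \<le> ennreal D"
    and ug: "upper_gradient R v \<phi>" and A: "0 \<le> A"
    and E: "energy n k R w \<phi> \<le> ennreal A"
  shows "\<bar>v b - v a\<bar> \<le> A powr (1 / (k + 1)) * D powr (k / (k + 1))"
proof -
  have [measurable]: "\<phi> \<in> borel_measurable borel" and \<phi>0: "\<And>s. 0 \<le> \<phi> s" using ug by (auto simp: upper_gradient_def)
  have "ennreal \<bar>v b - v a\<bar> \<le> (\<integral>\<^sup>+s\<in>{a..b}. ennreal (\<phi> s) \<partial>lborel)" using ug ab by (auto simp: upper_gradient_def)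
  also have "\<dots> \<le> ennreal (A powr (1 / (k + 1)) * D powr (k / (k + 1)))"
    by (rule energy_Hoelder[OF k _ _ _ _ w0 wp \<phi>0 D A E]) (use ab in auto)
  finally show ?thesis by (simp add: ennreal_le_iff)
qed

text \<open>Hoelder on [a,b] bounds the increment of v by a constant times
  \<open>(F b - F a) powr (k / (k + 1))\<close>, where F does not depend on v. Keeping y above x/2
  stays away from the singularity at 0.\<close>

lemma upper_gradient_equicontinuous:
  fixes n k R \<epsilon> A x e :: real
  assumes k: "k \<ge> 1" and R: "0 < R" and \<epsilon>: "n / k - 1 + \<epsilon> > 1"
    and w: "w \<in> borel_measurable borel" and w0: "\<And>s. 0 \<le> w s" and wp: "AE s in lborel. w s > 0"
    and tame: "tame R (\<lambda>s. s powr \<epsilon> * w s powr (- 1 / k))"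
    and A: "0 \<le> A" and x: "x \<in> {0<..<R}" and e: "0 < e"
  shows "\<exists>d>0. \<forall>y\<in>{0<..<R}. \<bar>y - x\<bar> < d \<longrightarrow> (\<forall>v \<phi>. upper_gradient R v \<phi> \<longrightarrow>
     energy n k R w \<phi> \<le> ennreal A \<longrightarrow> \<bar>v y - v x\<bar> \<le> e)"
proof -
  have x2: "0 < x / 2" "x / 2 < R" using x by auto
  obtain F where F: "continuous_on {x / 2..R} F"
    "\<And>a b. x / 2 < a \<Longrightarrow> a \<le> b \<Longrightarrow> b < R \<Longrightarrow> F a \<le> F b \<and>
      (\<integral>\<^sup>+s\<in>{a..b}. ennreal (s powr (- (n / k - 1 + \<epsilon>)) * (s powr \<epsilon> * w s powr (- 1 / k))) \<partial>lborel) = ennreal (F b - F a)"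
    using tame_primitive[OF tame \<epsilon> R x2] by blast
  define M where "M = A powr (1 / (k + 1))"
  have M: "M \<ge> 0" by (simp add: M_def)
  \<comment> \<open>Chosen so that \<open>M * \<eta> powr (k / (k + 1)) \<le> e\<close>; the summand
    1 covers M = 0.\<close>
  define \<eta> where "\<eta> = (e / (M + 1)) powr ((k + 1) / k)"
  have \<eta>: "\<eta> > 0" using e M by (simp add: \<eta>_def)
  have \<eta>e: "M * \<eta> powr (k / (k + 1)) \<le> e"
  proof -
    have "\<eta> powr (k / (k + 1)) = e / (M + 1)" using e M k by (simp add: \<eta>_def powr_powr)
    moreover have "M * (e / (M + 1)) \<le> e" using e M by (simp add: field_simps)
    ultimately show ?thesis by simp
  qed
  have "x \<in> {x / 2..R}" using x by auto
  then obtain d where d: "d > 0" "\<forall>y\<in>{x / 2..R}. dist y x < d \<longrightarrow> dist (F y) (F x) < \<eta>"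
    using F(1) \<eta> unfolding continuous_on_iff by blast
  have "\<bar>v y - v x\<bar> \<le> e" if y: "y \<in> {0<..<R}" "\<bar>y - x\<bar> < min d (x / 2)" and ug: "upper_gradient R v \<phi>"
    and E: "energy n k R w \<phi> \<le> ennreal A" for y v \<phi>
  proof -
    have "x - y < x / 2" using y(2) by linarith
    then have ylo: "x / 2 < y" "y < R" using y(1) by auto
    have Fyx: "\<bar>F y - F x\<bar> < \<eta>" using d(2) y ylo by (auto simp: dist_real_def)
    have inc: "\<bar>v b - v a\<bar> \<le> e" if ab: "x / 2 < a" "a \<le> b" "b < R" "F b - F a < \<eta>" for a b
    proof -
      have Fab: "F a \<le> F b" using F(2)[OF ab(1-3)] by blast
      have "\<bar>v b - v a\<bar> \<le> M * (F b - F a) powr (k / (k + 1))"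
        unfolding M_def
        by (rule upper_gradient_increment[OF k _ ab(2,3) w w0 wp _ _ ug A E, where \<epsilon> = \<epsilon>])
          (use F(2)[OF ab(1-3)] x2 ab in auto)
      also have "\<dots> \<le> M * \<eta> powr (k / (k + 1))"
        using ab(4) Fab k M by (intro mult_left_mono powr_mono2) auto
      finally show ?thesis using \<eta>e by linarith
    qed
    show ?thesis
    proof (cases "x \<le> y")
      case True
      then show ?thesis using inc[of x y] ylo x2 x Fyx by auto
    next
      case False
      then have "\<bar>v x - v y\<bar> \<le> e" using inc[of y x] ylo x Fyx by auto
      then show ?thesis by (simp add: abs_minus_commute)
    qed
  qed
  then show ?thesis using d(1) x2 by (intro exI[of _ "min d (x / 2)"]) auto
qed

lemma norm_L_dominated_convergence:
  fixes \<alpha> \<kappa> p K R :: real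
  assumes R: "0 < R" and p: "0 < p" and a: "\<alpha> - \<kappa> * p > -1" and K: "0 \<le> K"
    and cont: "\<And>j. continuous_on {0<..<R} (f j)"
    and bd: "\<And>j r. 0 < r \<Longrightarrow> r < R \<Longrightarrow> \<bar>f j r\<bar> \<le> K * r powr (- \<kappa>)"
    and lim: "\<And>r. 0 < r \<Longrightarrow> r < R \<Longrightarrow> (\<lambda>j. f j r) \<longlonglongrightarrow> 0"
  shows "(\<lambda>j. norm_L p \<alpha> R (f j)) \<longlonglongrightarrow> 0"
proof -
  define h where "h j r = indicat_real {0<..<R} r *\<^sub>R (r powr \<alpha> * \<bar>f j r\<bar> powr p)" for j r
  define g where "g r = indicat_real {0<..<R} r * (K powr p * r powr (\<alpha> - \<kappa> * p))" for r
  have hm: "h j \<in> borel_measurable lborel" for j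
    unfolding h_def using borel_measurable_Lp_integrand[OF cont] by simp
  have gm: "g \<in> borel_measurable borel" unfolding g_def by measurable
  have "(\<integral>\<^sup>+r. ennreal (g r) \<partial>lborel) = (\<integral>\<^sup>+r. ennreal (K powr p) * (ennreal (r powr (\<alpha> - \<kappa> * p)) * indicator {0<..<R} r) \<partial>lborel)"
    by (rule nn_integral_cong) (auto simp: g_def indicator_def ennreal_mult)
  also have "\<dots> = ennreal (K powr p) * ennreal (R powr (\<alpha> - \<kappa> * p + 1) / (\<alpha> - \<kappa> * p + 1))"
    by (subst nn_integral_cmult) (use a R in \<open>auto simp: nn_integral_powr_bounded_interval\<close>)
  also have "\<dots> < \<infinity>" by (simp add: ennreal_mult_less_top)
  finally have gi: "integrable lborel g"
    using gm by (intro integrableI_nonneg) (auto simp: g_def)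
  have "(\<lambda>j. LINT r|lborel. h j r) \<longlonglongrightarrow> integral\<^sup>L lborel (\<lambda>_::real. 0::real)"
  proof (rule integral_dominated_convergence[where s = h and w = g])
    show "h j \<in> borel_measurable lborel" for j by (rule hm)
    show "integrable lborel g" by (rule gi)
    show "AE r in lborel. (\<lambda>j. h j r) \<longlonglongrightarrow> 0"
    proof (rule AE_I2)
      fix r
      show "(\<lambda>j. h j r) \<longlonglongrightarrow> 0"
      proof (cases "r \<in> {0<..<R}")
        case True
        have "(\<lambda>j. \<bar>f j r\<bar> powr p) \<longlonglongrightarrow> 0"
          by (rule tendsto_zero_powrI[where b = p]) (use lim[of r] True p in \<open>auto simp: tendsto_rabs_zero_iff\<close>)
        then have "(\<lambda>j. r powr \<alpha> * \<bar>f j r\<bar> powr p) \<longlonglongrightarrow> 0" by (rule tendsto_mult_right_zero)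
        then show ?thesis using True by (simp add: h_def)
      qed (simp add: h_def)
    qed
    fix j
    show "AE r in lborel. norm (h j r) \<le> g r"
    proof (rule AE_I2)
      fix r
      show "norm (h j r) \<le> g r"
      proof (cases "r \<in> {0<..<R}")
        case True
        have "\<bar>f j r\<bar> powr p \<le> (K * r powr (- \<kappa>)) powr p" using bd[of r j] True p by (intro powr_mono2) auto
        also have "\<dots> = K powr p * r powr (- (\<kappa> * p))" using K by (simp add: powr_mult powr_powr)
        finally have "r powr \<alpha> * \<bar>f j r\<bar> powr p \<le> r powr \<alpha> * (K powr p * r powr (- (\<kappa> * p)))"
          by (intro mult_left_mono) auto
        also have "\<dots> = K powr p * (r powr \<alpha> * r powr (- (\<kappa> * p)))" by (simp only: mult_ac)
        also have "r powr \<alpha> * r powr (- (\<kappa> * p)) = r powr (\<alpha> - \<kappa> * p)"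
          by (simp add: powr_add[symmetric])
        finally show ?thesis using True by (simp add: h_def g_def)
      qed (simp add: h_def g_def)
    qed
  qed simp
  then have "(\<lambda>j. LINT r|lborel. h j r) \<longlonglongrightarrow> 0" by simp
  moreover have "norm_L p \<alpha> R (f j) = (LINT r|lborel. h j r) powr (1 / p)" for j
    unfolding norm_L_def set_lebesgue_integral_def h_def[symmetric] using integral_completion[OF hm] by simp
  moreover have "0 \<le> (LINT r|lborel. h j r)" for j by (rule integral_nonneg_AE) (simp add: h_def)
  ultimately show ?thesis
    using p by (simp only:) (rule tendsto_zero_powrI[where b = "1 / p"], auto)
qed

text \<open>The subsequence converges pointwise, its limit inherits the bound
  \<open>K * r powr (- \<kappa>)\<close>, and so twice that bound dominates the differences. The
  limit is only claimed to lie in the target space. The condition \<open>a\<close> is the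
  integrability of the p-th power of the dominating function against r^\<alpha>.\<close>

lemma compact_embedding_X_L:
  fixes c n k R p \<alpha> \<epsilon> :: real
  assumes R: "0 < R" and k: "1 \<le> k" and c: "0 < c" and p: "1 \<le> p"
    and \<epsilon>: "n / k - 1 + \<epsilon> > 1"
    and w: "w \<in> borel_measurable borel" and w0: "\<And>s. 0 \<le> w s" and wp: "AE s in lborel. w s > 0"
    and tame: "tame R (\<lambda>s. s powr \<epsilon> * w s powr (- 1 / k))"
    and a: "\<alpha> - (n - 2 * k + \<epsilon> * k) / (k + 1) * p > -1"
  shows "compact_embedding (X_space c n k R w) (norm_w c n k R w) (L_space p \<alpha> R) (norm_L p \<alpha> R)"
proof -
  define \<kappa> where "\<kappa> = (n - 2 * k + \<epsilon> * k) / (k + 1)"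
  have a': "\<alpha> - \<kappa> * p > -1" using a by (simp add: \<kappa>_def)
  have \<kappa>: "- (n - 2 * k + \<epsilon> * k) / (k + 1) = - \<kappa>"
    unfolding \<kappa>_def by (simp only: minus_divide_left)
  obtain C where C: "C \<ge> 0" "\<And>v \<phi> A r. upper_gradient R v \<phi> \<Longrightarrow> 0 \<le> A \<Longrightarrow>
     energy n k R w \<phi> \<le> ennreal A \<Longrightarrow>
     0 < r \<Longrightarrow> r < R \<Longrightarrow> \<bar>v r\<bar> \<le> C * A powr (1 / (k + 1)) * r powr (- \<kappa>)"
    using upper_gradient_pointwise[OF k R \<epsilon> w w0 wp tame] unfolding \<kappa> by blast
  have emb: "continuous_embedding (X_space c n k R w) (norm_w c n k R w) (L_space p \<alpha> R) (norm_L p \<alpha> R)"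
  proof (rule continuous_embedding_X_L[OF R k c p _ w w0])
    show "0 \<le> R powr (\<alpha> - \<kappa> * p + 1) / (\<alpha> - \<kappa> * p + 1) * C powr p" using a' by simp
    fix v \<phi> :: "real \<Rightarrow> real" and A :: real
    assume ug: "upper_gradient R v \<phi>" and A: "0 \<le> A"
      and E: "energy n k R w \<phi> \<le> ennreal A"
    have "Lp_integral p \<alpha> R v
      \<le> ennreal (R powr (\<alpha> - \<kappa> * p + 1) / (\<alpha> - \<kappa> * p + 1) * (C * A powr (1 / (k + 1))) powr p)"
      by (rule pointwise_imp_Lp_bound[OF R _ _ a']) (use p C(1) C(2)[OF ug A E] in auto)
    also have "(C * A powr (1 / (k + 1))) powr p = C powr p * A powr (p / (k + 1))"
      using C(1) by (simp add: powr_mult powr_powr)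
    finally show "Lp_integral p \<alpha> R v
      \<le> ennreal (R powr (\<alpha> - \<kappa> * p + 1) / (\<alpha> - \<kappa> * p + 1) * C powr p * A powr (p / (k + 1)))"
      by (simp only: mult.assoc)
  qed
  have "\<exists>v\<in>L_space p \<alpha> R. \<exists>s :: nat \<Rightarrow> nat. strict_mono s \<and> (\<lambda>j. norm_L p \<alpha> R (\<lambda>r. u (s j) r - v r)) \<longlonglongrightarrow> 0"
    if u: "\<And>j. u j \<in> X_space c n k R w" and B: "\<And>j. norm_w c n k R w (u j) \<le> B" for u :: "nat \<Rightarrow> real \<Rightarrow> real" and B
  proof -
    define A where "A = B powr (k + 1) / c"
    have A: "0 \<le> A" using c by (simp add: A_def)
    have "\<exists>\<phi>. upper_gradient R (u j) \<phi> \<and>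
      energy n k R w \<phi> \<le> ennreal A" for j
    proof -
      obtain \<phi> where \<phi>: "upper_gradient R (u j) \<phi>"
        "energy n k R w \<phi>
         = ennreal (norm_w c n k R w (u j) powr (k + 1) / c)"
        using X_space_upper_gradient[OF R _ c w w0 u[of j]] k by auto
      have "0 \<le> norm_w c n k R w (u j)" by (simp add: norm_w_def)
      then have "norm_w c n k R w (u j) powr (k + 1) / c \<le> A"
        unfolding A_def using B[of j] k c by (intro divide_right_mono powr_mono2) auto
      then show ?thesis using \<phi> by (metis ennreal_leI)
    qed
    then obtain \<phi> where \<phi>: "\<And>j. upper_gradient R (u j) (\<phi> j)"
      "\<And>j. energy n k R w (\<phi> j) \<le> ennreal A"
      by metis
    define K where "K = C * A powr (1 / (k + 1))"
    have K: "0 \<le> K" using C(1) by (simp add: K_def)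
    have bd: "\<bar>u j r\<bar> \<le> K * r powr (- \<kappa>)" if "r \<in> {0<..<R}" for j r
      unfolding K_def using C(2)[OF \<phi>(1) A \<phi>(2)] that by auto
    have eq: "\<exists>d>0. \<forall>y\<in>{0<..<R}. \<bar>y - x\<bar> < d \<longrightarrow> (\<forall>j. \<bar>u j y - u j x\<bar> \<le> e)" if x: "x \<in> {0<..<R}" "0 < e" for x e
    proof -
      obtain d where d: "d > 0" "\<forall>y\<in>{0<..<R}. \<bar>y - x\<bar> < d \<longrightarrow> (\<forall>v \<phi>. upper_gradient R v \<phi> \<longrightarrow>
        energy n k R w \<phi> \<le> ennreal A \<longrightarrow> \<bar>v y - v x\<bar> \<le> e)"
        using upper_gradient_equicontinuous[OF k R \<epsilon> w w0 wp tame A x] by blast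
      have "\<bar>u j y - u j x\<bar> \<le> e" if "y \<in> {0<..<R}" "\<bar>y - x\<bar> < d" for y j
        using d(2) that \<phi>[of j] by blast
      then show ?thesis using d(1) by blast
    qed
    obtain s v where s: "strict_mono (s :: nat \<Rightarrow> nat)" and lim: "\<And>x. x \<in> {0<..<R} \<Longrightarrow> (\<lambda>j. u (s j) x) \<longlonglongrightarrow> v x"
      and cont: "continuous_on {0<..<R} v"
      using equicontinuous_subsequence[OF open_greaterThanLessThan bd eq] by blast
    have vbd: "\<bar>v r\<bar> \<le> K * r powr (- \<kappa>)" if r: "r \<in> {0<..<R}" for r
      by (rule LIMSEQ_le_const2[OF tendsto_rabs[OF lim[OF r]]]) (use bd[OF r] in auto)
    have "Lp_integral p \<alpha> R v
      \<le> ennreal (R powr (\<alpha> - \<kappa> * p + 1) / (\<alpha> - \<kappa> * p + 1) * K powr p)"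
      by (rule pointwise_imp_Lp_bound[OF R K _ a']) (use p vbd in auto)
    then have vL: "v \<in> L_space p \<alpha> R" by (rule L_space_I(1)[OF cont, rotated 2]) (use p a' in auto)
    have ucont: "continuous_on {0<..<R} (u j)" for j using \<phi>(1)[of j] by (simp add: upper_gradient_def)
    have "(\<lambda>j. norm_L p \<alpha> R (\<lambda>r. u (s j) r - v r)) \<longlonglongrightarrow> 0"
    proof (rule norm_L_dominated_convergence[OF R _ a', where K = "2 * K"])
      show "continuous_on {0<..<R} (\<lambda>r. u (s j) r - v r)" for j by (intro continuous_intros ucont cont)
      show "\<bar>u (s j) r - v r\<bar> \<le> 2 * K * r powr (- \<kappa>)" if "0 < r" "r < R" for j r
        using bd[of r "s j"] vbd[of r] that by auto
      show "(\<lambda>j. u (s j) r - v r) \<longlonglongrightarrow> 0" if "0 < r" "r < R" for r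
        using lim[of r] that by (simp add: LIM_zero_iff)
    qed (use p K in auto)
    then show ?thesis using vL s by blast
  qed
  then show ?thesis unfolding compact_embedding_def using emb by blast
qed

section \<open>The critical exponent\<close>

text \<open>
  Hoelder's inequality with the extra factor \<open>s powr (m / 2)\<close> and Tonelli's theorem. The logarithmic
  weight \<open>lam\<close> changes slowly, so the inner integral is dominated by its value at the upper end.
\<close>

lemma Hardy_weighted:
  fixes n k R CL :: real and lam w :: "real \<Rightarrow> real"
  defines "m \<equiv> n - 2 * k"
  assumes k: "k \<ge> 1" and R: "0 < R" and m: "m > 0"
    and w[measurable]: "w \<in> borel_measurable borel" and w0: "\<And>s. 0 \<le> w s" and wp: "AE s in lborel. w s > 0"
    and lam[measurable]: "lam \<in> borel_measurable borel" and lam1: "\<And>s. 1 \<le> lam s"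
    and slow: "\<And>r s. 0 < r \<Longrightarrow> r \<le> s \<Longrightarrow> s < R \<Longrightarrow> lam r \<le> CL * lam s * (s / r) powr (m / 4)" and CL: "0 \<le> CL"
    and tame: "tame R (\<lambda>s. (lam s / w s) powr (1 / k))"
  shows "\<exists>C\<ge>0. \<forall>v \<phi> A. upper_gradient R v \<phi> \<longrightarrow> 0 \<le> A \<longrightarrow>
     energy n k R w \<phi> \<le> ennreal A \<longrightarrow>
     (\<integral>\<^sup>+r\<in>{0<..<R}. ennreal (r powr (m - 1) * lam r * \<bar>v r\<bar> powr (k + 1)) \<partial>lborel) \<le> ennreal (C * A)"
proof -
  \<comment> \<open>Chosen so that \<open>(1 - a) * k = - m / 2\<close>: half of the exponent m is
    put into Hoelder's inequality, the other half is left for the integration in r.\<close>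
  define a where "a = 1 + m / (2 * k)"
  have a: "a > 1" using m k by (simp add: a_def)
  \<comment> \<open>The weight of the energy divided by \<open>s powr (m / 2)\<close> and by
    \<open>lam s\<close>. Both factors come back from the integration over r < s.\<close>
  define W where "W s = s powr (n - k - m / 2) * (w s / lam s)" for s
  have [measurable]: "W \<in> borel_measurable borel" unfolding W_def by measurable
  have lam0: "lam s > 0" for s using lam1[of s] by linarith
  have W0: "0 \<le> W s" for s using w0 lam0[of s] by (simp add: W_def)
  obtain C1 where C1: "C1 \<ge> 0" "\<And>r. 0 < r \<Longrightarrow> r < R \<Longrightarrow>
     (\<integral>\<^sup>+s\<in>{r<..<R}. ennreal (s powr (- a) * (lam s / w s) powr (1 / k)) \<partial>lborel) \<le> ennreal (C1 * r powr (1 - a))"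
    using tame_tail_bound[OF tame a R] by blast
  have Wk: "W s powr (- 1 / k) = s powr (- a) * (lam s / w s) powr (1 / k)" if s: "s > 0" for s
  proof -
    have "W s powr (- 1 / k) = (s powr (n - k - m / 2)) powr (- 1 / k) * (w s / lam s) powr (- 1 / k)"
      unfolding W_def using w0[of s] lam0[of s] s by (intro powr_mult)
    also have "(s powr (n - k - m / 2)) powr (- 1 / k) = s powr (- a)"
      using k unfolding powr_powr a_def m_def by (intro arg_cong[where f = "\<lambda>x. s powr x"]) (simp add: field_simps)
    also have "(w s / lam s) powr (- 1 / k) = (lam s / w s) powr (1 / k)"
      using w0[of s] lam0[of s] powr_minus_divide[of "w s / lam s" "1 / k"] by (simp add: powr_divide)
    finally show ?thesis .
  qed
  \<comment> \<open>The factors stem from Hoelder's inequality, from the slow variation of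
    \<open>lam\<close>, and from the integral of \<open>r powr (m / 4 - 1)\<close> over
    (0,s).\<close>
  define C where "C = C1 powr k * CL * (4 / m)"
  have C: "C \<ge> 0" using C1(1) CL m by (simp add: C_def)
  have "(\<integral>\<^sup>+r\<in>{0<..<R}. ennreal (r powr (m - 1) * lam r * \<bar>v r\<bar> powr (k + 1)) \<partial>lborel) \<le> ennreal (C * A)"
    if ug: "upper_gradient R v \<phi>" and A: "0 \<le> A"
      and E: "energy n k R w \<phi> \<le> ennreal A" for v \<phi> A
  proof -
    have [measurable]: "\<phi> \<in> borel_measurable borel" and \<phi>0: "\<And>s. 0 \<le> \<phi> s" using ug by (auto simp: upper_gradient_def)
    define J where "J r = (\<integral>\<^sup>+s\<in>{r<..<R}. ennreal (\<phi> s powr (k + 1) * W s) \<partial>lborel)" for r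
    \<comment> \<open>Hoelder's inequality is applied with real bounds, so the tail integral must be
      known to be finite; away from 0 it is at most a constant times the energy.\<close>
    have Jfin: "J r < \<infinity>" if r: "0 < r" "r < R" for r
    proof -
      have "(\<integral>\<^sup>+s\<in>{r<..<R}. ennreal (\<phi> s powr (k + 1) * W s) \<partial>lborel) \<le>
        (\<integral>\<^sup>+s. ennreal (r powr (- m / 2)) * (ennreal (s powr (n - k) * \<phi> s powr (k + 1) * w s) * indicator {0<..<R} s) \<partial>lborel)"
      proof (rule nn_integral_mono)
        fix s
        have "\<phi> s powr (k + 1) * W s \<le> r powr (- m / 2) * (s powr (n - k) * \<phi> s powr (k + 1) * w s)" if s: "r < s"
        proof -
          have "s powr (n - k - m / 2) = s powr (n - k) * s powr (- m / 2)" by (simp add: powr_add[symmetric])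
          also have "\<dots> \<le> s powr (n - k) * r powr (- m / 2)"
            using s r m by (intro mult_left_mono powr_mono2') auto
          finally have "s powr (n - k - m / 2) \<le> s powr (n - k) * r powr (- m / 2)" .
          moreover have "w s / lam s \<le> w s" using w0[of s] lam1[of s] lam0[of s]
            by (simp add: divide_le_eq mult_le_cancel_left1)
          ultimately have "W s \<le> (s powr (n - k) * r powr (- m / 2)) * w s"
            unfolding W_def using w0[of s] lam0[of s] by (intro mult_mono) auto
          then have "\<phi> s powr (k + 1) * W s \<le> \<phi> s powr (k + 1) * ((s powr (n - k) * r powr (- m / 2)) * w s)"
            by (intro mult_left_mono) auto
          then show ?thesis by (simp only: mult_ac)
        qed
        then show "ennreal (\<phi> s powr (k + 1) * W s) * indicator {r<..<R} s \<le>
          ennreal (r powr (- m / 2)) * (ennreal (s powr (n - k) * \<phi> s powr (k + 1) * w s) * indicator {0<..<R} s)"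
          using r w0[of s] by (auto simp: indicator_def ennreal_mult[symmetric] intro!: ennreal_leI)
      qed
      also have "\<dots> \<le> ennreal (r powr (- m / 2)) * ennreal A"
        using E by (subst nn_integral_cmult) (auto intro!: mult_left_mono)
      also have "\<dots> < \<infinity>" by (simp add: ennreal_mult_less_top)
      finally show ?thesis by (simp add: J_def)
    qed
    have pt: "ennreal (\<bar>v r\<bar> powr (k + 1)) \<le> ennreal (C1 powr k * r powr (- m / 2)) * J r" if r: "0 < r" "r < R" for r
    proof -
      obtain D where D: "0 \<le> D" "J r = ennreal D"
        using Jfin[OF r] by (metis ennreal_cases infinity_ennreal_def less_irrefl)
      have "ennreal \<bar>v r\<bar> \<le> (\<integral>\<^sup>+s\<in>{r<..<R}. ennreal (\<phi> s) \<partial>lborel)" using ug r by (auto simp: upper_gradient_def)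
      also have "\<dots> \<le> ennreal (D powr (1 / (k + 1)) * (C1 * r powr (1 - a)) powr (k / (k + 1)))"
      proof (rule nn_integral_weighted_Hoelder[where W = W])
        show "AE s in lborel. s \<in> {r<..<R} \<longrightarrow> 0 < W s"
          using wp by eventually_elim (use r lam0 in \<open>auto simp: W_def\<close>)
        have "(\<integral>\<^sup>+s\<in>{r<..<R}. ennreal (W s powr (- 1 / k)) \<partial>lborel) =
          (\<integral>\<^sup>+s\<in>{r<..<R}. ennreal (s powr (- a) * (lam s / w s) powr (1 / k)) \<partial>lborel)"
          by (rule nn_integral_cong) (use r Wk in \<open>auto simp: indicator_def\<close>)
        then show "(\<integral>\<^sup>+s\<in>{r<..<R}. ennreal (W s powr (- 1 / k)) \<partial>lborel) \<le> ennreal (C1 * r powr (1 - a))"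
          using C1(2)[OF r] by simp
        show "(\<integral>\<^sup>+s\<in>{r<..<R}. ennreal (\<phi> s powr (k + 1) * W s) \<partial>lborel) \<le> ennreal D"
          using D(2) by (simp add: J_def)
      qed (use k \<phi>0 D C1 in auto)
      finally have "\<bar>v r\<bar> \<le> D powr (1 / (k + 1)) * (C1 * r powr (1 - a)) powr (k / (k + 1))"
        by (simp add: ennreal_le_iff)
      then have "\<bar>v r\<bar> powr (k + 1) \<le> (D powr (1 / (k + 1)) * (C1 * r powr (1 - a)) powr (k / (k + 1))) powr (k + 1)"
        using k by (intro powr_mono2) auto
      also have "\<dots> = D * (C1 * r powr (1 - a)) powr k"
        using D(1) k by (simp add: powr_mult powr_powr)
      also have "(C1 * r powr (1 - a)) powr k = C1 powr k * r powr ((1 - a) * k)"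
        using C1(1) by (simp add: powr_mult powr_powr)
      also have "(1 - a) * k = - m / 2" using k by (simp add: a_def)
      finally have "\<bar>v r\<bar> powr (k + 1) \<le> C1 powr k * r powr (- m / 2) * D" by (simp only: mult_ac)
      then show ?thesis unfolding D(2) using C1(1) D(1) by (simp add: ennreal_mult[symmetric] ennreal_leI)
    qed
    \<comment> \<open>The triangle 0 < r < s < R is built into the integrand, so that the order of
      integration can be exchanged over the whole plane.\<close>
    define H where "H r s = (if 0 < r \<and> r < s \<and> s < R then
       ennreal (C1 powr k * r powr (m / 2 - 1) * lam r) * ennreal (\<phi> s powr (k + 1) * W s) else 0)" for r s
    have [measurable]: "case_prod H \<in> borel_measurable (lborel \<Otimes>\<^sub>M lborel)" unfolding H_def by measurable
    have "(\<integral>\<^sup>+r\<in>{0<..<R}. ennreal (r powr (m - 1) * lam r * \<bar>v r\<bar> powr (k + 1)) \<partial>lborel)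
      \<le> (\<integral>\<^sup>+r. (\<integral>\<^sup>+s. H r s \<partial>lborel) \<partial>lborel)"
    proof (rule nn_integral_mono)
      fix r
      show "ennreal (r powr (m - 1) * lam r * \<bar>v r\<bar> powr (k + 1)) * indicator {0<..<R} r \<le> (\<integral>\<^sup>+s. H r s \<partial>lborel)"
      proof (cases "r \<in> {0<..<R}")
        case True
        have "ennreal (r powr (m - 1) * lam r * \<bar>v r\<bar> powr (k + 1)) =
            ennreal (r powr (m - 1) * lam r) * ennreal (\<bar>v r\<bar> powr (k + 1))"
          using lam0[of r] by (simp add: ennreal_mult)
        also have "\<dots> \<le> ennreal (r powr (m - 1) * lam r) * (ennreal (C1 powr k * r powr (- m / 2)) * J r)"
          using pt[of r] True by (intro mult_left_mono) auto
        also have "\<dots> = ennreal (C1 powr k * r powr (m / 2 - 1) * lam r) * J r"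
        proof -
          have "r powr (m / 2 - 1) = r powr (m - 1) * r powr (- m / 2)" by (simp add: powr_add[symmetric])
          then have "C1 powr k * r powr (m / 2 - 1) * lam r = (r powr (m - 1) * lam r) * (C1 powr k * r powr (- m / 2))"
            by simp
          moreover have "ennreal ((r powr (m - 1) * lam r) * (C1 powr k * r powr (- m / 2))) =
              ennreal (r powr (m - 1) * lam r) * ennreal (C1 powr k * r powr (- m / 2))"
            using lam0[of r] by (intro ennreal_mult) auto
          ultimately show ?thesis by (simp only: mult.assoc)
        qed
        also have "\<dots> = (\<integral>\<^sup>+s. H r s \<partial>lborel)"
        proof -
          have "H r s = ennreal (C1 powr k * r powr (m / 2 - 1) * lam r) *
              (ennreal (\<phi> s powr (k + 1) * W s) * indicator {r<..<R} s)" for s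
            using True by (simp add: H_def indicator_def)
          then show ?thesis unfolding J_def by (simp add: nn_integral_cmult)
        qed
        finally show ?thesis using True by simp
      qed simp
    qed
    also have "\<dots> = (\<integral>\<^sup>+s. (\<integral>\<^sup>+r. H r s \<partial>lborel) \<partial>lborel)"
      by (rule lborel_pair.Fubini'[symmetric]) measurable
    also have "\<dots> \<le> (\<integral>\<^sup>+s. ennreal C * (ennreal (s powr (n - k) * \<phi> s powr (k + 1) * w s) * indicator {0<..<R} s) \<partial>lborel)"
    proof (rule nn_integral_mono)
      fix s
      show "(\<integral>\<^sup>+r. H r s \<partial>lborel) \<le> ennreal C * (ennreal (s powr (n - k) * \<phi> s powr (k + 1) * w s) * indicator {0<..<R} s)"
      proof (cases "s \<in> {0<..<R}")
        case True
        \<comment> \<open>Everything that does not involve r once \<open>lam r\<close> has been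
          replaced by means of \<open>slow\<close>. Of \<open>r powr (m / 2 - 1)\<close> the
          exponent m/4 is spent on that replacement, and \<open>r powr (m / 4 - 1)\<close> is still
          integrable at 0.\<close>
        define Z where "Z = C1 powr k * CL * lam s * s powr (m / 4) * (\<phi> s powr (k + 1) * W s)"
        have Z: "0 \<le> Z" using CL lam0[of s] W0 by (simp add: Z_def)
        have "(\<integral>\<^sup>+r. H r s \<partial>lborel) \<le> (\<integral>\<^sup>+r. ennreal Z * (ennreal (r powr (m / 4 - 1)) * indicator {0<..<s} r) \<partial>lborel)"
        proof (rule nn_integral_mono)
          fix r
          have "C1 powr k * r powr (m / 2 - 1) * lam r * (\<phi> s powr (k + 1) * W s) \<le> Z * r powr (m / 4 - 1)"
            if r: "0 < r" "r < s"
          proof -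
            have "lam r \<le> CL * lam s * (s / r) powr (m / 4)" using slow[of r s] r True by auto
            also have "(s / r) powr (m / 4) = s powr (m / 4) * r powr (- (m / 4))"
              using r by (simp add: powr_divide powr_minus field_simps)
            finally have "C1 powr k * r powr (m / 2 - 1) * lam r * (\<phi> s powr (k + 1) * W s) \<le>
              C1 powr k * r powr (m / 2 - 1) * (CL * lam s * (s powr (m / 4) * r powr (- (m / 4)))) * (\<phi> s powr (k + 1) * W s)"
              using W0 by (intro mult_right_mono mult_left_mono) auto
            also have "\<dots> = Z * (r powr (m / 2 - 1) * r powr (- (m / 4)))"
              unfolding Z_def by (simp only: mult_ac)
            also have "r powr (m / 2 - 1) * r powr (- (m / 4)) = r powr (m / 4 - 1)"
              by (simp add: powr_add[symmetric])
            finally show ?thesis .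
          qed
          then show "H r s \<le> ennreal Z * (ennreal (r powr (m / 4 - 1)) * indicator {0<..<s} r)"
            using Z lam0[of r] W0[of s] by (auto simp: H_def ennreal_mult[symmetric] intro!: ennreal_leI)
        qed
        also have "\<dots> = ennreal Z * ennreal (s powr (m / 4) / (m / 4))"
          using nn_integral_powr_bounded_interval[of "m / 4 - 1" s] m True
          by (subst nn_integral_cmult) auto
        also have "\<dots> = ennreal (Z * (s powr (m / 4) / (m / 4)))"
          by (rule ennreal_mult[symmetric]) (use Z m in auto)
        also have "Z * (s powr (m / 4) / (m / 4)) = C * (s powr (n - k) * \<phi> s powr (k + 1) * w s)"
        proof -
          have "s powr (m / 4) * s powr (m / 4) * s powr (n - k - m / 2) = s powr (n - k)"
            by (simp add: powr_add[symmetric])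
          moreover have "Z * (s powr (m / 4) / (m / 4)) =
            C * ((s powr (m / 4) * s powr (m / 4) * s powr (n - k - m / 2)) * \<phi> s powr (k + 1) * w s)"
            unfolding Z_def C_def W_def using lam0[of s] m by (simp add: field_simps)
          ultimately show ?thesis by simp
        qed
        finally show ?thesis using True C w0[of s] by (simp add: ennreal_mult)
      next
        case False
        then have "H r s = 0" for r by (auto simp: H_def)
        then show ?thesis by simp
      qed
    qed
    also have "\<dots> \<le> ennreal C * ennreal A"
      using E by (subst nn_integral_cmult) (auto intro!: mult_left_mono)
    finally show ?thesis using C A by (simp add: ennreal_mult)
  qed
  then show ?thesis using C by blast
qed

section \<open>Logarithmic weights and the critical bound\<close>

lemma nn_integral_log_weight:
  fixes R \<sigma> :: real
  assumes R: "0 < R" and \<sigma>: "\<sigma> > 1"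
  shows "(\<integral>\<^sup>+r\<in>{0<..<R}. ennreal (r powr (- 1) * ln (exp 2 * R / r) powr (- \<sigma>)) \<partial>lborel) < \<infinity>"
proof -
  \<comment> \<open>An antiderivative of the integrand; for \<sigma> > 1 the value 0 at 0 is its
    continuous extension.\<close>
  define F where "F r = (if r \<le> 0 then 0 else ln (exp 2 * R / r) powr (1 - \<sigma>) / (\<sigma> - 1))" for r
  define f where "f r = r powr (- 1) * ln (exp 2 * R / r) powr (- \<sigma>)" for r
  have f0: "0 \<le> f r" for r by (simp add: f_def)
  have lnpos: "ln (exp 2 * R / r) > 0" if "0 < r" "r \<le> R" for r
  proof -
    have "exp 2 * R > 1 * r" using that R by (intro le_less_trans[of "1 * r" "1 * R"] mult_strict_right_mono) auto
    then show ?thesis using that by (intro ln_gt_zero) (simp add: less_divide_eq)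
  qed
  have der: "(F has_real_derivative f r) (at r)" if r: "0 < r" "r \<le> R" for r
  proof -
    have "((\<lambda>r. ln (exp 2 * R / r)) has_real_derivative - 1 / r) (at r)"
      using r R by (auto intro!: derivative_eq_intros simp: field_simps)
    from DERIV_chain2[OF has_real_derivative_powr[OF lnpos[OF r]] this]
    have "((\<lambda>r. ln (exp 2 * R / r) powr (1 - \<sigma>)) has_real_derivative
       (1 - \<sigma>) * ln (exp 2 * R / r) powr (1 - \<sigma> - 1) * (- 1 / r)) (at r)" .
    then have "((\<lambda>r. ln (exp 2 * R / r) powr (1 - \<sigma>) / (\<sigma> - 1)) has_real_derivative
       (1 - \<sigma>) * ln (exp 2 * R / r) powr (1 - \<sigma> - 1) * (- 1 / r) / (\<sigma> - 1)) (at r)"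
      by (rule DERIV_cdivide)
    moreover have "(1 - \<sigma>) * ln (exp 2 * R / r) powr (1 - \<sigma> - 1) * (- 1 / r) / (\<sigma> - 1) = f r"
      unfolding f_def using r \<sigma> by (simp add: powr_minus_divide divide_simps)
    ultimately have "((\<lambda>r. ln (exp 2 * R / r) powr (1 - \<sigma>) / (\<sigma> - 1)) has_real_derivative f r) (at r)"
      by simp
    moreover have "\<forall>\<^sub>F s in nhds r. F s = ln (exp 2 * R / s) powr (1 - \<sigma>) / (\<sigma> - 1)"
      using eventually_gt_at_top r order_tendstoD(1)[OF tendsto_ident_at[of r UNIV], of 0]
        eventually_nhds_in_open[of "{0<..}" r]
      by (auto elim!: eventually_mono simp: F_def)
    ultimately show ?thesis by (subst DERIV_cong_ev[OF refl _ refl]) auto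
  qed
  have "(f has_integral F R - F 0) {0..R}"
  proof (rule fundamental_theorem_of_calculus_interior)
    show "continuous_on {0..R} F"
    proof (rule continuous_on_IccI)
      have "((\<lambda>r. ln (exp 2 * R / r) powr (1 - \<sigma>) / (\<sigma> - 1)) \<longlongrightarrow> 0) (at_right 0)"
        using R \<sigma> by real_asymp
      moreover have "\<forall>\<^sub>F r in at_right 0. ln (exp 2 * R / r) powr (1 - \<sigma>) / (\<sigma> - 1) = F r"
        by (rule eventually_at_rightI[of 0 R]) (use R in \<open>auto simp: F_def\<close>)
      ultimately have "(F \<longlongrightarrow> 0) (at_right 0)" by (rule Lim_transform_eventually)
      then show "(F \<longlongrightarrow> F 0) (at_right 0)" by (simp add: F_def)
      have c: "isCont F r" if "0 < r" "r \<le> R" for r using der[OF that] by (rule DERIV_isCont)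
      show "(F \<longlongrightarrow> F R) (at_left R)" using c[of R] R by (simp add: isCont_def filterlim_at_split)
      show "F \<midarrow>x\<rightarrow> F x" if "0 < x" "x < R" for x using c[of x] that by (simp add: isCont_def)
    qed (use R in auto)
    show "(F has_vector_derivative f x) (at x)" if "x \<in> {0<..<R}" for x
      using der[of x] that by (simp add: has_real_derivative_iff_has_vector_derivative)
  qed (use R in auto)
  then have "(\<integral>\<^sup>+r. ennreal (indicator {0..R} r * f r) \<partial>lborel) = ennreal (F R - F 0)"
    by (intro nn_integral_has_integral_lebesgue) (rule f0)
  moreover have "(\<integral>\<^sup>+r\<in>{0<..<R}. ennreal (r powr (- 1) * ln (exp 2 * R / r) powr (- \<sigma>)) \<partial>lborel)
    \<le> (\<integral>\<^sup>+r. ennreal (indicator {0..R} r * f r) \<partial>lborel)"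
    by (rule nn_integral_mono) (auto simp: indicator_def f_def)
  ultimately show ?thesis by (simp add: le_less_trans)
qed

text \<open>The maximum with \<open>1\<close> matters only outside \<open>(0,R)\<close>; it keeps \<open>log_weight R s powr b\<close> at least \<open>1\<close> everywhere.\<close>

definition log_weight :: "real \<Rightarrow> real \<Rightarrow> real" where
  "log_weight R s = max 1 (ln (exp 2 * R / s))"

lemma log_weight_eq:
  assumes "0 < s" "s < R"
  shows "log_weight R s = ln (exp 2 * R / s)" and "log_weight R s = 2 + ln R - ln s"
proof -
  have "ln (exp 2 * R / s) = 2 + ln R - ln s" using assms by (simp add: ln_div ln_mult)
  moreover have "ln s < ln R" using assms by simp
  ultimately show "log_weight R s = ln (exp 2 * R / s)" "log_weight R s = 2 + ln R - ln s"
    by (auto simp: log_weight_def)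
qed

text \<open>With x = ln(s/r), L(r) = L(s) + x is at most L(s)(1 + x) since L(s) is at least 1. Then
  1 + x is bounded by (1 + b/\<delta>) exp(\<delta>x/b), whose b-th power is a constant times
  (s/r)^\<delta>.\<close>

lemma log_weight_slow:
  fixes R b \<delta> :: real
  assumes \<delta>: "\<delta> > 0" and b: "b \<ge> 0" and r: "0 < r" "r \<le> s" "s < R"
  shows "log_weight R r powr b \<le> (1 + b / \<delta>) powr b * log_weight R s powr b * (s / r) powr \<delta>"
proof (cases "b = 0")
  case True
  have "1 \<le> (s / r) powr \<delta>" using r \<delta> by (intro ge_one_powr_ge_zero) auto
  moreover have "log_weight R r \<noteq> 0" "log_weight R s \<noteq> 0" unfolding log_weight_def by linarith+
  ultimately show ?thesis using True by simp
next
  case False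
  then have b: "b > 0" using b by simp
  define x where "x = ln (s / r)"
  have x: "x \<ge> 0" using r by (simp add: x_def)
  have L1: "log_weight R s \<ge> 1" by (simp add: log_weight_def)
  have "log_weight R r = log_weight R s + x"
    using log_weight_eq(2)[of r R] log_weight_eq(2)[of s R] r by (simp add: x_def ln_div)
  also have "\<dots> \<le> log_weight R s + log_weight R s * x" using L1 x by (simp add: mult_le_cancel_right1)
  also have "\<dots> = log_weight R s * (1 + x)" by (simp add: algebra_simps)
  also have "\<dots> \<le> log_weight R s * ((1 + b / \<delta>) * exp (\<delta> * x / b))"
  proof (rule mult_left_mono)
    have "1 + x \<le> (1 + b / \<delta>) * (1 + \<delta> * x / b)"
      using b \<delta> x by (simp add: field_simps)
    also have "\<dots> \<le> (1 + b / \<delta>) * exp (\<delta> * x / b)"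
      using exp_ge_add_one_self[of "\<delta> * x / b"] b \<delta> by (intro mult_left_mono) auto
    finally show "1 + x \<le> (1 + b / \<delta>) * exp (\<delta> * x / b)" .
  qed (use L1 in auto)
  finally have "log_weight R r powr b \<le> (log_weight R s * ((1 + b / \<delta>) * exp (\<delta> * x / b))) powr b"
    using b by (intro powr_mono2) (auto simp: log_weight_def)
  also have "\<dots> = log_weight R s powr b * ((1 + b / \<delta>) powr b * exp (\<delta> * x / b) powr b)"
    using L1 b \<delta> by (simp add: powr_mult)
  also have "exp (\<delta> * x / b) powr b = (s / r) powr \<delta>"
    using b r by (simp add: powr_def x_def)
  finally show ?thesis by (simp only: mult_ac)
qed

lemma borel_measurable_log_weight [measurable]: "log_weight R \<in> borel_measurable borel"
  unfolding log_weight_def[abs_def] by measurable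

lemma tame_mono:
  assumes "tame R G" and "H \<in> borel_measurable borel" and "\<And>s. 0 \<le> H s" and "\<And>s. H s \<le> G s"
  shows "tame R H"
proof -
  obtain s0 M where s0: "0 < s0" "\<forall>s. 0 < s \<and> s < s0 \<longrightarrow> G s \<le> M"
    "(\<integral>\<^sup>+s\<in>{s0..<R}. ennreal (G s) \<partial>lborel) < \<infinity>" using assms(1) by (auto simp: tame_def)
  have "(\<integral>\<^sup>+s\<in>{s0..<R}. ennreal (H s) \<partial>lborel) \<le> (\<integral>\<^sup>+s\<in>{s0..<R}. ennreal (G s) \<partial>lborel)"
    by (rule nn_integral_mono) (use assms(4) in \<open>auto simp: indicator_def intro!: ennreal_leI\<close>)
  then have "(\<integral>\<^sup>+s\<in>{s0..<R}. ennreal (H s) \<partial>lborel) < \<infinity>" using s0(3) by (rule le_less_trans)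
  moreover have "\<forall>s. 0 < s \<and> s < s0 \<longrightarrow> H s \<le> M" using s0(2) assms(4) by (meson order_trans)
  ultimately show ?thesis unfolding tame_def using assms(2,3) s0(1) by blast
qed

text \<open>From p/(k+1) = (\<alpha>+1)/m it follows that p < k+1 means \<alpha>+1 < m, which is the
  range in which \<open>b'\<close> gives a lower bound on b. In both cases the exponent of A is the
  one dictated by homogeneity.\<close>

lemma critical_bound:
  fixes n k R \<alpha> b p :: real and w :: "real \<Rightarrow> real"
  defines "m \<equiv> n - 2 * k"
  assumes k: "k \<ge> 1" and R: "0 < R" and m: "m > 0" and \<alpha>: "\<alpha> > -1" and p1: "p \<ge> 1"
    and p: "p = (\<alpha> + 1) * (k + 1) / m"
    and b: "b \<ge> 0" and b': "\<alpha> + 1 < m \<Longrightarrow> b > m / (\<alpha> + 1) - 1"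
    and w[measurable]: "w \<in> borel_measurable borel" and w0: "\<And>s. 0 \<le> w s" and wp: "AE s in lborel. w s > 0"
    and tame: "tame R (\<lambda>s. (log_weight R s powr b / w s) powr (1 / k))"
  shows "\<exists>C\<ge>0. \<forall>v \<phi> A. upper_gradient R v \<phi> \<longrightarrow> 0 \<le> A \<longrightarrow>
     energy n k R w \<phi> \<le> ennreal A \<longrightarrow>
     Lp_integral p \<alpha> R v \<le> ennreal (C * A powr (p / (k + 1)))"
proof -
  define lam where "lam s = log_weight R s powr b" for s
  have lam1: "1 \<le> lam s" for s unfolding lam_def using b by (intro ge_one_powr_ge_zero) (auto simp: log_weight_def)
  have lam0: "0 < lam s" for s using lam1[of s] by linarith
  have [measurable]: "lam \<in> borel_measurable borel" unfolding lam_def by measurable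
  have "\<exists>C\<ge>0. \<forall>v \<phi> A. upper_gradient R v \<phi> \<longrightarrow> 0 \<le> A \<longrightarrow>
     energy n k R w \<phi> \<le> ennreal A \<longrightarrow>
     (\<integral>\<^sup>+r\<in>{0<..<R}. ennreal (r powr (m - 1) * lam r * \<bar>v r\<bar> powr (k + 1)) \<partial>lborel) \<le> ennreal (C * A)"
    unfolding m_def
  proof (rule Hardy_weighted[OF k R _ w w0 wp, where CL = "(1 + b / (m / 4)) powr b"])
    show "lam r \<le> (1 + b / (m / 4)) powr b * lam s * (s / r) powr ((n - 2 * k) / 4)"
      if "0 < r" "r \<le> s" "s < R" for r s
      unfolding lam_def using log_weight_slow[of "m / 4" b r s R] m b that by (simp add: m_def)
    show "tame R (\<lambda>s. (lam s / w s) powr (1 / k))" using tame by (simp add: lam_def)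
  qed (use m lam1 in \<open>auto simp: m_def\<close>)
  then obtain C where C: "C \<ge> 0" "\<And>v \<phi> A. upper_gradient R v \<phi> \<Longrightarrow> 0 \<le> A \<Longrightarrow>
     energy n k R w \<phi> \<le> ennreal A \<Longrightarrow>
     (\<integral>\<^sup>+r\<in>{0<..<R}. ennreal (r powr (m - 1) * lam r * \<bar>v r\<bar> powr (k + 1)) \<partial>lborel) \<le> ennreal (C * A)"
    by blast
  have pm: "m * (p / (k + 1)) = \<alpha> + 1" using p m k by simp
  show ?thesis
  proof (cases "p \<ge> k + 1")
    case True
    \<comment> \<open>Since \<open>lam\<close> is at least 1, the function w^(-1/k) is dominated by
      the given tame function. So the pointwise bound holds with \<epsilon> = 0, without the usual
      loss.\<close>
    have tame0: "tame R (\<lambda>s. s powr 0 * w s powr (- 1 / k))"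
    proof (rule tame_mono[OF tame])
      show "s powr 0 * w s powr (- 1 / k) \<le> (log_weight R s powr b / w s) powr (1 / k)" for s
      proof -
        have "w s powr (- 1 / k) = (1 / w s) powr (1 / k)"
          using w0[of s] by (simp add: powr_divide powr_minus_divide)
        also have "\<dots> \<le> (lam s / w s) powr (1 / k)"
          using w0[of s] lam1[of s] k by (intro powr_mono2 divide_right_mono) auto
        finally show ?thesis by (simp add: lam_def)
      qed
    qed auto
    have "n / k - 1 + 0 > 1" using m k by (simp add: m_def field_simps)
    from upper_gradient_pointwise[OF k R this w w0 wp tame0]
    obtain C2 where C2: "C2 \<ge> 0" "\<And>v \<phi> A r. upper_gradient R v \<phi> \<Longrightarrow> 0 \<le> A \<Longrightarrow>
     energy n k R w \<phi> \<le> ennreal A \<Longrightarrow>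
     0 < r \<Longrightarrow> r < R \<Longrightarrow> \<bar>v r\<bar> \<le> C2 * A powr (1 / (k + 1)) * r powr (- m / (k + 1))"
      by (auto simp: m_def)
    have "Lp_integral p \<alpha> R v \<le> ennreal (C2 powr (p - (k + 1)) * C * A powr (p / (k + 1)))"
      if ug: "upper_gradient R v \<phi>" and A: "0 \<le> A"
        and E: "energy n k R w \<phi> \<le> ennreal A" for v \<phi> A
    \<comment> \<open>Zero energy forces v = 0 on (0,R) by the pointwise bound; afterwards the
      powers of A have a positive base.\<close>
    proof (cases "A = 0")
      case A0: True
      have "Lp_integral p \<alpha> R v = (\<integral>\<^sup>+(r::real). 0 \<partial>lborel)"
      proof (rule nn_integral_cong)
        fix r
        show "ennreal (r powr \<alpha> * \<bar>v r\<bar> powr p) * indicator {0<..<R} r = 0"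
          using C2(2)[OF ug A E, of r] A0 by (cases "r \<in> {0<..<R}") auto
      qed
      then show ?thesis by simp
    next
      case False
      define d where "d = p - (k + 1)"
      define K where "K = C2 * A powr (1 / (k + 1))"
      have K: "0 \<le> K" using C2(1) by (simp add: K_def)
      have d: "d \<ge> 0" using True by (simp add: d_def)
      have "Lp_integral p \<alpha> R v
         \<le> (\<integral>\<^sup>+r. ennreal (K powr d) * (ennreal (r powr (m - 1) * lam r * \<bar>v r\<bar> powr (k + 1)) * indicator {0<..<R} r) \<partial>lborel)"
      proof (rule nn_integral_mono)
        fix r
        have "r powr \<alpha> * \<bar>v r\<bar> powr p \<le> K powr d * (r powr (m - 1) * lam r * \<bar>v r\<bar> powr (k + 1))" if r: "0 < r" "r < R"
        proof -
          have "\<bar>v r\<bar> powr p = \<bar>v r\<bar> powr d * \<bar>v r\<bar> powr (k + 1)" by (simp add: d_def powr_add[symmetric])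
          also have "\<bar>v r\<bar> powr d \<le> (K * r powr (- m / (k + 1))) powr d"
            unfolding K_def by (rule powr_mono2[OF d _ C2(2)[OF ug A E r]]) simp
          also have "(K * r powr (- m / (k + 1))) powr d = K powr d * r powr (- m / (k + 1) * d)"
            using K by (simp add: powr_mult powr_powr)
          finally have "r powr \<alpha> * \<bar>v r\<bar> powr p \<le> r powr \<alpha> * (K powr d * r powr (- m / (k + 1) * d) * \<bar>v r\<bar> powr (k + 1))"
            by (simp add: mult_left_mono mult_right_mono)
          also have "\<dots> = K powr d * ((r powr \<alpha> * r powr (- m / (k + 1) * d)) * \<bar>v r\<bar> powr (k + 1))"
            by (simp only: mult_ac)
          \<comment> \<open>At the critical exponent m d/(k+1) = \<alpha> + 1 - m, so exactly the
            weight of Hardy's inequality remains.\<close>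
          also have "r powr \<alpha> * r powr (- m / (k + 1) * d) = r powr (m - 1)"
          proof -
            have "\<alpha> + - m / (k + 1) * d = m - 1" using pm k by (simp add: d_def field_simps)
            then show ?thesis by (simp only: powr_add[symmetric])
          qed
          also have "K powr d * (r powr (m - 1) * \<bar>v r\<bar> powr (k + 1)) \<le> K powr d * (r powr (m - 1) * lam r * \<bar>v r\<bar> powr (k + 1))"
            using lam1[of r] by (intro mult_left_mono mult_right_mono) (auto simp: mult_le_cancel_left1)
          finally show ?thesis .
        qed
        then show "ennreal (r powr \<alpha> * \<bar>v r\<bar> powr p) * indicator {0<..<R} r \<le>
          ennreal (K powr d) * (ennreal (r powr (m - 1) * lam r * \<bar>v r\<bar> powr (k + 1)) * indicator {0<..<R} r)"
          using lam0[of r] by (auto simp: indicator_def ennreal_mult[symmetric] intro!: ennreal_leI)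
      qed
      also have "\<dots> \<le> ennreal (K powr d) * ennreal (C * A)"
      proof -
        have cont: "continuous_on {0<..<R} v" using ug by (simp add: upper_gradient_def)
        define h where "h r = indicat_real {0<..<R} r *\<^sub>R (r powr (m - 1) * \<bar>v r\<bar> powr (k + 1))" for r
        have [measurable]: "h \<in> borel_measurable borel"
          unfolding h_def by (rule borel_measurable_Lp_integrand[OF cont])
        have "(\<lambda>r. ennreal (r powr (m - 1) * lam r * \<bar>v r\<bar> powr (k + 1)) * indicator {0<..<R} r) =
          (\<lambda>r. ennreal (lam r * h r))"
          by (auto simp: indicator_def fun_eq_iff mult_ac h_def)
        then have "(\<lambda>r. ennreal (r powr (m - 1) * lam r * \<bar>v r\<bar> powr (k + 1)) * indicator {0<..<R} r) \<in> borel_measurable lborel"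
          by simp
        then show ?thesis using C(2)[OF ug A E] by (subst nn_integral_cmult) (auto intro!: mult_left_mono)
      qed
      also have "\<dots> = ennreal (K powr d * (C * A))" using C(1) A by (simp add: ennreal_mult)
      also have "K powr d * (C * A) = C2 powr d * C * A powr (p / (k + 1))"
      proof -
        have "A powr (d / (k + 1)) * A powr 1 = A powr (p / (k + 1))"
          unfolding powr_add[symmetric] using k by (simp add: d_def field_simps)
        then have "A powr (d / (k + 1)) * A = A powr (p / (k + 1))" using A False by simp
        moreover have "K powr d = C2 powr d * A powr (d / (k + 1))"
          using C2(1) by (simp add: K_def powr_mult powr_powr)
        ultimately show ?thesis by (simp add: mult_ac)
      qed
      finally show ?thesis by (simp add: d_def)
    qed
    then show ?thesis using C(1) by (intro exI[of _ "C2 powr (p - (k + 1)) * C"]) auto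
  next
    case False
    define \<theta> where "\<theta> = p / (k + 1)"
    have \<theta>: "0 < \<theta>" "\<theta> < 1" using False p1 k by (auto simp: \<theta>_def)
    have m\<theta>: "m * \<theta> = \<alpha> + 1" using pm by (simp add: \<theta>_def)
    \<comment> \<open>The power of the logarithm left in the second Hoelder factor. As 1/\<theta> =
      m/(\<alpha>+1), the condition \<sigma> > 1 reads b > m/(\<alpha>+1) - 1.\<close>
    define \<sigma> where "\<sigma> = b * \<theta> / (1 - \<theta>)"
    have \<sigma>: "\<sigma> > 1"
    proof -
      have "\<alpha> + 1 < m" using mult_strict_left_mono[OF \<theta>(2) m] m\<theta> by simp
      then have "b > m / (\<alpha> + 1) - 1" by (rule b')
      moreover have "m / (\<alpha> + 1) = 1 / \<theta>" unfolding m\<theta>[symmetric] using m \<theta> by simp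
      ultimately have "1 / \<theta> - 1 < b" by simp
      then have "(1 / \<theta> - 1) * \<theta> < b * \<theta>" using \<theta> by (intro mult_strict_right_mono) auto
      then have "1 - \<theta> < b * \<theta>" using \<theta> by (simp add: algebra_simps)
      then show ?thesis using \<theta> by (simp add: \<sigma>_def less_divide_eq)
    qed
    have "\<exists>B\<ge>0. (\<integral>\<^sup>+r\<in>{0<..<R}. ennreal (r powr (- 1) * ln (exp 2 * R / r) powr (- \<sigma>)) \<partial>lborel) = ennreal B"
      using nn_integral_log_weight[OF R \<sigma>] unfolding infinity_ennreal_def less_top_ennreal .
    then obtain B where B: "0 \<le> B"
      "(\<integral>\<^sup>+r\<in>{0<..<R}. ennreal (r powr (- 1) * ln (exp 2 * R / r) powr (- \<sigma>)) \<partial>lborel) = ennreal B"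
      by blast
    have "Lp_integral p \<alpha> R v \<le> ennreal (C powr \<theta> * B powr (1 - \<theta>) * A powr (p / (k + 1)))"
      if ug: "upper_gradient R v \<phi>" and A: "0 \<le> A"
        and E: "energy n k R w \<phi> \<le> ennreal A" for v \<phi> A
    proof -
      have cont: "continuous_on {0<..<R} v" using ug by (simp add: upper_gradient_def)
      define h where "h r = indicat_real {0<..<R} r *\<^sub>R (r powr (m - 1) * \<bar>v r\<bar> powr (k + 1))" for r
      \<comment> \<open>The integrand is split as the Hardy integrand to the power \<theta> times
        \<open>g\<close>; the exponents 1/\<theta> and 1/(1-\<theta>) then turn g into r^(-1)
        L^(-\<sigma>).\<close>
      define f where "f r = (lam r * h r) powr \<theta>" for r
      define g where "g r = indicat_real {0<..<R} r * (r powr (\<theta> - 1) * lam r powr (- \<theta>))" for r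
      have [measurable]: "h \<in> borel_measurable borel"
        unfolding h_def by (rule borel_measurable_Lp_integrand[OF cont])
      have [measurable]: "f \<in> borel_measurable lborel" "g \<in> borel_measurable lborel"
        unfolding f_def g_def by simp_all
      have "Lp_integral p \<alpha> R v = (\<integral>\<^sup>+r. ennreal (f r * g r) \<partial>lborel)"
      proof (rule nn_integral_cong)
        fix r
        show "ennreal (r powr \<alpha> * \<bar>v r\<bar> powr p) * indicator {0<..<R} r = ennreal (f r * g r)"
        proof (cases "r \<in> {0<..<R}")
          case True
          have "f r = lam r powr \<theta> * (r powr ((m - 1) * \<theta>) * \<bar>v r\<bar> powr p)"
            unfolding f_def h_def using True lam0[of r] k by (simp add: powr_mult powr_powr \<theta>_def)
          then have "f r * g r = (lam r powr \<theta> * lam r powr (- \<theta>)) * ((r powr ((m - 1) * \<theta>) * r powr (\<theta> - 1)) * \<bar>v r\<bar> powr p)"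
            using True by (simp add: g_def mult_ac)
          also have "lam r powr \<theta> * lam r powr (- \<theta>) = 1" using lam0[of r] by (simp add: powr_add[symmetric])
          also have "r powr ((m - 1) * \<theta>) * r powr (\<theta> - 1) = r powr \<alpha>"
          proof -
            have "(m - 1) * \<theta> + (\<theta> - 1) = \<alpha>" using m\<theta> by (simp add: algebra_simps)
            then show ?thesis by (simp only: powr_add[symmetric])
          qed
          finally show ?thesis using True by simp
        qed (simp add: f_def h_def)
      qed
      also have "\<dots> \<le> ennreal ((C * A) powr (1 / (1 / \<theta>)) * B powr (1 / (1 / (1 - \<theta>))))"
      proof (rule nn_integral_Hoelder)
        show "1 < 1 / \<theta>" "1 < 1 / (1 - \<theta>)" "1 / (1 / \<theta>) + 1 / (1 / (1 - \<theta>)) = 1" using \<theta> by auto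
        have "(\<integral>\<^sup>+r. ennreal (f r powr (1 / \<theta>)) \<partial>lborel) = (\<integral>\<^sup>+r\<in>{0<..<R}. ennreal (r powr (m - 1) * lam r * \<bar>v r\<bar> powr (k + 1)) \<partial>lborel)"
          by (rule nn_integral_cong)
            (use \<theta> lam0 in \<open>auto simp: f_def h_def indicator_def powr_powr mult_ac less_imp_le\<close>)
        then show "(\<integral>\<^sup>+r. ennreal (f r powr (1 / \<theta>)) \<partial>lborel) \<le> ennreal (C * A)"
          using C(2)[OF ug A E] by simp
        have "(\<integral>\<^sup>+r. ennreal (g r powr (1 / (1 - \<theta>))) \<partial>lborel) =
          (\<integral>\<^sup>+r\<in>{0<..<R}. ennreal (r powr (- 1) * ln (exp 2 * R / r) powr (- \<sigma>)) \<partial>lborel)"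
        proof (rule nn_integral_cong)
          fix r
          show "ennreal (g r powr (1 / (1 - \<theta>))) = ennreal (r powr (- 1) * ln (exp 2 * R / r) powr (- \<sigma>)) * indicator {0<..<R} r"
          proof (cases "r \<in> {0<..<R}")
            case True
            have "g r powr (1 / (1 - \<theta>)) = r powr ((\<theta> - 1) * (1 / (1 - \<theta>))) * log_weight R r powr (b * - \<theta> * (1 / (1 - \<theta>)))"
              using True by (simp add: g_def lam_def powr_mult powr_powr)
            also have "(\<theta> - 1) * (1 / (1 - \<theta>)) = - 1" using \<theta> by (simp add: field_simps)
            also have "b * - \<theta> * (1 / (1 - \<theta>)) = - \<sigma>" by (simp add: \<sigma>_def)
            finally show ?thesis using True log_weight_eq(1)[of r R] by simp
          qed (simp add: g_def)
        qed
        then show "(\<integral>\<^sup>+r. ennreal (g r powr (1 / (1 - \<theta>))) \<partial>lborel) \<le> ennreal B" using B(2) by simp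
        show "0 \<le> f r" "0 \<le> g r" for r by (auto simp: f_def g_def)
      qed (use C(1) A B(1) in auto)
      also have "(C * A) powr (1 / (1 / \<theta>)) * B powr (1 / (1 / (1 - \<theta>))) = C powr \<theta> * B powr (1 - \<theta>) * A powr (p / (k + 1))"
        using C(1) A by (simp add: powr_mult \<theta>_def)
      finally show ?thesis .
    qed
    then show ?thesis by (intro exI[of _ "C powr \<theta> * B powr (1 - \<theta>)"]) auto
  qed
qed

section \<open>The logarithmic weights\<close>

lemma nn_integral_abs_powr_finite:
  fixes a \<tau> D :: real
  assumes \<tau>: "\<tau> > -1" and D: "D > 0"
  shows "(\<integral>\<^sup>+s\<in>{a - D<..<a + D}. ennreal (\<bar>s - a\<bar> powr \<tau>) \<partial>lborel) < \<infinity>"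
proof -
  define I where "I = (\<integral>\<^sup>+t\<in>{0<..<D}. ennreal (t powr \<tau>) \<partial>lborel)"
  have I: "I < \<infinity>" using nn_integral_powr_bounded_interval[OF \<tau> D] by (simp add: I_def)
  have shift: "(\<integral>\<^sup>+s. f s \<partial>lborel) = (\<integral>\<^sup>+t. f (a + c * t) \<partial>lborel)"
    if "f \<in> borel_measurable borel" "c = 1 \<or> c = -1" for f c
    using nn_integral_real_affine[OF that(1), of c a] that(2) by auto
  have "(\<integral>\<^sup>+s\<in>{a - D<..<a + D}. ennreal (\<bar>s - a\<bar> powr \<tau>) \<partial>lborel) \<le>
     (\<integral>\<^sup>+s. ennreal (\<bar>s - a\<bar> powr \<tau>) * indicator {a<..<a + D} s + ennreal (\<bar>s - a\<bar> powr \<tau>) * indicator {a - D<..<a} s \<partial>lborel)"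
    by (rule nn_integral_mono) (auto simp: indicator_def)
  also have "\<dots> = (\<integral>\<^sup>+s. ennreal (\<bar>s - a\<bar> powr \<tau>) * indicator {a<..<a + D} s \<partial>lborel) +
     (\<integral>\<^sup>+s. ennreal (\<bar>s - a\<bar> powr \<tau>) * indicator {a - D<..<a} s \<partial>lborel)"
    by (rule nn_integral_add) auto
  also have "(\<integral>\<^sup>+s. ennreal (\<bar>s - a\<bar> powr \<tau>) * indicator {a<..<a + D} s \<partial>lborel) = I"
    unfolding I_def by (subst shift[of _ 1]) (auto simp: indicator_def intro!: nn_integral_cong)
  also have "(\<integral>\<^sup>+s. ennreal (\<bar>s - a\<bar> powr \<tau>) * indicator {a - D<..<a} s \<partial>lborel) = I"
    unfolding I_def by (subst shift[of _ "-1"]) (auto simp: indicator_def intro!: nn_integral_cong)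
  finally have "(\<integral>\<^sup>+s\<in>{a - D<..<a + D}. ennreal (\<bar>s - a\<bar> powr \<tau>) \<partial>lborel) \<le> I + I" .
  also have "I + I < \<infinity>" using I by (simp add: less_top[symmetric])
  finally show ?thesis .
qed

text \<open>\<open>ln t \<le> t - 1\<close>, applied to s/A or to A/s, shows that the zero of the
  logarithm at A is of first order. Negative powers of the logarithm are thereby dominated by powers
  of the distance to A.\<close>

lemma abs_ln_ratio_ge:
  fixes A R s :: real
  assumes "0 < A" "0 < s" "s \<le> R"
  shows "\<bar>s - A\<bar> / max A R \<le> \<bar>ln (A / s)\<bar>"
proof (cases "s \<le> A")
  case True
  have "1 - s / A \<le> ln (A / s)" using ln_le_minus_one[of "s / A"] assms by (simp add: ln_div)
  moreover have "1 - s / A = (A - s) / A" using assms by (simp add: field_simps)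
  moreover have "(A - s) / max A R \<le> (A - s) / A" using True assms by (intro divide_left_mono) auto
  ultimately show ?thesis using True by (auto simp: abs_if split: if_splits)
next
  case False
  have "1 - A / s \<le> ln (s / A)" using ln_le_minus_one[of "A / s"] assms by (simp add: ln_div)
  moreover have "1 - A / s = (s - A) / s" using assms by (simp add: field_simps)
  moreover have "(s - A) / max A R \<le> (s - A) / s" using False assms by (intro divide_left_mono) auto
  moreover have "ln (A / s) = - ln (s / A)" using assms by (simp add: ln_div)
  ultimately show ?thesis using False by (auto simp: abs_if split: if_splits)
qed

text \<open>Away from 0 the only possible singularity is at s = A and occurs for negative \<tau>. It
  is integrable if \<tau> > -1, and it lies outside the interval if R < A. With \<tau> = -b/k this
  is where the assumption on the size of \<beta>n enters.\<close>

lemma nn_integral_abs_ln_powr_finite: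
  fixes A R s0 \<tau> :: real
  assumes A: "0 < A" and s0: "0 < s0" and \<tau>: "\<tau> > -1 \<or> R < A"
  shows "(\<integral>\<^sup>+s\<in>{s0..<R}. ennreal (\<bar>ln (A / s)\<bar> powr \<tau>) \<partial>lborel) < \<infinity>"
proof -
  have bounded: ?thesis if K: "\<And>s. s0 \<le> s \<Longrightarrow> s < R \<Longrightarrow> \<bar>ln (A / s)\<bar> powr \<tau> \<le> K" for K
  proof -
    have "(\<integral>\<^sup>+s\<in>{s0..<R}. ennreal (\<bar>ln (A / s)\<bar> powr \<tau>) \<partial>lborel) \<le> (\<integral>\<^sup>+s. ennreal K * indicator {s0..<R} s \<partial>lborel)"
      by (rule nn_integral_mono) (use K in \<open>auto simp: indicator_def intro!: ennreal_leI\<close>)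
    also have "\<dots> = ennreal K * emeasure lborel {s0..<R}" by (rule nn_integral_cmult_indicator) simp
    also have "\<dots> < \<infinity>" by (cases "s0 \<le> R") (auto simp: ennreal_mult_less_top)
    finally show ?thesis .
  qed
  consider "R \<le> s0" | "s0 < R" "\<tau> \<ge> 0" | "s0 < R" "\<tau> < 0" "R < A" | "s0 < R" "-1 < \<tau>" "\<tau> < 0" using \<tau> by linarith
  then show ?thesis
  proof cases
    case 1 then show ?thesis by simp
  next
    case 2
    show ?thesis
    proof (rule bounded)
      fix s assume s: "s0 \<le> s" "s < R"
      have "ln s0 \<le> ln s" "ln s \<le> ln R" using s s0 by auto
      then have "\<bar>ln (A / s)\<bar> \<le> \<bar>ln A\<bar> + \<bar>ln s0\<bar> + \<bar>ln R\<bar>"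
      proof -
        have "ln (A / s) = ln A - ln s" using A s s0 by (simp add: ln_div)
        then show ?thesis using \<open>ln s0 \<le> ln s\<close> \<open>ln s \<le> ln R\<close> by linarith
      qed
      then show "\<bar>ln (A / s)\<bar> powr \<tau> \<le> (\<bar>ln A\<bar> + \<bar>ln s0\<bar> + \<bar>ln R\<bar>) powr \<tau>" using 2 by (intro powr_mono2) auto
    qed
  next
    case 3
    show ?thesis
    proof (rule bounded)
      fix s assume s: "s0 \<le> s" "s < R"
      have "0 < ln (A / R)" using 3 s0 by (intro ln_gt_zero) (simp add: less_divide_eq)
      moreover have "ln (A / R) \<le> ln (A / s)" using s s0 A by (simp add: ln_div)
      ultimately show "\<bar>ln (A / s)\<bar> powr \<tau> \<le> ln (A / R) powr \<tau>" using 3 by (intro powr_mono2') auto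
    qed
  next
    case 4
    define M where "M = max A R"
    have M: "M > 0" using A by (simp add: M_def)
    have "(\<integral>\<^sup>+s\<in>{s0..<R}. ennreal (\<bar>ln (A / s)\<bar> powr \<tau>) \<partial>lborel) \<le>
       (\<integral>\<^sup>+s. ennreal (M powr (- \<tau>)) * (ennreal (\<bar>s - A\<bar> powr \<tau>) * indicator {A - M<..<A + M} s) \<partial>lborel)"
    proof (rule nn_integral_mono_AE)
      have "AE s in lborel. s \<noteq> A" by (rule AE_lborel_singleton)
      then show "AE s in lborel. ennreal (\<bar>ln (A / s)\<bar> powr \<tau>) * indicator {s0..<R} s \<le>
         ennreal (M powr (- \<tau>)) * (ennreal (\<bar>s - A\<bar> powr \<tau>) * indicator {A - M<..<A + M} s)"
      proof eventually_elim
        case (elim s)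
        show ?case
        proof (cases "s \<in> {s0..<R}")
          case True
          have "\<bar>s - A\<bar> / M \<le> \<bar>ln (A / s)\<bar>" unfolding M_def using abs_ln_ratio_ge[of A s R] True A s0 by auto
          then have "\<bar>ln (A / s)\<bar> powr \<tau> \<le> (\<bar>s - A\<bar> / M) powr \<tau>" using 4 elim M by (intro powr_mono2') auto
          also have "\<dots> = M powr (- \<tau>) * \<bar>s - A\<bar> powr \<tau>" using M by (simp add: powr_divide powr_minus_divide)
          finally have "\<bar>ln (A / s)\<bar> powr \<tau> \<le> M powr (- \<tau>) * \<bar>s - A\<bar> powr \<tau>" .
          moreover have "s \<in> {A - M<..<A + M}" using True A s0 by (auto simp: M_def)
          ultimately show ?thesis using True by (simp add: ennreal_mult[symmetric] ennreal_leI)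
        qed simp
      qed
    qed
    also have "\<dots> = ennreal (M powr (- \<tau>)) * (\<integral>\<^sup>+s\<in>{A - M<..<A + M}. ennreal (\<bar>s - A\<bar> powr \<tau>) \<partial>lborel)"
      by (rule nn_integral_cmult) measurable
    also have "\<dots> < \<infinity>" using nn_integral_abs_powr_finite[OF 4(2) M, of A] by (simp add: ennreal_mult_less_top)
    finally show ?thesis .
  qed
qed

lemma tame_log:
  fixes A R \<tau> M :: real
  assumes A: "0 < A" and \<tau>: "\<tau> > -1 \<or> R < A"
    and [measurable]: "G \<in> borel_measurable borel" and G0: "\<And>s. 0 \<le> G s"
    and near: "\<forall>\<^sub>F s in at_right 0. G s \<le> M"
    and far: "\<And>s0. 0 < s0 \<Longrightarrow> \<exists>K\<ge>0. \<forall>s. s0 \<le> s \<longrightarrow> s < R \<longrightarrow> G s \<le> K * \<bar>ln (A / s)\<bar> powr \<tau>"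
  shows "tame R G"
proof -
  obtain s0 where s0: "s0 > 0" "\<And>s. 0 < s \<Longrightarrow> s < s0 \<Longrightarrow> G s \<le> M"
    using near unfolding eventually_at_right_field by auto
  obtain K where K: "K \<ge> 0" "\<forall>s. s0 \<le> s \<longrightarrow> s < R \<longrightarrow> G s \<le> K * \<bar>ln (A / s)\<bar> powr \<tau>" using far[OF s0(1)] by blast
  have "(\<integral>\<^sup>+s\<in>{s0..<R}. ennreal (G s) \<partial>lborel) \<le>
     (\<integral>\<^sup>+s. ennreal K * (ennreal (\<bar>ln (A / s)\<bar> powr \<tau>) * indicator {s0..<R} s) \<partial>lborel)"
    by (rule nn_integral_mono) (use K in \<open>auto simp: indicator_def ennreal_mult[symmetric] intro!: ennreal_leI\<close>)
  also have "\<dots> = ennreal K * (\<integral>\<^sup>+s\<in>{s0..<R}. ennreal (\<bar>ln (A / s)\<bar> powr \<tau>) \<partial>lborel)"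
    by (rule nn_integral_cmult) measurable
  also have "\<dots> < \<infinity>" using nn_integral_abs_ln_powr_finite[OF A s0(1) \<tau>] by (simp add: ennreal_mult_less_top)
  finally show ?thesis unfolding tame_def using G0 s0 by auto
qed

text \<open>The weight contributes \<open>\<bar>ln (A / s)\<bar> powr (- b / k)\<close>. For
  negative b this grows at 0, but slower than any negative power, so the factor
  \<open>s powr \<epsilon>\<close> tames it; away from 0 the condition b < k means -b/k >
  -1.\<close>

lemma tame_powr_ln:
  fixes A R \<epsilon> b k :: real
  assumes A: "0 < A" and \<epsilon>: "0 < \<epsilon>" and k: "0 < k" and b: "b < k \<or> R < A"
  shows "tame R (\<lambda>s. s powr \<epsilon> * (\<bar>ln (A / s)\<bar> powr b) powr (- 1 / k))"
proof (rule tame_log[OF A, where \<tau> = "- b / k" and M = 1])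
  show "- 1 < - b / k \<or> R < A" using b k by auto
  have eq: "(\<bar>ln (A / s)\<bar> powr b) powr (- 1 / k) = \<bar>ln (A / s)\<bar> powr (- b / k)" for s
    by (simp add: powr_powr)
  have "((\<lambda>s. s powr \<epsilon> * \<bar>ln (A / s)\<bar> powr (- b / k)) \<longlongrightarrow> 0) (at_right 0)"
    using A \<epsilon> by real_asymp
  then have "\<forall>\<^sub>F s in at_right 0. s powr \<epsilon> * \<bar>ln (A / s)\<bar> powr (- b / k) < 1"
    by (rule order_tendstoD) simp
  then show "\<forall>\<^sub>F s in at_right 0. s powr \<epsilon> * (\<bar>ln (A / s)\<bar> powr b) powr (- 1 / k) \<le> 1"
    unfolding eq by eventually_elim simp
  show "\<exists>K\<ge>0. \<forall>s. s0 \<le> s \<longrightarrow> s < R \<longrightarrow> s powr \<epsilon> * (\<bar>ln (A / s)\<bar> powr b) powr (- 1 / k) \<le> K * \<bar>ln (A / s)\<bar> powr (- b / k)"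
    if "0 < s0" for s0
    unfolding eq using that \<epsilon> by (intro exI[of _ "R powr \<epsilon>"]) (auto intro!: mult_right_mono powr_mono2)
qed auto

text \<open>No power of s is available here. The quotient of the two logarithms tends to 1 at 0,
  hence is at most 2 there, which gives the bound \<open>2 powr (b / k)\<close>; away from 0
  \<open>log_weight\<close> is bounded and only the zero of the weight at A matters.\<close>

lemma tame_log_ratio:
  fixes A R b k :: real
  assumes A: "0 < A" and R: "0 < R" and k: "0 < k" and b: "0 \<le> b" "b < k \<or> R < A"
  shows "tame R (\<lambda>s. (log_weight R s powr b / \<bar>ln (A / s)\<bar> powr b) powr (1 / k))"
proof (rule tame_log[OF A, where \<tau> = "- b / k" and M = "2 powr (b / k)"])
  show "- 1 < - b / k \<or> R < A" using b(2) k by auto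
  have L: "0 \<le> log_weight R s" for s by (simp add: log_weight_def)
  have eq: "(log_weight R s powr b / \<bar>ln (A / s)\<bar> powr b) powr (1 / k) = (log_weight R s / \<bar>ln (A / s)\<bar>) powr (b / k)" for s
    using L[of s] by (simp add: powr_divide[symmetric] powr_powr)
  have "((\<lambda>s. ln (exp 2 * R / s) / \<bar>ln (A / s)\<bar>) \<longlongrightarrow> 1) (at_right 0)"
    using A R by real_asymp
  then have "\<forall>\<^sub>F s in at_right 0. ln (exp 2 * R / s) / \<bar>ln (A / s)\<bar> < 2"
    by (rule order_tendstoD) simp
  moreover have "\<forall>\<^sub>F s in at_right 0. s \<in> {0<..<R}" by (rule eventually_at_right_real[OF R])
  ultimately show "\<forall>\<^sub>F s in at_right 0. (log_weight R s powr b / \<bar>ln (A / s)\<bar> powr b) powr (1 / k) \<le> 2 powr (b / k)"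
    unfolding eq
  proof eventually_elim
    case (elim s)
    then have "log_weight R s / \<bar>ln (A / s)\<bar> \<le> 2" using log_weight_eq(1)[of s R] by simp
    then show ?case using b k L[of s] by (intro powr_mono2) auto
  qed
  show "\<exists>K\<ge>0. \<forall>s. s0 \<le> s \<longrightarrow> s < R \<longrightarrow>
      (log_weight R s powr b / \<bar>ln (A / s)\<bar> powr b) powr (1 / k) \<le> K * \<bar>ln (A / s)\<bar> powr (- b / k)"
    if s0: "0 < s0" for s0
  proof (intro exI[of _ "(2 + ln R - ln s0) powr (b / k)"] conjI allI impI)
    fix s assume s: "s0 \<le> s" "s < R"
    have "log_weight R s \<le> 2 + ln R - ln s0" using log_weight_eq(2)[of s R] s s0 by simp
    then have "log_weight R s powr (b / k) \<le> (2 + ln R - ln s0) powr (b / k)"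
      using b k L[of s] by (intro powr_mono2) auto
    moreover have "(log_weight R s / \<bar>ln (A / s)\<bar>) powr (b / k) = log_weight R s powr (b / k) * \<bar>ln (A / s)\<bar> powr (- b / k)"
      using L[of s] by (simp add: powr_divide powr_minus_divide)
    ultimately show "(log_weight R s powr b / \<bar>ln (A / s)\<bar> powr b) powr (1 / k) \<le> (2 + ln R - ln s0) powr (b / k) * \<bar>ln (A / s)\<bar> powr (- b / k)"
      unfolding eq by (simp add: mult_right_mono)
  qed simp
qed auto

lemma AE_abs_ln_powr_pos:
  fixes A b :: real
  assumes "0 < A"
  shows "AE s in lborel. 0 < \<bar>ln (A / s)\<bar> powr b"
proof -
  \<comment> \<open>For negative arguments \<open>ln\<close> is the logarithm of the absolute value,
    so the weight also vanishes at -A; at 0 it vanishes because \<open>A / 0\<close> and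
    \<open>ln 0\<close> are 0.\<close>
  have "AE s in lborel. s \<noteq> 0" "AE s in lborel. s \<noteq> A" "AE s in lborel. s \<noteq> - A"
    by (rule AE_lborel_singleton)+
  then show ?thesis
  proof eventually_elim
    case (elim s)
    have "exp (ln (A / s)) = \<bar>A / s\<bar>" using elim assms by (intro exp_ln_abs) simp
    moreover have "\<bar>A / s\<bar> \<noteq> 1" using elim assms by (auto simp: abs_if field_simps split: if_splits)
    ultimately have "ln (A / s) \<noteq> 0" by auto
    then show ?case by simp
  qed
qed

section \<open>The embeddings for the two weights\<close>

lemma subcritical_compact_embedding:
  fixes c n k R p \<alpha> A b :: real
  assumes R: "0 < R" and k: "1 \<le> k" and c: "0 < c" and p: "1 \<le> p" and nk: "2 * k \<le> n"
    and A: "0 < A" and b: "b < k \<or> R < A" and sub: "p * (n - 2 * k) < (\<alpha> + 1) * (k + 1)"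
  shows "compact_embedding (X_space c n k R (\<lambda>r. \<bar>ln (A / r)\<bar> powr b)) (norm_w c n k R (\<lambda>r. \<bar>ln (A / r)\<bar> powr b))
    (L_space p \<alpha> R) (norm_L p \<alpha> R)"
proof -
  \<comment> \<open>This loss consumes half of the gap in \<open>sub\<close>: \<epsilon>kp equals
    half the difference of its two sides. Being positive, it also makes
    \<open>n / k - 1 + \<epsilon>\<close> exceed 1 in the borderline case n = 2k.\<close>
  define \<epsilon> where "\<epsilon> = ((\<alpha> + 1) * (k + 1) - p * (n - 2 * k)) / (2 * p * k)"
  have \<epsilon>: "\<epsilon> > 0" using sub p k by (simp add: \<epsilon>_def)
  show ?thesis
  proof (rule compact_embedding_X_L[OF R k c p, where \<epsilon> = \<epsilon>])
    have "2 \<le> n / k" using nk k by (simp add: le_divide_eq)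
    then show "1 < n / k - 1 + \<epsilon>" using \<epsilon> by simp
    show "tame R (\<lambda>s. s powr \<epsilon> * (\<bar>ln (A / s)\<bar> powr b) powr (- 1 / k))"
      using tame_powr_ln[OF A \<epsilon> _ b] k by simp
    have "\<epsilon> * k * p = ((\<alpha> + 1) * (k + 1) - p * (n - 2 * k)) / 2" using p k by (simp add: \<epsilon>_def)
    then have "(n - 2 * k + \<epsilon> * k) * p < (\<alpha> + 1) * (k + 1)" using sub by (simp add: algebra_simps)
    then have "(n - 2 * k + \<epsilon> * k) / (k + 1) * p < \<alpha> + 1" using k by (simp add: divide_less_eq)
    then show "- 1 < \<alpha> - (n - 2 * k + \<epsilon> * k) / (k + 1) * p" by simp
  qed (use AE_abs_ln_powr_pos[OF A] in auto)
qed

lemma critical_continuous_embedding: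
  fixes c n k R p \<alpha> A b :: real
  assumes R: "0 < R" and k: "1 \<le> k" and c: "0 < c" and p: "1 \<le> p" and nk: "2 * k < n" and \<alpha>: "\<alpha> > -1"
    and A: "0 < A" and b: "0 \<le> b" "b < k \<or> R < A" and b': "\<alpha> + 1 < n - 2 * k \<Longrightarrow> (n - 2 * k) / (\<alpha> + 1) - 1 < b"
    and crit: "p = (\<alpha> + 1) * (k + 1) / (n - 2 * k)"
  shows "continuous_embedding (X_space c n k R (\<lambda>r. \<bar>ln (A / r)\<bar> powr b)) (norm_w c n k R (\<lambda>r. \<bar>ln (A / r)\<bar> powr b))
    (L_space p \<alpha> R) (norm_L p \<alpha> R)"
proof -
  let ?w = "\<lambda>r. \<bar>ln (A / r)\<bar> powr b"
  have w: "?w \<in> borel_measurable borel" by measurable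
  have "tame R (\<lambda>s. (log_weight R s powr b / ?w s) powr (1 / k))"
    by (rule tame_log_ratio[OF A R _ b]) (use k in simp)
  then obtain C where C: "0 \<le> C" "\<And>v \<phi> D. upper_gradient R v \<phi> \<Longrightarrow> 0 \<le> D \<Longrightarrow>
     energy n k R ?w \<phi> \<le> ennreal D \<Longrightarrow>
     Lp_integral p \<alpha> R v \<le> ennreal (C * D powr (p / (k + 1)))"
    using critical_bound[OF k R _ \<alpha> p crit b(1) b' w _ AE_abs_ln_powr_pos[OF A]] nk by auto
  show ?thesis
    by (rule continuous_embedding_X_L[OF R k c p C(1) w]) (use C(2) in auto)
qed

theorem corollary1p1:
  fixes \<alpha> \<beta> n k R c :: real and w :: "real \<Rightarrow> real"
  assumes "0 < R" and "\<alpha> > -1" and "n \<ge> 1" and "k \<ge> 1" and "c > 0"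
    and weight: "w = w0 \<beta> n \<or> w = w1 \<beta> n"
    and "w = w0 \<beta> n \<Longrightarrow> \<beta> * n < 2 * k"
    and "w = w1 \<beta> n \<Longrightarrow> R < exp 1 \<or> \<beta> * n < 2 * k"
  shows
    "(k < n / 2 \<longrightarrow>
       (\<forall>p. 1 \<le> p \<and> p \<le> k_star \<alpha> n k \<and>
            (p = k_star \<alpha> n k \<longrightarrow>
               (w = w0 \<beta> n \<longrightarrow> endpoint_w0 \<alpha> \<beta> n k) \<and> (w = w1 \<beta> n \<longrightarrow> endpoint_w1 \<alpha> \<beta> n k)) \<longrightarrow>
          continuous_embedding (X_space c n k R w) (norm_w c n k R w)
            (L_space p \<alpha> R) (norm_L p \<alpha> R)) \<and>
       (\<alpha> \<ge> 0 \<longrightarrow> (\<forall>p. 1 \<le> p \<and> p < k_star \<alpha> n k \<longrightarrow>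
          compact_embedding (X_space c n k R w) (norm_w c n k R w)
            (L_space p \<alpha> R) (norm_L p \<alpha> R)))) \<and>
     (k = n / 2 \<longrightarrow>
       (\<forall>p\<ge>1. continuous_embedding (X_space c n k R w) (norm_w c n k R w)
            (L_space p \<alpha> R) (norm_L p \<alpha> R)) \<and>
       (\<alpha> \<ge> 0 \<longrightarrow> (\<forall>p\<ge>1. compact_embedding (X_space c n k R w) (norm_w c n k R w)
            (L_space p \<alpha> R) (norm_L p \<alpha> R))))"
proof -
  define b where "b = \<beta> * n / 2"
  \<comment> \<open>Both weights are treated at once, with A = 1 for \<open>w0\<close> and A = e for
    \<open>w1\<close>; the assumptions on \<beta>n and R become the alternative b < k or R <
    A.\<close>
  have wA: "\<exists>A>0. w = (\<lambda>r. \<bar>ln (A / r)\<bar> powr b) \<and> (b < k \<or> R < A)"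
    using weight
  proof
    assume w: "w = w0 \<beta> n"
    then have "w = (\<lambda>r. \<bar>ln (1 / r)\<bar> powr b)" by (simp add: w0_def fun_eq_iff b_def)
    moreover have "b < k" using assms(7)[OF w] by (simp add: b_def)
    ultimately show ?thesis by (intro exI[of _ 1]) simp
  next
    assume w: "w = w1 \<beta> n"
    then have "w = (\<lambda>r. \<bar>ln (exp 1 / r)\<bar> powr b)" by (simp add: w1_def fun_eq_iff b_def)
    moreover have "b < k \<or> R < exp 1" using assms(8)[OF w] by (auto simp: b_def)
    ultimately show ?thesis by (intro exI[of _ "exp 1"]) simp
  qed
  then obtain A where A: "0 < A" "w = (\<lambda>r. \<bar>ln (A / r)\<bar> powr b)" "b < k \<or> R < A" by blast
  \<comment> \<open>Compactness includes continuity by definition, so this also serves the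
    continuous embeddings strictly below the critical exponent and those for k = n/2.\<close>
  have sub: "compact_embedding (X_space c n k R w) (norm_w c n k R w) (L_space p \<alpha> R) (norm_L p \<alpha> R)"
    if "1 \<le> p" "2 * k \<le> n" "p * (n - 2 * k) < (\<alpha> + 1) * (k + 1)" for p
    unfolding A(2) using subcritical_compact_embedding[OF \<open>0 < R\<close> \<open>k \<ge> 1\<close> \<open>c > 0\<close> that(1,2) A(1,3) that(3)] .
  have crit: "continuous_embedding (X_space c n k R w) (norm_w c n k R w) (L_space p \<alpha> R) (norm_L p \<alpha> R)"
    if nk: "2 * k < n" and p: "1 \<le> p" "p = k_star \<alpha> n k"
      and e0: "w = w0 \<beta> n \<longrightarrow> endpoint_w0 \<alpha> \<beta> n k" and e1: "w = w1 \<beta> n \<longrightarrow> endpoint_w1 \<alpha> \<beta> n k" for p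
  proof -
    have b': "(n - 2 * k) / (\<alpha> + 1) - 1 < b" if "\<alpha> + 1 < n - 2 * k"
      using weight e0 e1 that by (auto simp: endpoint_w0_def endpoint_w1_def b_def)
    \<comment> \<open>For \<open>w0\<close> with \<alpha> + 1 < n - 2k the sign of \<beta> is not
      assumed; it follows from the lower bound on b, because (n - 2k)/(\<alpha> + 1) is at least
      1.\<close>
    have "0 \<le> b"
    proof (cases "\<alpha> + 1 < n - 2 * k")
      case True
      then have "1 \<le> (n - 2 * k) / (\<alpha> + 1)" using \<open>\<alpha> > -1\<close> by (simp add: le_divide_eq)
      then show ?thesis using b'[OF True] by linarith
    next
      case False
      then have "\<beta> \<ge> 0" using weight e0 e1 by (auto simp: endpoint_w0_def endpoint_w1_def)
      then show ?thesis using \<open>n \<ge> 1\<close> by (simp add: b_def)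
    qed
    then show ?thesis
      unfolding A(2)
      using critical_continuous_embedding[OF \<open>0 < R\<close> \<open>k \<ge> 1\<close> \<open>c > 0\<close> p(1) nk \<open>\<alpha> > -1\<close> A(1) _ A(3) b']
        p(2) by (simp add: k_star_def)
  qed
  have below: "p * (n - 2 * k) < (\<alpha> + 1) * (k + 1)" if "2 * k < n" "p < k_star \<alpha> n k" for p
    using that by (simp add: k_star_def less_divide_eq)
  have pos: "0 < (\<alpha> + 1) * (k + 1)" using \<open>\<alpha> > -1\<close> \<open>k \<ge> 1\<close> by simp
  show ?thesis
  proof (intro conjI impI allI)
    fix p
    assume "k < n / 2" and p: "1 \<le> p \<and> p \<le> k_star \<alpha> n k \<and> (p = k_star \<alpha> n k \<longrightarrow>
      (w = w0 \<beta> n \<longrightarrow> endpoint_w0 \<alpha> \<beta> n k) \<and> (w = w1 \<beta> n \<longrightarrow> endpoint_w1 \<alpha> \<beta> n k))"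
    then have nk: "2 * k < n" by simp
    show "continuous_embedding (X_space c n k R w) (norm_w c n k R w) (L_space p \<alpha> R) (norm_L p \<alpha> R)"
    proof (cases "p = k_star \<alpha> n k")
      case True
      then show ?thesis using crit[OF nk, of p] p by blast
    next
      case False
      then have "p < k_star \<alpha> n k" using p by simp
      then show ?thesis using sub[of p] below[OF nk] p nk by (simp add: compact_embedding_def)
    qed
  next
    fix p
    assume "k < n / 2" "1 \<le> p \<and> p < k_star \<alpha> n k"
    then show "compact_embedding (X_space c n k R w) (norm_w c n k R w) (L_space p \<alpha> R) (norm_L p \<alpha> R)"
      using sub[of p] below[of p] by simp
  next
    fix p :: real
    assume "k = n / 2" and p: "1 \<le> p"
    then have nk: "2 * k \<le> n" "p * (n - 2 * k) < (\<alpha> + 1) * (k + 1)" using pos by auto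
    show "continuous_embedding (X_space c n k R w) (norm_w c n k R w) (L_space p \<alpha> R) (norm_L p \<alpha> R)"
      using sub[OF p nk] by (simp add: compact_embedding_def)
  next
    fix p :: real
    assume "k = n / 2" and p: "1 \<le> p"
    then have nk: "2 * k \<le> n" "p * (n - 2 * k) < (\<alpha> + 1) * (k + 1)" using pos by auto
    show "compact_embedding (X_space c n k R w) (norm_w c n k R w) (L_space p \<alpha> R) (norm_L p \<alpha> R)"
      by (rule sub[OF p nk])
  qed
qed

end
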